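(* Let $a,b$ be relatively prime integers with $a>0$, $b\neq 0$ and $a\neq 27b$, and let $c_p,\widetilde c_p$ denote the local Tamagawa numbers at a prime $p$ of $E_{C_3}(a,b)$ and $\widetilde E_{C_3}(a,b)$ respectively. (i) For every prime $p$ (including $p=3$) with $n=v_p(b)>0$, the curves have bad reduction at $p$ and $c_p=3n$, $\widetilde c_p=n$. (ii) A prime $p\neq 3$ not dividing $b$ is a prime of bad reduction if and only if either $v_p(a-27b)>0$ or $v_p(a)\not\equiv 0\pmod 3$. If $n=v_p(a-27b)>0$ and $p\equiv 1\pmod 6$, then $c_p=n$ and $\widetilde c_p=3n$; if $n=v_p(a-27b)>0$ and $p\equiv 2,5\pmod 6$, then $c_p=\widetilde c_p=2$ if $n$ is even and $c_p=\widetilde c_p=1$ if $n$ is odd. If $v_p(a)\not\equiv 0\pmod 3$, then $c_p=3$, and $\widetilde c_p=3$ if $p\equiv 1\pmod 6$, while $\widetilde c_p=1$ if $p\equiv 2,5\pmod 6$.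
   Context: For integers $a,b$, $E_{C_3}(a,b)$ is the curve $y^2+axy+a^2by=x^3$ over $\mathbb{Q}$ (with the point $(0,0)$ of order $3$), and $\widetilde E_{C_3}(a,b)$ is the curve $y^2+axy+a^2by=x^3-5a^3b\,x-a^4b(a+7b)$, which is a model of $E_{C_3}(a,b)/\langle(0,0)\rangle$. The local Tamagawa number at $p$ of an elliptic curve $E/\mathbb{Q}$ is $c_p=[E(\mathbb{Q}_p):E_0(\mathbb{Q}_p)]$, computed with respect to a $p$-minimal model, where $E_0$ denotes the points of nonsingular reduction. *)

theory Defs
  imports "HOL-Computational_Algebra.Computational_Algebra"
begin

text \<open>Weierstrass coefficients (a1,a2,a3,a4,a6) over a field.\<close>
type_synonym 'k ainv = "'k \<times> 'k \<times> 'k \<times> 'k \<times> 'k"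

text \<open>Points: None is the point at infinity O, Some (x,y) an affine point.\<close>
type_synonym 'k epoint = "('k \<times> 'k) option"

fun on_curve :: "'k::field ainv \<Rightarrow> 'k \<times> 'k \<Rightarrow> bool" where
  "on_curve (a1,a2,a3,a4,a6) (x,y) \<longleftrightarrow>
     y^2 + a1*x*y + a3*y = x^3 + a2*x^2 + a4*x + a6"

definition points :: "'k::field ainv \<Rightarrow> 'k epoint set" where
  "points A = insert None (Some ` {P. on_curve A P})"

fun eneg :: "'k::field ainv \<Rightarrow> 'k epoint \<Rightarrow> 'k epoint" where
  "eneg A None = None"
| "eneg (a1,a2,a3,a4,a6) (Some (x,y)) = Some (x, - y - a1*x - a3)"

fun eadd :: "'k::field ainv \<Rightarrow> 'k epoint \<Rightarrow> 'k epoint \<Rightarrow> 'k epoint" where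
  "eadd A None Q = Q"
| "eadd A P None = P"
| "eadd (a1,a2,a3,a4,a6) (Some (x1,y1)) (Some (x2,y2)) =
    (if x1 = x2 \<and> y1 + y2 + a1*x2 + a3 = 0 then None
     else
       (let l = (if x1 = x2 then (3*x1^2 + 2*a2*x1 + a4 - a1*y1) / (2*y1 + a1*x1 + a3)
                 else (y2 - y1) / (x2 - x1));
            nu = y1 - l*x1;
            x3 = l^2 + a1*l - a2 - x1 - x2;
            y3 = - (l + a1)*x3 - nu - a3
        in Some (x3, y3)))"

fun disc :: "'k::field ainv \<Rightarrow> 'k" where
  "disc (a1,a2,a3,a4,a6) =
    (let b2 = a1^2 + 4*a2; b4 = 2*a4 + a1*a3; b6 = a3^2 + 4*a6;
         b8 = a1^2*a6 + 4*a2*a6 - a1*a3*a4 + a2*a3^2 - a4^2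
     in - (b2^2*b8) - 8*b4^3 - 27*b6^2 + 9*b2*b4*b6)"

text \<open>Change of variables x = u^2 x' + r, y = u^3 y' + s u^2 x' + t (Silverman III.1).\<close>
fun wchange :: "'k::field ainv \<Rightarrow> 'k \<Rightarrow> 'k \<Rightarrow> 'k \<Rightarrow> 'k \<Rightarrow> 'k ainv" where
  "wchange (a1,a2,a3,a4,a6) u r s t =
    ((a1 + 2*s) / u,
     (a2 - s*a1 + 3*r - s^2) / u^2,
     (a3 + r*a1 + 2*t) / u^3,
     (a4 - s*a3 + 2*r*a2 - (t + r*s)*a1 + 3*r^2 - 2*s*t) / u^4,
     (a6 + r*a4 + r^2*a2 + r^3 - t*a3 - t^2 - r*t*a1) / u^6)"

text \<open>Valuation conventions: v is only meaningful on nonzero elements.\<close>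
definition vint :: "('k::field \<Rightarrow> int) \<Rightarrow> 'k \<Rightarrow> bool" where
  "vint v x \<longleftrightarrow> x = 0 \<or> 0 \<le> v x"

definition vpos :: "('k::field \<Rightarrow> int) \<Rightarrow> 'k \<Rightarrow> bool" where
  "vpos v x \<longleftrightarrow> x = 0 \<or> 0 < v x"

definition vge :: "('k::field \<Rightarrow> int) \<Rightarrow> 'k \<Rightarrow> int \<Rightarrow> bool" where
  "vge v x N \<longleftrightarrow> x = 0 \<or> N \<le> v x"

definition vunit :: "('k::field \<Rightarrow> int) \<Rightarrow> 'k \<Rightarrow> bool" where
  "vunit v x \<longleftrightarrow> x \<noteq> 0 \<and> v x = 0"

text \<open>(K, v) is a field of characteristic 0 with a normalized discrete valuation v,
  v(p) = 1, complete, with residue field of p elements; i.e. K is (isomorphic to) Q_p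
  with its p-adic valuation.\<close>
definition is_Qp :: "int \<Rightarrow> ('k::field_char_0 \<Rightarrow> int) \<Rightarrow> bool" where
  "is_Qp p v \<longleftrightarrow>
     prime p \<and>
     (\<forall>x y. x \<noteq> 0 \<longrightarrow> y \<noteq> 0 \<longrightarrow> v (x*y) = v x + v y) \<and>
     (\<forall>x y. x \<noteq> 0 \<longrightarrow> y \<noteq> 0 \<longrightarrow> x + y \<noteq> 0 \<longrightarrow> min (v x) (v y) \<le> v (x + y)) \<and>
     v (of_int p) = 1 \<and>
     (\<forall>x. vint v x \<longrightarrow> (\<exists>i\<in>{0..<p}. vpos v (x - of_int i))) \<and>
     (\<forall>f :: nat \<Rightarrow> 'k.
        (\<forall>N. \<exists>M. \<forall>m\<ge>M. \<forall>n\<ge>M. vge v (f m - f n) N) \<longrightarrow>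
        (\<exists>L. \<forall>N. \<exists>M. \<forall>n\<ge>M. vge v (f n - L) N))"

fun integral_model :: "('k::field \<Rightarrow> int) \<Rightarrow> 'k ainv \<Rightarrow> bool" where
  "integral_model v (a1,a2,a3,a4,a6) \<longleftrightarrow>
     vint v a1 \<and> vint v a2 \<and> vint v a3 \<and> vint v a4 \<and> vint v a6"

definition minimal_model :: "('k::field \<Rightarrow> int) \<Rightarrow> 'k ainv \<Rightarrow> 'k ainv \<Rightarrow> bool" where
  "minimal_model v A B \<longleftrightarrow>
     (\<exists>u r s t. u \<noteq> 0 \<and> B = wchange A u r s t) \<and> integral_model v B \<and>
     (\<forall>u r s t. u \<noteq> 0 \<longrightarrow> integral_model v (wchange A u r s t) \<longrightarrow>
        v (disc B) \<le> v (disc (wchange A u r s t)))"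

definition min_model :: "('k::field \<Rightarrow> int) \<Rightarrow> 'k ainv \<Rightarrow> 'k ainv" where
  "min_model v A = (SOME B. minimal_model v A B)"

text \<open>Points of nonsingular reduction, for an integral model A.\<close>
fun E0 :: "('k::field \<Rightarrow> int) \<Rightarrow> 'k ainv \<Rightarrow> 'k epoint set" where
  "E0 v (a1,a2,a3,a4,a6) =
     insert None (Some ` {(x,y). on_curve (a1,a2,a3,a4,a6) (x,y) \<and>
        (\<not> vint v x \<or> vunit v (2*y + a1*x + a3) \<or>
         vunit v (3*x^2 + 2*a2*x + a4 - a1*y))})"

definition coset_index :: "('k::field \<Rightarrow> int) \<Rightarrow> 'k ainv \<Rightarrow> nat" where
  "coset_index v A = card (points A //
      {(P,Q). P \<in> points A \<and> Q \<in> points A \<and> eadd A P (eneg A Q) \<in> E0 v A})"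

definition tamagawa :: "('k::field \<Rightarrow> int) \<Rightarrow> 'k ainv \<Rightarrow> nat" where
  "tamagawa v A = coset_index v (min_model v A)"

definition bad_reduction :: "('k::field \<Rightarrow> int) \<Rightarrow> 'k ainv \<Rightarrow> bool" where
  "bad_reduction v A \<longleftrightarrow> 0 < v (disc (min_model v A))"

definition EC3 :: "int \<Rightarrow> int \<Rightarrow> 'k::field ainv" where
  "EC3 a b = (of_int a, 0, of_int (a^2*b), 0, 0)"

definition EC3t :: "int \<Rightarrow> int \<Rightarrow> 'k::field ainv" where
  "EC3t a b = (of_int a, 0, of_int (a^2*b), of_int (-5*a^3*b), of_int (-(a^4*b*(a+7*b))))"

end

theory Submission
  imports Defs "HOL-Number_Theory.Number_Theory"
begin

text \<open>
  Two minimal equations differ by a change of variables with integral \<open>r, s, t\<close> and unit \<open>u\<close>, so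
  every minimal model may be used. Put the singular point of the reduction at the origin: \<open>E\<^sub>0\<close> is then
  the complement of the set \<open>S\<close> of points with \<open>v x > 0\<close>. Of three collinear points it never happens
  that exactly one lies in \<open>S\<close>, and for \<open>P, Q\<close> in \<open>S\<close> joined by a line of slope \<open>l\<close> the sum lies in \<open>E\<^sub>0\<close>
  unless \<open>l\<^sup>2 + a1 l - a2\<close> has positive valuation. Hence the index is found by exhibiting a function on
  \<open>S\<close> that separates the components, without proving the group law.

  At a node, Hensel's lemma removes \<open>a3\<close> and \<open>a4\<close>. If the tangents are rational the equation becomes
  \<open>y (y + c x) = x\<^sup>3 + d\<close> with \<open>v d\<close> the valuation of the discriminant, and the valuations of the factors
  \<open>y\<close> and \<open>y + c x\<close> identify the components with the integers modulo \<open>v d\<close>. Otherwise the quadratic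
  form on the left is anisotropic, which leaves at most one component besides \<open>E\<^sub>0\<close>, present exactly
  when \<open>v d\<close> is even. For additive reduction (types IV and IV*) the components correspond to the roots
  of a quadratic polynomial over the residue field. For \<open>p\<close> not dividing \<open>b\<close>, rationality of the
  tangents, or of the roots for the quotient curve, is that of the primitive cube roots of unity modulo \<open>p\<close>.
\<close>

section \<open>Valuations and Hensel's lemma\<close>

text \<open>Every rationality question is about the square root of -3. For \<open>p\<close> dividing
  \<open>a - 27*b\<close> the tangents at the node are the roots modulo \<open>p\<close> of
  \<open>T^2 + a*T + 243*b^2\<close> for \<open>EC3\<close> and of
  \<open>T^2 + a*T + 729*b^2\<close> for \<open>EC3t\<close>; putting a = 27b, their discriminants
  are -3 (9b)^2 and -3 (27b)^2. In the additive case \<open>EC3t\<close> leads to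
  \<open>\<eta>^2 + \<eta> + 7\<close>, of discriminant -27, whereas \<open>EC3\<close> leads to
  \<open>\<eta>^2 + \<eta>\<close> because its \<open>a6\<close> vanishes. Discriminants decide
  nothing at \<open>p = 2\<close>, so explicit substitutions into \<open>z^2 + z + 1\<close> take
  their place. For the same reason no square is completed over the local field: at a node the
  divisions are by the unit \<open>b2\<close>, never by 2.\<close>

locale padic_field =
  fixes p :: int and v :: "'k::field_char_0 \<Rightarrow> int"
  assumes is_Qp: "is_Qp p v"
begin

lemma prime_p: "prime p"
  using is_Qp by (simp add: is_Qp_def)

lemma v_mult: "x \<noteq> 0 \<Longrightarrow> y \<noteq> 0 \<Longrightarrow> v (x * y) = v x + v y"
  using is_Qp by (simp add: is_Qp_def)

lemma v_add: "x \<noteq> 0 \<Longrightarrow> y \<noteq> 0 \<Longrightarrow> x + y \<noteq> 0 \<Longrightarrow> min (v x) (v y) \<le> v (x + y)"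
  using is_Qp by (simp add: is_Qp_def)

lemma v_p: "v (of_int p) = 1"
  using is_Qp by (simp add: is_Qp_def)

lemma residue_exists: "vint v x \<Longrightarrow> \<exists>i\<in>{0..<p}. vpos v (x - of_int i)"
  using is_Qp by (simp add: is_Qp_def)

lemma complete:
  fixes f :: "nat \<Rightarrow> 'k"
  assumes "\<And>N. \<exists>M. \<forall>m\<ge>M. \<forall>n\<ge>M. vge v (f m - f n) N"
  obtains L where "\<And>N. \<exists>M. \<forall>n\<ge>M. vge v (f n - L) N"
  using is_Qp assms unfolding is_Qp_def by blast

lemma v_1 [simp]: "v 1 = 0"
  using v_mult[of 1 1] by simp

lemma v_minus [simp]: "v (- x) = v x"
proof (cases "x = 0")
  case False
  have "v (-1) + v (-1) = v ((-1) * (-1))"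
    by (rule v_mult[symmetric]) auto
  hence "v (-1) = 0" by simp
  with v_mult[of "-1" x] False show ?thesis by simp
qed simp

lemma v_inverse: "x \<noteq> 0 \<Longrightarrow> v (inverse x) = - v x"
  using v_mult[of x "inverse x"] by simp

lemma v_divide: "x \<noteq> 0 \<Longrightarrow> y \<noteq> 0 \<Longrightarrow> v (x / y) = v x - v y"
  by (simp add: divide_inverse v_mult v_inverse)

lemma v_power: "x \<noteq> 0 \<Longrightarrow> v (x ^ n) = int n * v x"
  by (induction n) (auto simp: v_mult algebra_simps)

section \<open>Lower bounds for valuations, integrality, positivity, units\<close>

lemma vge_0 [simp]: "vge v 0 n"
  by (simp add: vge_def)

lemma vge_1 [simp]: "vge v 1 n \<longleftrightarrow> n \<le> 0"
  by (simp add: vge_def)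

lemma vge_minus [simp]: "vge v (- x) n \<longleftrightarrow> vge v x n"
  by (simp add: vge_def)

lemma vge_mono: "vge v x n \<Longrightarrow> m \<le> n \<Longrightarrow> vge v x m"
  by (auto simp: vge_def)

lemma vge_add: "vge v x n \<Longrightarrow> vge v y n \<Longrightarrow> vge v (x + y) n"
  using v_add[of x y] by (cases "x = 0"; cases "y = 0"; cases "x + y = 0") (auto simp: vge_def)

lemma vge_diff: "vge v x n \<Longrightarrow> vge v y n \<Longrightarrow> vge v (x - y) n"
  using vge_add[of x n "-y"] by simp

lemma vge_mult: "vge v x m \<Longrightarrow> vge v y n \<Longrightarrow> vge v (x * y) (m + n)"
  by (cases "x = 0"; cases "y = 0") (auto simp: vge_def v_mult)

lemma vge_mult': "vge v x m \<Longrightarrow> vge v y n \<Longrightarrow> k \<le> m + n \<Longrightarrow> vge v (x * y) k"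
  using vge_mult vge_mono by blast

lemma vge_square: "vge v x m \<Longrightarrow> k \<le> 2 * m \<Longrightarrow> vge v (x ^ 2) k"
  by (simp add: power2_eq_square vge_mult')

lemma vge_cube: "vge v x m \<Longrightarrow> k \<le> 3 * m \<Longrightarrow> vge v (x ^ 3) k"
  by (cases "x = 0") (auto simp: vge_def v_power)

lemma vge_zeroI: "(\<And>n. vge v x n) \<Longrightarrow> x = 0"
proof (rule ccontr)
  assume "\<And>n. vge v x n" "x \<noteq> 0"
  from this(1)[of "v x + 1"] this(2) show False by (simp add: vge_def)
qed

lemma vint_iff: "vint v x \<longleftrightarrow> vge v x 0"
  by (simp add: vint_def vge_def)

lemma vpos_iff: "vpos v x \<longleftrightarrow> vge v x 1"
  by (auto simp: vpos_def vge_def)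

lemma vint_0 [simp]: "vint v 0" and vint_1 [simp]: "vint v 1"
  by (auto simp: vint_def)

lemma vint_minus [simp]: "vint v (- x) \<longleftrightarrow> vint v x"
  by (simp add: vint_iff)

lemma vint_add: "vint v x \<Longrightarrow> vint v y \<Longrightarrow> vint v (x + y)"
  by (simp add: vint_iff vge_add)

lemma vint_diff: "vint v x \<Longrightarrow> vint v y \<Longrightarrow> vint v (x - y)"
  by (simp add: vint_iff vge_diff)

lemma vint_mult: "vint v x \<Longrightarrow> vint v y \<Longrightarrow> vint v (x * y)"
  by (simp add: vint_iff vge_mult')

lemma vint_power: "vint v x \<Longrightarrow> vint v (x ^ n)"
  by (induction n) (auto simp: vint_mult)

lemma vint_of_nat [simp]: "vint v (of_nat n)"
  by (induction n) (auto simp: vint_add)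

lemma vint_of_int [simp]: "vint v (of_int i)"
  by (cases i rule: int_diff_cases) (auto simp: vint_diff)

lemma vint_numeral [simp]: "vint v (numeral n)"
  using vint_of_nat[of "numeral n"] by (simp del: vint_of_nat)

lemma vpos_0 [simp]: "vpos v 0" and vpos_1 [simp]: "\<not> vpos v 1"
  by (auto simp: vpos_def)

lemma vpos_minus [simp]: "vpos v (- x) \<longleftrightarrow> vpos v x"
  by (simp add: vpos_iff)

lemma vpos_imp_vint: "vpos v x \<Longrightarrow> vint v x"
  by (auto simp: vpos_def vint_def)

lemma vpos_add: "vpos v x \<Longrightarrow> vpos v y \<Longrightarrow> vpos v (x + y)"
  by (simp add: vpos_iff vge_add)

lemma vpos_diff: "vpos v x \<Longrightarrow> vpos v y \<Longrightarrow> vpos v (x - y)"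
  by (simp add: vpos_iff vge_diff)

lemma vpos_mult1: "vpos v x \<Longrightarrow> vint v y \<Longrightarrow> vpos v (x * y)"
  by (simp add: vpos_iff vint_iff vge_mult')

lemma vpos_mult2: "vint v x \<Longrightarrow> vpos v y \<Longrightarrow> vpos v (x * y)"
  by (simp add: vpos_iff vint_iff vge_mult')

lemma vpos_power: "vpos v x \<Longrightarrow> 0 < n \<Longrightarrow> vpos v (x ^ n)"
  by (cases n) (auto simp: vpos_mult1 vint_power vpos_imp_vint)

lemma vpos_power_iff: "0 < n \<Longrightarrow> vpos v (x ^ n) \<longleftrightarrow> vpos v x"
  by (cases "x = 0") (auto simp: vpos_def v_power zero_less_mult_iff)

lemma vint_power_iff: "0 < n \<Longrightarrow> vint v (x ^ n) \<longleftrightarrow> vint v x"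
  by (cases "x = 0") (auto simp: vint_def v_power zero_le_mult_iff)

lemma vunit_power: "vunit v x \<Longrightarrow> vunit v (x ^ n)"
  by (auto simp: vunit_def v_power)

lemma vunit_alt: "vunit v x \<longleftrightarrow> vint v x \<and> \<not> vpos v x"
  by (auto simp: vunit_def vint_def vpos_def)

lemma vunit_imp_vint: "vunit v x \<Longrightarrow> vint v x"
  by (simp add: vunit_alt)

lemma vunit_minus [simp]: "vunit v (- x) \<longleftrightarrow> vunit v x"
  by (simp add: vunit_alt)

lemma vunit_nonzero: "vunit v x \<Longrightarrow> x \<noteq> 0"
  by (simp add: vunit_def)

lemma vint_divide_unit [simp]: "vunit v u \<Longrightarrow> vint v (x / u) \<longleftrightarrow> vint v x"
  by (cases "x = 0") (auto simp: vunit_def vint_def v_divide)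

lemma vpos_divide_unit [simp]: "vunit v u \<Longrightarrow> vpos v (x / u) \<longleftrightarrow> vpos v x"
  by (cases "x = 0") (auto simp: vunit_def vpos_def v_divide)

lemma vunit_cong: "vpos v (x - y) \<Longrightarrow> vunit v x \<Longrightarrow> vunit v y"
  using vpos_add[of "x - y" y] vint_diff[of x "x - y"]
  by (auto simp: vunit_alt vpos_imp_vint)

lemma vpos_cong: "vpos v (x - y) \<Longrightarrow> vpos v x \<longleftrightarrow> vpos v y"
  using vpos_add[of "x - y" y] vpos_diff[of x "x - y"] by auto

lemmas vint_intros = vint_add vint_diff vint_mult vint_power vpos_imp_vint vunit_imp_vint

lemmas vpos_intros = vpos_add vpos_diff vpos_mult1 vpos_mult2 vpos_power

text \<open>If \<open>p\<close> does not divide \<open>i\<close>, a Bezout relation writes 1 as a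
  combination of \<open>i\<close> and \<open>p\<close>, so positivity of \<open>i\<close> would make
  1 positive.\<close>

lemma vpos_of_int [simp]: "vpos v (of_int i) \<longleftrightarrow> p dvd i"
proof
  assume "p dvd i"
  then obtain k where "i = p * k" ..
  moreover have "vpos v (of_int p)" by (simp add: vpos_def v_p)
  ultimately show "vpos v (of_int i)" by (simp add: vpos_mult1)
next
  assume i: "vpos v (of_int i)"
  show "p dvd i"
  proof (rule ccontr)
    assume "\<not> p dvd i"
    with prime_p have "coprime i p" using prime_imp_coprime coprime_commute by blast
    then obtain x y where "i * x + p * y = 1"
      by (metis bezout_int coprime_iff_gcd_eq_1 mult.commute)
    hence "of_int i * of_int x + of_int p * of_int y = (1::'k)"
      by (metis of_int_1 of_int_add of_int_mult)
    moreover have "vpos v (of_int i * of_int x + of_int p * of_int y)"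
      using i by (intro vpos_add vpos_mult1) (auto simp: vpos_def v_p)
    ultimately show False by simp
  qed
qed

lemma vunit_of_int [simp]: "vunit v (of_int i) \<longleftrightarrow> \<not> p dvd i"
  by (simp add: vunit_alt)

lemma v_of_int:
  assumes "i \<noteq> 0"
  shows "v (of_int i) = int (multiplicity p i)"
proof -
  from prime_p have "\<not> is_unit p" by auto
  with assms obtain k where k: "i = p ^ multiplicity p i * k" "\<not> p dvd k"
    using multiplicity_decompose' by metis
  with assms have "k \<noteq> 0" by auto
  have "v (of_int k) = 0" using k(2) vunit_of_int vunit_def by blast
  have "p \<noteq> 0" using prime_p by auto
  have "v (of_int i) = v (of_int p ^ multiplicity p i * of_int k)"
    by (subst k(1)) simp
  also have "\<dots> = int (multiplicity p i)"
    using \<open>k \<noteq> 0\<close> \<open>p \<noteq> 0\<close> \<open>v (of_int k) = 0\<close> by (simp add: v_mult v_power v_p)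
  finally show ?thesis .
qed

text \<open>Banach's theorem on the maximal ideal: each application of \<open>g\<close> gains one
  unit of valuation, so the iterates of 0 form a Cauchy sequence, and the limit stays in the maximal
  ideal because that is closed.\<close>

lemma contraction_fixpoint:
  fixes g :: "'k \<Rightarrow> 'k"
  assumes g: "\<And>x. vpos v x \<Longrightarrow> vpos v (g x)"
    and contr: "\<And>x y n. vpos v x \<Longrightarrow> vpos v y \<Longrightarrow> vge v (x - y) n \<Longrightarrow> vge v (g x - g y) (n + 1)"
  obtains x where "vpos v x" "g x = x"
proof -
  define f where "f n = (g ^^ n) 0" for n
  have f_pos: "vpos v (f n)" for n
    by (induction n) (auto simp: f_def g)
  have f_Suc: "f (Suc n) = g (f n)" for n by (simp add: f_def)
  have step: "vge v (f (n + k) - f n) (int n)" for n k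
  proof (induction n)
    case 0
    show ?case using f_pos[of k] by (simp add: f_def[of 0] vpos_imp_vint flip: vint_iff)
  next
    case (Suc n)
    from contr[OF f_pos f_pos Suc] show ?case by (simp add: f_Suc add.commute)
  qed
  have cauchy: "\<exists>M. \<forall>m\<ge>M. \<forall>n\<ge>M. vge v (f m - f n) N" for N
  proof (intro exI allI impI)
    fix m n assume "nat N \<le> m" "nat N \<le> n"
    then obtain i j where "m = nat N + i" "n = nat N + j" by (metis le_Suc_ex)
    hence "vge v (f m - f n) (int (nat N))"
      using vge_diff[OF step[of "nat N" i] step[of "nat N" j]] by simp
    thus "vge v (f m - f n) N" by (rule vge_mono) simp
  qed
  obtain L where L: "\<And>N. \<exists>M. \<forall>n\<ge>M. vge v (f n - L) N"
    using complete[of f] cauchy by blast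
  \<comment> \<open>An iterate and its successor are compared with the limit at the same accuracy,
    as passing to the limit in \<open>f (Suc n) = g (f n)\<close> requires.\<close>
  have near: "\<exists>n. vge v (f n - L) N \<and> vge v (f (Suc n) - L) N" for N
    using L[of N] by (meson le_Suc_eq order_refl)
  have L_pos: "vpos v L"
  proof -
    obtain n where "vge v (f n - L) 1" using near by blast
    with f_pos[of n] show ?thesis using vpos_cong vpos_iff by blast
  qed
  have "g L - L = 0"
  proof (rule vge_zeroI)
    fix N
    obtain n where n: "vge v (f n - L) N" "vge v (f (Suc n) - L) N" using near by blast
    have "vge v (f (Suc n) - g L) N"
      using contr[OF f_pos L_pos n(1)] by (auto simp: f_Suc intro: vge_mono)
    from vge_diff[OF n(2) this] show "vge v (g L - L) N" by simp
  qed
  with L_pos that show ?thesis by simp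
qed

text \<open>The root is the fixed point of \<open>x = - (e + g * x^2 + h * x^3) / f\<close>; on the
  maximal ideal the difference quotient of the right-hand side is positive, so this is a
  contraction. The only division is by the unit \<open>f\<close>, so residue characteristics 2 and 3
  are included.\<close>

lemma hensel_cubic:
  assumes e: "vpos v e" and f: "vunit v f" and g: "vint v g" and h: "vint v h"
  obtains x where "vpos v x" "e + f * x + g * x^2 + h * x^3 = 0"
proof -
  define F where "F x = - (e + g * x^2 + h * x^3) / f" for x
  have f0: "f \<noteq> 0" using f by (rule vunit_nonzero)
  obtain x where x: "vpos v x" "F x = x"
  proof (rule contraction_fixpoint[of F])
    fix x assume x: "vpos v x"
    have "vpos v (e + g * x^2 + h * x^3)"
      using e x g h by (intro vpos_intros) auto
    thus "vpos v (F x)" using f by (simp add: F_def del: minus_add_distrib)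
  next
    fix x y n assume x: "vpos v x" "vpos v y" "vge v (x - y) n"
    have *: "F x - F y = - (((g * (x + y) + h * (x^2 + x * y + y^2)) / f) * (x - y))"
      using f0 by (simp add: F_def field_simps) (simp add: algebra_simps power2_eq_square power3_eq_cube)
    have "vpos v ((g * (x + y) + h * (x^2 + x * y + y^2)) / f)"
      unfolding vpos_divide_unit[OF f] using x g h
      by (intro vpos_intros) (auto intro: vpos_imp_vint)
    from vge_mult[OF this[unfolded vpos_iff] x(3)] show "vge v (F x - F y) (n + 1)"
      unfolding * by (simp add: add.commute)
  qed blast
  have "x * f = - (e + g * x^2 + h * x^3)"
    using x(2) f0 unfolding F_def by (metis nonzero_divide_eq_eq)
  hence "e + f * x + g * x^2 + h * x^3 = 0"
    by (simp add: mult.commute)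
  with x(1) that show ?thesis by blast
qed

end

section \<open>Changes of variables and minimal models\<close>

definition b2 :: "'k::field ainv \<Rightarrow> 'k" where
  "b2 A = (case A of (a1,a2,a3,a4,a6) \<Rightarrow> a1^2 + 4*a2)"

definition b4 :: "'k::field ainv \<Rightarrow> 'k" where
  "b4 A = (case A of (a1,a2,a3,a4,a6) \<Rightarrow> 2*a4 + a1*a3)"

definition b6 :: "'k::field ainv \<Rightarrow> 'k" where
  "b6 A = (case A of (a1,a2,a3,a4,a6) \<Rightarrow> a3^2 + 4*a6)"

definition b8 :: "'k::field ainv \<Rightarrow> 'k" where
  "b8 A = (case A of (a1,a2,a3,a4,a6) \<Rightarrow>
     a1^2*a6 + 4*a2*a6 - a1*a3*a4 + a2*a3^2 - a4^2)"

definition c4 :: "'k::field ainv \<Rightarrow> 'k" where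
  "c4 A = b2 A ^ 2 - 24 * b4 A"

lemma disc_b: "disc A = - (b2 A ^ 2 * b8 A) - 8 * b4 A ^ 3 - 27 * b6 A ^ 2 + 9 * b2 A * b4 A * b6 A"
  by (cases A) (simp add: b2_def b4_def b6_def b8_def Let_def)

lemma b8_relation: "4 * b8 A = b2 A * b6 A - b4 A ^ 2"
  by (cases A) (simp add: b2_def b4_def b6_def b8_def algebra_simps power2_eq_square)

lemma wchange_scale: "u \<noteq> 0 \<Longrightarrow> wchange A u r s t = wchange (wchange A 1 r s t) u 0 0 0"
  by (cases A) simp

text \<open>Completing the square leaves the cubic 4x^3 + b2 x^2 + 2 b4 x + b6, on which
  \<open>s\<close> and \<open>t\<close> have no effect. These formulas therefore isolate
  \<open>r\<close>.\<close>

lemma b_shift: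
  "b2 (wchange A 1 r s t) = b2 A + 12 * r"
  "b4 (wchange A 1 r s t) = b4 A + r * b2 A + 6 * r^2"
  "b6 (wchange A 1 r s t) = b6 A + 2 * r * b4 A + r^2 * b2 A + 4 * r^3"
  "b8 (wchange A 1 r s t) = b8 A + 3 * r * b6 A + 3 * r^2 * b4 A + r^3 * b2 A + 3 * r^4"
  by (cases A; simp add: b2_def b4_def b6_def b8_def eval_nat_numeral; simp add: algebra_simps)+

lemma b_scale:
  shows "b2 (wchange A u 0 0 0) = b2 A / u^2"
    "b4 (wchange A u 0 0 0) = b4 A / u^4"
    "b6 (wchange A u 0 0 0) = b6 A / u^6"
    "b8 (wchange A u 0 0 0) = b8 A / u^8"
  by (cases A; simp add: b2_def b4_def b6_def b8_def divide_inverse eval_nat_numeral; simp add: algebra_simps)+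

lemma b_wchange:
  assumes "u \<noteq> 0"
  shows "u^2 * b2 (wchange A u r s t) = b2 A + 12 * r"
    "u^4 * b4 (wchange A u r s t) = b4 A + r * b2 A + 6 * r^2"
    "u^6 * b6 (wchange A u r s t) = b6 A + 2 * r * b4 A + r^2 * b2 A + 4 * r^3"
    "u^8 * b8 (wchange A u r s t) = b8 A + 3 * r * b6 A + 3 * r^2 * b4 A + r^3 * b2 A + 3 * r^4"
  by (subst wchange_scale[OF assms], simp add: b_scale b_shift assms)+

lemma c4_wchange:
  assumes "u \<noteq> 0"
  shows "u^4 * c4 (wchange A u r s t) = c4 A"
proof -
  have "u^4 * c4 (wchange A u r s t) = (u^2 * b2 (wchange A u r s t))^2 - 24 * (u^4 * b4 (wchange A u r s t))"
    by (simp add: c4_def power_mult_distrib right_diff_distrib flip: power_mult)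
  also have "\<dots> = c4 A"
    unfolding b_wchange[OF assms] c4_def by (simp add: algebra_simps power2_eq_square)
  finally show ?thesis .
qed

text \<open>\<open>b8_relation\<close> eliminates \<open>b8\<close> at the cost of a factor 4, which
  can be cancelled in characteristic 0. All remaining monomials have weight 12, whence the twelfth
  power in \<open>disc_wchange\<close>.\<close>

lemma disc_b_246:
  fixes A :: "'k::field_char_0 ainv"
  shows "4 * disc A = 36 * b2 A * b4 A * b6 A - b2 A ^ 3 * b6 A + b2 A ^ 2 * b4 A ^ 2
    - 32 * b4 A ^ 3 - 108 * b6 A ^ 2"
proof -
  have "4 * disc A = - (b2 A ^ 2 * (4 * b8 A)) - 32 * b4 A ^ 3 - 108 * b6 A ^ 2 + 36 * b2 A * b4 A * b6 A"
    unfolding disc_b by simp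
  thus ?thesis
    unfolding b8_relation by (simp add: algebra_simps power2_eq_square power3_eq_cube)
qed

lemma disc_wchange:
  fixes A :: "'k::field_char_0 ainv"
  assumes "u \<noteq> 0"
  shows "u^12 * disc (wchange A u r s t) = disc A"
proof -
  define B where "B = wchange A u r s t"
  define x y z where xyz: "x = b2 A" "y = b4 A" "z = b6 A"
  have B2: "u^2 * b2 B = x + 12 * r" and B4: "u^4 * b4 B = y + r * x + 6 * r^2"
    and B6: "u^6 * b6 B = z + 2 * r * y + r^2 * x + 4 * r^3"
    unfolding B_def xyz by (rule b_wchange[OF assms])+
  have "4 * (u^12 * disc B) = u^12 * (4 * disc B)" by simp
  also have "\<dots> = 36 * (u^2 * b2 B) * (u^4 * b4 B) * (u^6 * b6 B) - (u^2 * b2 B) ^ 3 * (u^6 * b6 B)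
     + (u^2 * b2 B) ^ 2 * (u^4 * b4 B) ^ 2 - 32 * (u^4 * b4 B) ^ 3 - 108 * (u^6 * b6 B) ^ 2"
    unfolding disc_b_246 by (simp add: eval_nat_numeral) (simp add: algebra_simps)
  also have "\<dots> = 36 * x * y * z - x ^ 3 * z + x ^ 2 * y ^ 2 - 32 * y ^ 3 - 108 * z ^ 2"
    unfolding B2 B4 B6 by (simp add: algebra_simps power2_eq_square power3_eq_cube)
  also have "\<dots> = 4 * disc A" by (simp add: disc_b_246 xyz)
  finally show ?thesis by (simp add: B_def)
qed

lemma disc_nonzero_wchange:
  fixes A :: "'k::field_char_0 ainv"
  shows "u \<noteq> 0 \<Longrightarrow> disc (wchange A u r s t) = 0 \<longleftrightarrow> disc A = 0"
  using disc_wchange[of u A r s t] by auto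

lemma wchange_wchange:
  assumes "u \<noteq> 0" "u' \<noteq> 0"
  shows "wchange (wchange A u r s t) u' r' s' t' =
    wchange A (u * u') (r + u^2 * r') (s + u * s') (t + u^2 * s * r' + u^3 * t')"
proof (cases A)
  case (fields a1 a2 a3 a4 a6)
  show ?thesis
    unfolding fields wchange.simps prod.inject using assms
    by (intro conjI; simp add: field_simps eval_nat_numeral)
qed

text \<open>This solves the composition law for the second change, so that two models of one curve
  can be compared directly.\<close>

lemma wchange_relative:
  assumes "u \<noteq> 0" "u' \<noteq> 0"
  shows "wchange A u' r' s' t' = wchange (wchange A u r s t) (u' / u) ((r' - r) / u^2)
    ((s' - s) / u) ((t' - t - s * (r' - r)) / u^3)"
  using assms by (subst wchange_wchange) (auto simp: field_simps)

section \<open>Integral changes of variables and minimality\<close>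

context padic_field
begin

text \<open>If \<open>r\<close> were not integral, dividing the formula for \<open>b6\<close> by
  \<open>r^3\<close> would make 4 positive and dividing that for \<open>b8\<close> by
  \<open>r^4\<close> would make 3 positive, hence also 4 - 3 = 1; so no residue characteristic is
  exceptional. Then \<open>s\<close> and \<open>t\<close> are roots of monic quadratics with
  integral coefficients.\<close>

lemma wchange_integral_unit:
  assumes A: "integral_model v A" and B: "integral_model v (wchange A u r s t)" and u: "vunit v u"
  shows "vint v r" "vint v s" "vint v t"
proof -
  obtain a1 a2 a3 a4 a6 where a: "A = (a1,a2,a3,a4,a6)" by (cases A)
  obtain d1 d2 d3 d4 d6 where d: "wchange A u r s t = (d1,d2,d3,d4,d6)"
    by (cases "wchange A u r s t")
  note u0 = vunit_nonzero[OF u] and ui = vunit_imp_vint[OF u]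
  have ai: "vint v a1" "vint v a2" "vint v a3" "vint v a4" "vint v a6" using A by (auto simp: a)
  have di: "vint v d1" "vint v d2" "vint v d3" "vint v d4" "vint v d6" using B by (auto simp: d)
  have b_int: "vint v (b2 A)" "vint v (b4 A)" "vint v (b6 A)" "vint v (b8 A)"
    unfolding a b2_def b4_def b6_def b8_def prod.case using ai
    by (auto intro!: vint_add vint_diff vint_mult vint_power)
  have b_int': "vint v (u^6 * b6 (wchange A u r s t))" "vint v (u^8 * b8 (wchange A u r s t))"
    unfolding d b6_def b8_def prod.case using di ui
    by (auto intro!: vint_add vint_diff vint_mult vint_power)
  show r: "vint v r"
  proof (rule ccontr)
    assume r: "\<not> vint v r"
    hence r0: "r \<noteq> 0" and vr: "v r < 0" by (auto simp: vint_def)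
    define z where "z = inverse r"
    have z: "vpos v z" using r0 vr by (simp add: z_def vpos_def v_inverse)
    have "4 = z^3 * (u^6 * b6 (wchange A u r s t)) - z^3 * b6 A - 2 * z^2 * b4 A - z * b2 A"
      unfolding b_wchange[OF u0] z_def using r0 by (simp add: field_simps eval_nat_numeral)
    moreover have "vpos v \<dots>"
      using z b_int b_int' by (intro vpos_diff) (simp_all add: vpos_intros vint_intros)
    ultimately have four: "vpos v (4::'k)" by simp
    have "3 = z^4 * (u^8 * b8 (wchange A u r s t)) - z^4 * b8 A - 3 * z^3 * b6 A - 3 * z^2 * b4 A - z * b2 A"
      unfolding b_wchange[OF u0] z_def using r0 by (simp add: field_simps eval_nat_numeral)
    moreover have "vpos v \<dots>"
      using z b_int b_int' by (intro vpos_diff) (simp_all add: vpos_intros vint_intros)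
    ultimately have "vpos v (3::'k)" by simp
    from vpos_diff[OF four this] show False by simp
  qed
  show s: "vint v s"
  proof (rule ccontr)
    assume "\<not> vint v s"
    hence s0: "s \<noteq> 0" and vs: "v s < 0" by (auto simp: vint_def)
    define z where "z = inverse s"
    have z: "vpos v z" using s0 vs by (simp add: z_def vpos_def v_inverse)
    have d2: "u^2 * d2 = a2 - s*a1 + 3*r - s^2" using d u0 by (auto simp: a)
    have "1 = z^2 * (a2 + 3 * r - u^2 * d2) - z * a1"
      unfolding d2 z_def using s0 by (simp add: field_simps eval_nat_numeral)
    moreover have "vpos v \<dots>"
      using z ai di ui r by (intro vpos_diff) (simp_all add: vpos_intros vint_intros)
    ultimately show False by simp
  qed
  show "vint v t"
  proof (rule ccontr)
    assume "\<not> vint v t"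
    hence t0: "t \<noteq> 0" and vt: "v t < 0" by (auto simp: vint_def)
    define z where "z = inverse t"
    have z: "vpos v z" using t0 vt by (simp add: z_def vpos_def v_inverse)
    have d6: "u^6 * d6 = a6 + r*a4 + r^2*a2 + r^3 - t*a3 - t^2 - r*t*a1" using d u0 by (auto simp: a)
    have "1 = z^2 * (a6 + r*a4 + r^2*a2 + r^3 - u^6 * d6) - z * (a3 + r * a1)"
      unfolding d6 z_def using t0 by (simp add: field_simps eval_nat_numeral)
    moreover have "vpos v \<dots>"
      using z ai di ui r by (intro vpos_diff) (simp_all add: vpos_intros vint_intros)
    ultimately show False by simp
  qed
qed

lemma vint_disc: "integral_model v A \<Longrightarrow> vint v (disc A)"
  unfolding disc_b
  by (cases A) (auto simp: b2_def b4_def b6_def b8_def intro!: vint_add vint_diff vint_mult vint_power)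

lemma vint_c4: "integral_model v A \<Longrightarrow> vint v (c4 A)"
  unfolding c4_def
  by (cases A) (auto simp: b2_def b4_def intro!: vint_add vint_diff vint_mult vint_power)

lemma v_disc_wchange:
  assumes "u \<noteq> 0" "disc A \<noteq> 0"
  shows "v (disc (wchange A u r s t)) = v (disc A) - 12 * v u"
proof -
  have "disc (wchange A u r s t) \<noteq> 0" using assms by (simp add: disc_nonzero_wchange)
  with assms show ?thesis using disc_wchange[OF assms(1), of A r s t] v_mult[of "u^12" "disc (wchange A u r s t)"]
    by (simp add: v_power)
qed

text \<open>A further scaling \<open>w\<close> divides the discriminant by \<open>w^12\<close> and
  \<open>c4\<close> by \<open>w^4\<close>. If \<open>v w\<close> were positive, the first would
  become nonintegral when \<open>v (disc M) < 12\<close>, and the second when \<open>c4 M\<close> is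
  a unit.\<close>

lemma minimal_modelI:
  assumes M: "M = wchange A u r s t" and u: "u \<noteq> 0" and int: "integral_model v M"
    and nz: "disc A \<noteq> 0" and small: "v (disc M) < 12 \<or> vunit v (c4 M)"
  shows "minimal_model v A M"
proof -
  have "v (disc M) \<le> v (disc (wchange A u' r' s' t'))"
    if u': "u' \<noteq> 0" and int': "integral_model v (wchange A u' r' s' t')" for u' r' s' t'
  proof -
    define w where "w = u' / u"
    have w: "w \<noteq> 0" using u u' by (simp add: w_def)
    obtain r2 s2 t2 where W: "wchange A u' r' s' t' = wchange M w r2 s2 t2"
      using wchange_relative[OF u u'] M w_def by metis
    have nzM: "disc M \<noteq> 0" using nz u by (simp add: M disc_nonzero_wchange)
    have D: "v (disc (wchange M w r2 s2 t2)) = v (disc M) - 12 * v w"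
      by (rule v_disc_wchange[OF w nzM])
    have D0: "0 \<le> v (disc (wchange M w r2 s2 t2))"
      using vint_disc[OF int'] nzM w unfolding W by (auto simp: vint_def disc_nonzero_wchange)
    have "v w \<le> 0"
      using small
    proof
      assume "v (disc M) < 12"
      with D D0 show ?thesis by linarith
    next
      assume c: "vunit v (c4 M)"
      have "w^4 * c4 (wchange M w r2 s2 t2) = c4 M" by (rule c4_wchange[OF w])
      moreover from this have "c4 (wchange M w r2 s2 t2) \<noteq> 0" using vunit_nonzero[OF c] by auto
      moreover have "vint v (c4 (wchange M w r2 s2 t2))"
        using vint_c4[OF int'] by (simp add: W)
      ultimately have "4 * v w + v (c4 (wchange M w r2 s2 t2)) = 0" "0 \<le> v (c4 (wchange M w r2 s2 t2))"
        using c w v_mult[of "w^4" "c4 (wchange M w r2 s2 t2)"] by (auto simp: v_power vunit_def vint_def)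
      thus ?thesis by linarith
    qed
    with D W show ?thesis by simp
  qed
  with M u int show ?thesis unfolding minimal_model_def by blast
qed

text \<open>\<open>min_model\<close> is a Hilbert choice, and an explicit \<open>M\<close> shows
  that there is something to choose. Both discriminants have the least valuation, so the scaling
  \<open>u\<close> between the two models satisfies 12 v(u) = 0.\<close>

lemma min_model_relation:
  assumes M: "minimal_model v A M" and nz: "disc A \<noteq> 0"
  obtains u r s t where "min_model v A = wchange M u r s t" "vunit v u" "vint v r" "vint v s" "vint v t"
    "integral_model v M" "integral_model v (min_model v A)" "v (disc (min_model v A)) = v (disc M)"
proof -
  have B: "minimal_model v A (min_model v A)"
    unfolding min_model_def by (rule someI[of _ M]) (rule M)
  obtain u1 r1 s1 t1 where M1: "u1 \<noteq> 0" "M = wchange A u1 r1 s1 t1" "integral_model v M"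
    using M unfolding minimal_model_def by blast
  obtain u2 r2 s2 t2 where B1: "u2 \<noteq> 0" "min_model v A = wchange A u2 r2 s2 t2" "integral_model v (min_model v A)"
    using B unfolding minimal_model_def by blast
  have eq: "v (disc (min_model v A)) = v (disc M)"
    using M B M1 B1 unfolding minimal_model_def by (metis order_antisym)
  define u where "u = u2 / u1"
  have u: "u \<noteq> 0" using M1 B1 by (simp add: u_def)
  obtain r s t where W: "min_model v A = wchange M u r s t"
    using wchange_relative[OF M1(1) B1(1)] M1 B1 u_def by metis
  have "disc M \<noteq> 0" using nz M1 by (simp add: disc_nonzero_wchange)
  with v_disc_wchange[OF u this, of r s t] eq u have "vunit v u" by (simp add: W vunit_def)
  with W eq M1 B1 wchange_integral_unit[of M u r s t] that show ?thesis by metis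
qed

end

section \<open>Invariance of the index\<close>

text \<open>Sends points of the transformed curve \<open>wchange A u r s t\<close> to points of \<open>A\<close>.\<close>

fun emap :: "'k::field \<Rightarrow> 'k \<Rightarrow> 'k \<Rightarrow> 'k \<Rightarrow> 'k epoint \<Rightarrow> 'k epoint" where
  "emap u r s t None = None"
| "emap u r s t (Some (x,y)) = Some (u^2 * x + r, u^3 * y + s * u^2 * x + t)"

text \<open>The system is triangular: each coefficient is expressed by new coefficients and earlier
  old ones. Unfolding from the last equation to the first eliminates the old coefficients and leaves
  polynomial identities.\<close>

lemma wchange_inverse:
  assumes "u \<noteq> 0" and "wchange (a1,a2,a3,a4,a6) u r s t = (d1,d2,d3,d4,d6)"
  shows "a1 = u * d1 - 2 * s" "a2 = u^2 * d2 + s * a1 - 3 * r + s^2"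
    "a3 = u^3 * d3 - r * a1 - 2 * t"
    "a4 = u^4 * d4 + s * a3 - 2 * r * a2 + (t + r * s) * a1 - 3 * r^2 + 2 * s * t"
    "a6 = u^6 * d6 - r * a4 - r^2 * a2 - r^3 + t * a3 + t^2 + r * t * a1"
  using assms by (auto simp: field_simps)

lemma on_curve_emap:
  assumes "u \<noteq> 0" and "wchange A u r s t = B"
  shows "on_curve A (u^2 * x + r, u^3 * y + s * u^2 * x + t) \<longleftrightarrow> on_curve B (x, y)"
proof -
  obtain a1 a2 a3 a4 a6 where A: "A = (a1,a2,a3,a4,a6)" by (cases A)
  obtain d1 d2 d3 d4 d6 where B: "B = (d1,d2,d3,d4,d6)" by (cases B)
  note W = wchange_inverse[OF assms(1) assms(2)[unfolded A B]]
  define X Y where XY: "X = u^2 * x + r" "Y = u^3 * y + s * u^2 * x + t"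
  have eq: "Y^2 + a1*X*Y + a3*Y - (X^3 + a2*X^2 + a4*X + a6) =
      u^6 * (y^2 + d1*x*y + d3*y - (x^3 + d2*x^2 + d4*x + d6))"
    unfolding W(5) unfolding W(4) unfolding W(3) unfolding W(2) unfolding W(1) XY
    by (simp add: algebra_simps eval_nat_numeral)
  have "Y^2 + a1*X*Y + a3*Y = X^3 + a2*X^2 + a4*X + a6 \<longleftrightarrow>
      y^2 + d1*x*y + d3*y - (x^3 + d2*x^2 + d4*x + d6) = 0"
    unfolding eq_iff_diff_eq_0[of "Y^2 + a1*X*Y + a3*Y"] eq using assms(1) by simp
  thus ?thesis unfolding XY[symmetric] A B on_curve.simps by simp
qed

lemma eneg_emap:
  assumes "u \<noteq> 0" and "wchange A u r s t = B"
  shows "eneg A (emap u r s t P) = emap u r s t (eneg B P)"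
proof (cases P)
  case (Some xy)
  obtain x y where P: "P = Some (x, y)" using Some by (cases xy) auto
  obtain a1 a2 a3 a4 a6 where A: "A = (a1,a2,a3,a4,a6)" by (cases A)
  obtain d1 d2 d3 d4 d6 where B: "B = (d1,d2,d3,d4,d6)" by (cases B)
  note W = wchange_inverse[OF assms(1) assms(2)[unfolded A B]]
  show ?thesis
    unfolding P A B W(3) unfolding W(1) by (simp add: algebra_simps eval_nat_numeral)
qed (cases A; cases B; simp)

lemma on_curve_eq_x:
  assumes "on_curve (a1,a2,a3,a4,a6) (x,y)" "on_curve (a1,a2,a3,a4,a6) (x,y')"
    and "y + y' + a1 * x + a3 \<noteq> 0"
  shows "y = y'"
proof -
  have "(y - y') * (y + y' + a1 * x + a3) = (y^2 + a1*x*y + a3*y) - (y'^2 + a1*x*y' + a3*y')"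
    by (simp add: algebra_simps power2_eq_square)
  also have "\<dots> = 0" using assms(1,2) by simp
  finally show ?thesis using assms(3) by simp
qed

lemma eadd_emap:
  assumes "u \<noteq> 0" and "wchange A u r s t = B" and "P \<in> points B" "Q \<in> points B"
  shows "eadd A (emap u r s t P) (emap u r s t Q) = emap u r s t (eadd B P Q)"
proof (cases "P = None \<or> Q = None")
  case True
  thus ?thesis by (cases P; cases Q) auto
next
  case False
  then obtain x1 y1 x2 y2 where PQ: "P = Some (x1, y1)" "Q = Some (x2, y2)" by auto
  obtain a1 a2 a3 a4 a6 where A: "A = (a1,a2,a3,a4,a6)" by (cases A)
  obtain d1 d2 d3 d4 d6 where B: "B = (d1,d2,d3,d4,d6)" by (cases B)
  note W = wchange_inverse[OF assms(1) assms(2)[unfolded A B]]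
  define X1 Y1 X2 Y2 where XY: "X1 = u^2 * x1 + r" "Y1 = u^3 * y1 + s * u^2 * x1 + t"
    "X2 = u^2 * x2 + r" "Y2 = u^3 * y2 + s * u^2 * x2 + t"
  have X_eq: "X1 = X2 \<longleftrightarrow> x1 = x2" using assms(1) by (simp add: XY)
  have neg_eq: "Y1 + Y2 + a1 * X2 + a3 = u^3 * (y1 + y2 + d1 * x2 + d3)" if "x1 = x2"
    unfolding W(3) unfolding W(1) XY that by (simp add: algebra_simps eval_nat_numeral)
  have on: "on_curve B (x1, y1)" "on_curve B (x2, y2)"
    using assms(3,4) by (auto simp: points_def PQ)
  show ?thesis
  proof (cases "x1 = x2 \<and> y1 + y2 + d1 * x2 + d3 = 0")
    case True
    hence "X1 = X2 \<and> Y1 + Y2 + a1 * X2 + a3 = 0" using neg_eq X_eq by simp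
    with True show ?thesis
      unfolding PQ emap.simps XY[symmetric] A B eadd.simps by (simp only: simp_thms if_True emap.simps)
  next
    case False
    define l where "l = (if x1 = x2 then (3*x1^2 + 2*d2*x1 + d4 - d1*y1) / (2*y1 + d1*x1 + d3)
      else (y2 - y1) / (x2 - x1))"
    define L where "L = (if X1 = X2 then (3*X1^2 + 2*a2*X1 + a4 - a1*Y1) / (2*Y1 + a1*X1 + a3)
      else (Y2 - Y1) / (X2 - X1))"
    have L: "L = u * l + s"
    proof (cases "x1 = x2")
      case True
      with False on have "y1 = y2" by (auto intro: on_curve_eq_x simp: B)
      define D where "D = 2*y1 + d1*x1 + d3"
      have D: "D \<noteq> 0" using False True \<open>y1 = y2\<close> by (auto simp: D_def)
      have "2*Y1 + a1*X1 + a3 = u^3 * D"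
        unfolding W(3) unfolding W(1) XY D_def by (simp add: algebra_simps eval_nat_numeral)
      moreover have "3*X1^2 + 2*a2*X1 + a4 - a1*Y1 = u^4 * (3*x1^2 + 2*d2*x1 + d4 - d1*y1) + s * u^3 * D"
        unfolding W(4) unfolding W(3) unfolding W(2) unfolding W(1) XY D_def
        by (simp add: algebra_simps eval_nat_numeral)
      ultimately have "L = (u^4 * (3*x1^2 + 2*d2*x1 + d4 - d1*y1) + s * u^3 * D) / (u^3 * D)"
        using True X_eq by (simp add: L_def)
      also have "\<dots> = u * ((3*x1^2 + 2*d2*x1 + d4 - d1*y1) / D) + s"
        using D assms(1) by (simp add: field_simps eval_nat_numeral)
      finally show ?thesis using True by (simp add: l_def D_def)
    next
      case False
      hence "x2 - x1 \<noteq> 0" by simp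
      moreover have "X2 - X1 = u^2 * (x2 - x1)" "Y2 - Y1 = u^3 * (y2 - y1) + s * u^2 * (x2 - x1)"
        by (simp_all add: XY algebra_simps)
      ultimately show ?thesis using False X_eq assms(1)
        unfolding L_def l_def by (simp add: divide_simps) (simp add: algebra_simps eval_nat_numeral)
    qed
    have "eadd B P Q = Some (l^2 + d1*l - d2 - x1 - x2, - (l + d1)*(l^2 + d1*l - d2 - x1 - x2) - (y1 - l * x1) - d3)"
      unfolding PQ B using False by (simp only: eadd.simps l_def[symmetric] Let_def if_False)
    moreover have "eadd A (Some (X1, Y1)) (Some (X2, Y2)) =
      Some (L^2 + a1*L - a2 - X1 - X2, - (L + a1)*(L^2 + a1*L - a2 - X1 - X2) - (Y1 - L * X1) - a3)"
    proof -
      have "\<not> (X1 = X2 \<and> Y1 + Y2 + a1 * X2 + a3 = 0)"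
        using False X_eq neg_eq assms(1) by auto
      thus ?thesis
        unfolding A by (simp only: eadd.simps L_def[symmetric] Let_def if_False)
    qed
    moreover have X3: "L^2 + a1*L - a2 - X1 - X2 = u^2 * (l^2 + d1*l - d2 - x1 - x2) + r"
      unfolding W(2) unfolding W(1) XY L by (simp add: algebra_simps eval_nat_numeral)
    moreover have "- (L + a1)*(u^2 * x3 + r) - (Y1 - L * X1) - a3 =
        u^3 * (- (l + d1)*x3 - (y1 - l * x1) - d3) + s * u^2 * x3 + t" for x3
      unfolding W(3) unfolding W(1) XY L by (simp add: algebra_simps eval_nat_numeral)
    ultimately show ?thesis unfolding PQ emap.simps XY[symmetric] by simp
  qed
qed

lemma card_quotient_image:
  assumes bij: "bij_betw f X Y" and RX: "R \<subseteq> X \<times> X" and RY: "S \<subseteq> Y \<times> Y"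
    and RS: "\<And>x x'. x \<in> X \<Longrightarrow> x' \<in> X \<Longrightarrow> (f x, f x') \<in> S \<longleftrightarrow> (x, x') \<in> R"
  shows "card (Y // S) = card (X // R)"
proof -
  have img: "f ` X = Y" and inj: "inj_on f X" using bij by (auto simp: bij_betw_def)
  have "S `` {f x} = f ` (R `` {x})" if "x \<in> X" for x
    using RX RY RS that img by auto blast+
  hence "Y // S = (\<lambda>C. f ` C) ` (X // R)"
    unfolding quotient_def img[symmetric] by auto
  moreover have "inj_on (\<lambda>C. f ` C) (X // R)"
  proof (rule inj_onI)
    fix C D assume "C \<in> X // R" "D \<in> X // R" and eq: "f ` C = f ` D"
    hence "C \<subseteq> X" "D \<subseteq> X" using RX by (auto simp: quotient_def)
    with inj eq show "C = D" by (simp add: inj_on_image_eq_iff)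
  qed
  ultimately show ?thesis by (simp add: card_image)
qed

text \<open>A relation that is the kernel of a classifying function has one class per value. The
  coset relation is handled through such a function instead of through associativity of
  \<open>eadd\<close>.\<close>

lemma card_quotient_kernel:
  assumes "\<And>x y. x \<in> X \<Longrightarrow> y \<in> X \<Longrightarrow> r x y \<longleftrightarrow> f x = f y"
  shows "card (X // {(x,y). x \<in> X \<and> y \<in> X \<and> r x y}) = card (f ` X)"
proof -
  have "{(x,y). x \<in> X \<and> y \<in> X \<and> r x y} `` {x} = {y \<in> X. f y = f x}" if "x \<in> X" for x
    using assms that by auto
  hence "X // {(x,y). x \<in> X \<and> y \<in> X \<and> r x y} = (\<lambda>c. {y \<in> X. f y = c}) ` (f ` X)"
    unfolding quotient_def by auto
  moreover have "inj_on (\<lambda>c. {y \<in> X. f y = c}) (f ` X)"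
    by (rule inj_onI) blast
  ultimately show ?thesis by (simp add: card_image)
qed

lemma eneg_points: "P \<in> points A \<Longrightarrow> eneg A P \<in> points A"
  by (cases A; cases P) (auto simp: points_def algebra_simps power2_eq_square)

lemma eneg_eneg [simp]: "eneg A (eneg A P) = P"
  by (cases A; cases P) auto

section \<open>Transport of \<open>E0\<close> and of the index along integral changes\<close>

context padic_field
begin

text \<open>\<open>y\<close> is a root of a monic quadratic with integral coefficients.\<close>

lemma vint_y:
  assumes "integral_model v (a1,a2,a3,a4,a6)" "on_curve (a1,a2,a3,a4,a6) (x,y)" "vint v x"
  shows "vint v y"
proof (rule ccontr)
  assume "\<not> vint v y"
  hence y0: "y \<noteq> 0" and vy: "v y < 0" by (auto simp: vint_def)
  define z where "z = inverse y"
  have z: "vpos v z" using y0 vy by (simp add: z_def vpos_def v_inverse)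
  have on: "x^3 + a2*x^2 + a4*x + a6 = y^2 + a1*x*y + a3*y" using assms(2) by simp
  have "1 = z^2 * (x^3 + a2*x^2 + a4*x + a6) - z * (a1 * x + a3)"
    unfolding on z_def using y0 by (simp add: field_simps eval_nat_numeral)
  moreover have "vpos v \<dots>"
    using z assms(1,3) by (intro vpos_diff) (simp_all add: vpos_intros vint_intros)
  ultimately show False by simp
qed

text \<open>Up to sign, the partial derivatives of the equation transform by an integral triangular
  matrix with diagonal entries \<open>u^3\<close> and \<open>u^4\<close>, which are units; so they
  vanish together modulo \<open>p\<close> in either coordinate system.\<close>

lemma E0_emap:
  assumes u: "vunit v u" and W: "wchange A u r s t = B"
    and A: "integral_model v A" and B: "integral_model v B" and rst: "vint v r" "vint v s" "vint v t"
  shows "emap u r s t P \<in> E0 v A \<longleftrightarrow> P \<in> E0 v B"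
proof (cases P)
  case None
  thus ?thesis by (cases A; cases B) simp
next
  case (Some xy)
  obtain x y where P: "P = Some (x, y)" using Some by (cases xy) auto
  obtain a1 a2 a3 a4 a6 where a: "A = (a1,a2,a3,a4,a6)" by (cases A)
  obtain d1 d2 d3 d4 d6 where d: "B = (d1,d2,d3,d4,d6)" by (cases B)
  note u0 = vunit_nonzero[OF u] and ui = vunit_imp_vint[OF u]
  note I = wchange_inverse[OF u0 W[unfolded a d]]
  define X Y where XY: "X = u^2 * x + r" "Y = u^3 * y + s * u^2 * x + t"
  have on: "on_curve A (X, Y) \<longleftrightarrow> on_curve B (x, y)"
    unfolding XY by (rule on_curve_emap[OF u0 W])
  have u2: "vunit v (u^n)" for n using u by (rule vunit_power)
  have vX: "vint v X \<longleftrightarrow> vint v x"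
  proof
    assume "vint v X"
    hence "vint v ((X - r) / u^2)" using u2 rst by (simp add: vint_diff)
    thus "vint v x" using u0 by (simp add: XY)
  qed (simp add: XY rst ui vint_intros)
  define G H where GH: "G = 2*y + d1*x + d3" "H = 3*x^2 + 2*d2*x + d4 - d1*y"
  have G: "2*Y + a1*X + a3 = u^3 * G"
    unfolding I(3) unfolding I(1) XY GH by (simp add: algebra_simps eval_nat_numeral)
  have H: "3*X^2 + 2*a2*X + a4 - a1*Y = u^4 * H + s * u^3 * G"
    unfolding I(4) unfolding I(3) unfolding I(2) unfolding I(1) XY GH
    by (simp add: algebra_simps eval_nat_numeral)
  have unit_mult: "vunit v (u^n * g) \<longleftrightarrow> vunit v g" for n g
    using u0 u by (cases "g = 0") (auto simp: vunit_def v_mult v_power)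
  have "vunit v (u^3 * G) \<or> vunit v (u^4 * H + s * u^3 * G) \<longleftrightarrow> vunit v G \<or> vunit v H"
    if on': "on_curve B (x,y)" and x: "vint v x"
  proof (cases "vunit v G")
    case False
    have "vint v y" using vint_y on' x B d by blast
    hence Gi: "vint v G" using x B by (simp add: d GH vint_intros)
    hence "vpos v (s * u^3 * G)" using False rst ui by (auto simp: vunit_alt intro: vpos_mult2 vint_mult vint_power)
    hence "vunit v (u^4 * H + s * u^3 * G) \<longleftrightarrow> vunit v (u^4 * H)"
      using vunit_cong[of "u^4 * H + s * u^3 * G" "u^4 * H"] vunit_cong[of "u^4 * H" "u^4 * H + s * u^3 * G"]
      by auto
    with False show ?thesis by (simp add: unit_mult)
  qed (simp add: unit_mult)
  hence "(on_curve A (X,Y) \<and> (\<not> vint v X \<or> vunit v (2*Y + a1*X + a3) \<or> vunit v (3*X^2 + 2*a2*X + a4 - a1*Y)))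
    \<longleftrightarrow> (on_curve B (x,y) \<and> (\<not> vint v x \<or> vunit v G \<or> vunit v H))"
    unfolding G H vX on by blast
  thus ?thesis unfolding P emap.simps XY[symmetric] GH a d E0.simps by auto
qed

lemma coset_index_wchange:
  assumes u: "vunit v u" and W: "wchange A u r s t = B"
    and A: "integral_model v A" and B: "integral_model v B" and rst: "vint v r" "vint v s" "vint v t"
  shows "coset_index v B = coset_index v A"
proof -
  note u0 = vunit_nonzero[OF u]
  define \<phi> where "\<phi> = emap u r s t"
  have inj: "inj_on \<phi> (points B)"
  proof (rule inj_onI)
    fix P Q assume "\<phi> P = \<phi> Q"
    thus "P = Q" using u0 by (cases P; cases Q) (auto simp: \<phi>_def)
  qed
  have "\<phi> ` points B = points A"
  proof (intro subset_antisym subsetI)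
    fix P assume "P \<in> \<phi> ` points B"
    thus "P \<in> points A" using on_curve_emap[OF u0 W] by (auto simp: \<phi>_def points_def)
  next
    fix P assume P: "P \<in> points A"
    show "P \<in> \<phi> ` points B"
    proof (cases P)
      case None
      have "\<phi> None = P" "None \<in> points B" by (auto simp: \<phi>_def None points_def)
      thus ?thesis by blast
    next
      case (Some xy)
      obtain X Y where XY: "P = Some (X, Y)" using Some by (cases xy) auto
      define x where "x = (X - r) / u^2"
      define y where "y = (Y - s * u^2 * x - t) / u^3"
      have eq: "u^2 * x + r = X" "u^3 * y + s * u^2 * x + t = Y"
        using u0 by (simp_all add: x_def y_def)
      have "on_curve B (x, y)" using P on_curve_emap[OF u0 W, of x y] by (auto simp: XY points_def eq)
      hence "Some (x, y) \<in> points B" by (simp add: points_def)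
      moreover have "\<phi> (Some (x, y)) = P" by (simp add: \<phi>_def eq XY)
      ultimately show ?thesis by blast
    qed
  qed
  with inj have "bij_betw \<phi> (points B) (points A)" by (simp add: bij_betw_def)
  moreover have "eadd A (\<phi> P) (eneg A (\<phi> Q)) \<in> E0 v A \<longleftrightarrow> eadd B P (eneg B Q) \<in> E0 v B"
    if "P \<in> points B" "Q \<in> points B" for P Q
    using E0_emap[OF assms] eadd_emap[OF u0 W that(1) eneg_points[OF that(2)]] eneg_emap[OF u0 W, of Q]
    by (simp add: \<phi>_def)
  ultimately have "card (points A // {(P,Q). P \<in> points A \<and> Q \<in> points A \<and> eadd A P (eneg A Q) \<in> E0 v A}) =
    card (points B // {(P,Q). P \<in> points B \<and> Q \<in> points B \<and> eadd B P (eneg B Q) \<in> E0 v B})"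
    by (intro card_quotient_image[of \<phi>]) (auto dest: bij_betwE)
  thus ?thesis by (simp add: coset_index_def)
qed

lemma tamagawa_eq:
  assumes "minimal_model v A M" and "disc A \<noteq> 0"
  shows "tamagawa v A = coset_index v M"
proof -
  obtain u r s t where "min_model v A = wchange M u r s t" "vunit v u" "vint v r" "vint v s" "vint v t"
    "integral_model v M" "integral_model v (min_model v A)"
    using min_model_relation[OF assms] .
  thus ?thesis unfolding tamagawa_def by (metis coset_index_wchange)
qed

lemma bad_reduction_eq:
  assumes "minimal_model v A M" and "disc A \<noteq> 0"
  shows "bad_reduction v A \<longleftrightarrow> 0 < v (disc M)"
  using min_model_relation[OF assms] unfolding bad_reduction_def by metis

end

section \<open>Equations with singular reduction at the origin\<close>

text \<open>The last equation, with denominators cleared, holds for chords and tangents alike.\<close>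

definition is_slope :: "'k::field ainv \<Rightarrow> 'k \<times> 'k \<Rightarrow> 'k \<times> 'k \<Rightarrow> 'k \<Rightarrow> bool" where
  "is_slope A P Q l = (case (A, P, Q) of ((a1,a2,a3,a4,a6), (x1,y1), (x2,y2)) \<Rightarrow>
     \<not> (x1 = x2 \<and> y1 + y2 + a1*x2 + a3 = 0) \<and>
     l * (x2 - x1) = y2 - y1 \<and>
     l * (y1 + y2 + a1*x2 + a3) = x1^2 + x1*x2 + x2^2 + a2*(x1 + x2) + a4 - a1*y1)"

lemma slope_exists:
  assumes on: "on_curve (a1,a2,a3,a4,a6) (x1,y1)" "on_curve (a1,a2,a3,a4,a6) (x2,y2)"
    and neq: "\<not> (x1 = x2 \<and> y1 + y2 + a1*x2 + a3 = 0)"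
  obtains l where "is_slope (a1,a2,a3,a4,a6) (x1,y1) (x2,y2) l"
    and "eadd (a1,a2,a3,a4,a6) (Some (x1,y1)) (Some (x2,y2)) =
      Some (l^2 + a1*l - a2 - x1 - x2, - (l + a1)*(l^2 + a1*l - a2 - x1 - x2) - (y1 - l * x1) - a3)"
proof -
  define l where "l = (if x1 = x2 then (3*x1^2 + 2*a2*x1 + a4 - a1*y1) / (2*y1 + a1*x1 + a3)
      else (y2 - y1) / (x2 - x1))"
  have "eadd (a1,a2,a3,a4,a6) (Some (x1,y1)) (Some (x2,y2)) =
      Some (l^2 + a1*l - a2 - x1 - x2, - (l + a1)*(l^2 + a1*l - a2 - x1 - x2) - (y1 - l * x1) - a3)"
    using neq by (simp only: eadd.simps l_def[symmetric] Let_def if_False)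
  moreover have "is_slope (a1,a2,a3,a4,a6) (x1,y1) (x2,y2) l"
  proof (cases "x1 = x2")
    case True
    with neq on have "y1 = y2" by (auto intro: on_curve_eq_x)
    moreover from this True neq have "2*y1 + a1*x1 + a3 \<noteq> 0" by auto
    ultimately show ?thesis using True neq
      by (simp add: is_slope_def l_def) (simp add: algebra_simps power2_eq_square)
  next
    case False
    hence l: "l * (x2 - x1) = y2 - y1" by (simp add: l_def)
    \<comment> \<open>The factor \<open>x2 - x1\<close> divides the difference of the two curve
      equations once \<open>l\<close> is inserted; cancelling it yields the form that also describes
      tangents.\<close>
    have "(x2 - x1) * (l * (y1 + y2 + a1*x2 + a3)) = (l * (x2 - x1)) * (y1 + y2 + a1*x2 + a3)"
      by (simp add: algebra_simps)
    also have "\<dots> = (y2^2 + a1*x2*y2 + a3*y2) - (y1^2 + a1*x1*y1 + a3*y1) - a1*y1*(x2 - x1)"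
      unfolding l by (simp add: algebra_simps power2_eq_square)
    also have "\<dots> = (x2^3 + a2*x2^2 + a4*x2 + a6) - (x1^3 + a2*x1^2 + a4*x1 + a6) - a1*y1*(x2 - x1)"
      using on by simp
    also have "\<dots> = (x2 - x1) * (x1^2 + x1*x2 + x2^2 + a2*(x1 + x2) + a4 - a1*y1)"
      by (simp add: algebra_simps power2_eq_square power3_eq_cube)
    finally show ?thesis using False l neq by (simp add: is_slope_def)
  qed
  ultimately show ?thesis using that by blast
qed

text \<open>Vieta for the cubic obtained by substituting the line \<open>y = l*x + m\<close>: the
  definition of \<open>x3\<close> supplies the sum of the roots, and the cleared slope equation
  determines \<open>a4\<close>.\<close>

lemma slope_vieta:
  assumes "is_slope (a1,a2,a3,a4,a6) (x1,y1) (x2,y2) l"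
    and x3: "x3 = l^2 + a1*l - a2 - x1 - x2" and m: "m = y1 - l * x1"
  shows "x1*x2 + x1*x3 + x2*x3 = a4 - 2*l*m - a1*m - a3*l"
proof -
  have y2: "y2 = y1 + l * (x2 - x1)" using assms(1) by (simp add: is_slope_def)
  have "l * (y1 + y2 + a1*x2 + a3) = x1^2 + x1*x2 + x2^2 + a2*(x1 + x2) + a4 - a1*y1"
    using assms(1) by (simp add: is_slope_def)
  hence a4: "a4 = l * (y1 + y2 + a1*x2 + a3) - (x1^2 + x1*x2 + x2^2 + a2*(x1 + x2)) + a1*y1"
    by (simp add: algebra_simps)
  show ?thesis unfolding a4 y2 x3 m by (simp add: algebra_simps power2_eq_square)
qed

text \<open>The two symmetric functions give \<open>a2\<close> and \<open>a4\<close>, the first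
  point gives \<open>a6\<close>. After substitution the claim is an identity in the abscissas and
  the line, the same for chord and tangent.\<close>

lemma slope_third_point:
  assumes on: "on_curve (a1,a2,a3,a4,a6) (x1,y1)"
    and sl: "is_slope (a1,a2,a3,a4,a6) (x1,y1) (x2,y2) l"
    and x3: "x3 = l^2 + a1*l - a2 - x1 - x2"
  shows "on_curve (a1,a2,a3,a4,a6) (x3, l * x3 + (y1 - l * x1))"
proof -
  define m where "m = y1 - l * x1"
  have y1: "y1 = l * x1 + m" by (simp add: m_def)
  have e2: "a4 = x1*x2 + x1*x3 + x2*x3 + 2*l*m + a1*m + a3*l"
    using slope_vieta[OF sl x3 m_def] by simp
  have a2: "a2 = l^2 + a1*l - x1 - x2 - x3" by (simp add: x3)
  have a6: "a6 = y1^2 + a1*x1*y1 + a3*y1 - (x1^3 + a2*x1^2 + a4*x1)" using on by simp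
  show ?thesis
    unfolding m_def[symmetric] on_curve.simps a6 unfolding y1 e2 a2
    by (simp add: algebra_simps power2_eq_square power3_eq_cube)
qed

section \<open>The singular point of the reduction and lines through it\<close>

context padic_field
begin

lemma vpos_multD: "vpos v (x * y) \<Longrightarrow> vpos v x \<or> vpos v y"
  by (cases "x = 0"; cases "y = 0") (auto simp: vpos_def v_mult)

text \<open>The last three conditions say that the reduction passes through (0,0) and that both
  partial derivatives vanish there.\<close>

definition singular_model :: "'k ainv \<Rightarrow> bool" where
  "singular_model A = (case A of (a1,a2,a3,a4,a6) \<Rightarrow>
     vint v a1 \<and> vint v a2 \<and> vpos v a3 \<and> vpos v a4 \<and> vpos v a6)"

lemma singular_model_integral: "singular_model A \<Longrightarrow> integral_model v A"
  by (cases A) (auto simp: singular_model_def vpos_imp_vint)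

lemma singular_vpos_y:
  assumes A: "singular_model (a1,a2,a3,a4,a6)" and on: "on_curve (a1,a2,a3,a4,a6) (x,y)" and x: "vpos v x"
  shows "vpos v y"
proof -
  have y: "vint v y"
    using vint_y[OF singular_model_integral[OF A] on vpos_imp_vint[OF x]] .
  have "y^2 = x^3 + a2*x^2 + a4*x + a6 - (a1*x*y + a3*y)" using on by (simp add: algebra_simps)
  also have "vpos v \<dots>"
    using A x y by (intro vpos_diff vpos_add) (simp_all add: singular_model_def vpos_intros vint_intros)
  finally show ?thesis by (simp add: vpos_power_iff)
qed

lemma singular_E0_iff:
  assumes A: "singular_model A" and on: "on_curve A (x,y)"
  shows "Some (x,y) \<in> E0 v A \<longleftrightarrow> \<not> vpos v x"
proof -
  obtain a1 a2 a3 a4 a6 where a: "A = (a1,a2,a3,a4,a6)" by (cases A)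
  have ai: "vint v a1" "vint v a2" "vpos v a3" "vpos v a4" "vpos v a6"
    using A by (auto simp: a singular_model_def)
  define G H where GH: "G = 2*y + a1*x + a3" "H = 3*x^2 + 2*a2*x + a4 - a1*y"
  have E0: "Some (x,y) \<in> E0 v A \<longleftrightarrow> \<not> vint v x \<or> vunit v G \<or> vunit v H"
    using on unfolding a GH by auto
  show ?thesis
  proof
    assume "\<not> vpos v x"
    show "Some (x,y) \<in> E0 v A"
    proof (rule ccontr)
      assume "Some (x,y) \<notin> E0 v A"
      hence x: "vint v x" and nG: "\<not> vunit v G" and nH: "\<not> vunit v H" by (auto simp: E0)
      have y: "vint v y" using vint_y[of a1 a2 a3 a4 a6 x y] singular_model_integral[OF A] on x a by blast
      have "vint v G" "vint v H"
        unfolding GH using ai x y by (simp_all add: vint_intros)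
      with nG nH have GH': "vpos v G" "vpos v H" by (auto simp: vunit_alt)
      have "y^2 + a1*x*y + a3*y = x^3 + a2*x^2 + a4*x + a6" using on by (simp add: a)
      hence a6': "a6 = y^2 + a1*x*y + a3*y - (x^3 + a2*x^2 + a4*x)" by simp
      \<comment> \<open>Combining the equation with both partial derivatives isolates
        \<open>x^3\<close> with coefficient 1, so singular points of the reduction have abscissa 0
        even in residue characteristics 2 and 3.\<close>
      have "x^3 = x * H - y * G - a3 * y + a4 * x + 2 * a6"
        unfolding a6' GH by (simp add: algebra_simps power2_eq_square power3_eq_cube)
      also have "vpos v \<dots>"
        using ai x y GH' by (intro vpos_diff vpos_add) (simp_all add: vpos_intros vint_intros)
      finally have "vpos v x" by (simp add: vpos_power_iff)
      with \<open>\<not> vpos v x\<close> show False ..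
    qed
  next
    assume S: "Some (x,y) \<in> E0 v A"
    show "\<not> vpos v x"
    proof
      assume x: "vpos v x"
      have y: "vpos v y" using singular_vpos_y[of a1 a2 a3 a4 a6 x y] A on x a by blast
      have "vpos v G" "vpos v H"
        unfolding GH using ai x y by (simp_all add: vpos_intros vint_intros)
      with S x show False by (simp add: E0 vunit_alt vpos_imp_vint)
    qed
  qed
qed

text \<open>A line through the singular point of the reduction meets it with multiplicity at least two.\<close>

lemma two_of_three_singular:
  assumes A: "singular_model (a1,a2,a3,a4,a6)"
    and e1: "x1 + x2 + x3 = l^2 + a1*l - a2"
    and e2: "x1*x2 + x1*x3 + x2*x3 = a4 - 2*l*m - a1*m - a3*l"
    and x1: "vpos v x1" and y1: "vpos v (l * x1 + m)"
  shows "vpos v x2 \<or> vpos v x3"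
proof -
  have ai: "vint v a1" "vint v a2" "vpos v a3" "vpos v a4" "vpos v a6"
    using A by (auto simp: singular_model_def)
  have sum: "x2 + x3 = l^2 + a1*l - a2 - x1" using e1 by (simp add: algebra_simps)
  have prod: "x2 * x3 = a4 - 2*l*m - a1*m - a3*l - x1 * (x2 + x3)" using e2 by (simp add: algebra_simps)
  show ?thesis
  proof (cases "vint v l")
    case True
    have m: "vpos v m" using vpos_diff[OF y1 vpos_mult2[OF True x1]] by simp
    have "vpos v (x2 * x3)"
      unfolding prod sum using True m ai x1
      by (intro vpos_diff) (simp_all add: vpos_intros vint_intros)
    thus ?thesis by (rule vpos_multD)
  next
    \<comment> \<open>A nonintegral slope means a vertical line modulo \<open>p\<close>. Vieta's
      relations are scaled by \<open>z^2\<close> with z = 1/l, and \<open>m\<close> is replaced by w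
      = m/l, which is positive because the line meets the neighbourhood of the origin.\<close>
    case False
    hence l0: "l \<noteq> 0" and vl: "v l < 0" by (auto simp: vint_def)
    define z where "z = inverse l"
    have z: "vpos v z" using l0 vl by (simp add: z_def vpos_def v_inverse)
    have zl: "z * l = 1" using l0 by (simp add: z_def)
    define w where "w = z * m"
    have "w = z * (l * x1 + m) - x1" using zl by (simp add: w_def algebra_simps)
    hence w: "vpos v w" using vpos_diff[OF vpos_mult2[OF vpos_imp_vint[OF z] y1] x1] by simp
    have sum': "z^2 * x2 + z^2 * x3 = 1 + (a1*z - (a2 + x1)*z^2)"
      using l0 unfolding distrib_left[symmetric] sum z_def
      by (simp add: field_simps power2_eq_square)
    have s: "vpos v (a1*z - (a2 + x1)*z^2)"
      using z ai x1 by (simp add: vpos_intros vint_intros)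
    have prod': "z^2 * (x2 * x3) = z^2 * a4 - 2 * w - a1 * (z * w) - a3 * z - x1 * (1 + (a1*z - (a2 + x1)*z^2))"
      unfolding sum'[symmetric] prod w_def using l0 unfolding z_def
      by (simp add: field_simps power2_eq_square)
    have p: "vpos v (z^2 * (x2 * x3))"
      unfolding prod' using z w ai x1 by (intro vpos_diff) (simp_all add: vpos_intros vint_intros)
    show ?thesis
    proof (rule ccontr)
      \<comment> \<open>If neither abscissa were positive, the positive product would make
        \<open>z^2 * x2\<close> and \<open>z^2 * x3\<close> both positive, although their sum is 1
        up to a positive term.\<close>
      assume "\<not> ?thesis"
      moreover from p have "vpos v ((z^2 * x2) * x3)" "vpos v ((z^2 * x3) * x2)"
        by (simp_all add: algebra_simps)
      ultimately have "vpos v (z^2 * x2 + z^2 * x3)"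
        by (meson vpos_multD vpos_add)
      with s have "vpos v 1" unfolding sum' using vpos_diff by fastforce
      thus False by simp
    qed
  qed
qed

text \<open>\<open>l^2 + a1*l - a2\<close> is the tangent cone \<open>y^2 + a1*x*y - a2*x^2\<close>
  in the direction (1, l): two singular points have a singular sum exactly when their line is
  tangent to the reduction at the origin.\<close>

lemma singular_sum_iff:
  assumes A: "singular_model (a1,a2,a3,a4,a6)"
    and on: "on_curve (a1,a2,a3,a4,a6) (x1,y1)" "on_curve (a1,a2,a3,a4,a6) (x2,y2)"
    and sl: "is_slope (a1,a2,a3,a4,a6) (x1,y1) (x2,y2) l"
    and x3: "x3 = l^2 + a1*l - a2 - x1 - x2"
  shows "vpos v x3 \<longleftrightarrow> (if vpos v x1 \<and> vpos v x2 then vpos v (l^2 + a1*l - a2) else vpos v x1 \<or> vpos v x2)"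
proof -
  define m where "m = y1 - l * x1"
  have y1: "l * x1 + m = y1" and y2: "l * x2 + m = y2"
    using sl by (simp_all add: m_def is_slope_def algebra_simps)
  have e1: "x1 + x2 + x3 = l^2 + a1*l - a2" by (simp add: x3)
  have e2: "x1*x2 + x1*x3 + x2*x3 = a4 - 2*l*m - a1*m - a3*l"
    by (rule slope_vieta[OF sl x3 m_def])
  have on3: "on_curve (a1,a2,a3,a4,a6) (x3, l * x3 + m)"
    unfolding m_def by (rule slope_third_point[OF on(1) sl x3])
  have both: "vpos v x3 \<longleftrightarrow> vpos v (l^2 + a1*l - a2)" if "vpos v x1" "vpos v x2"
    using vpos_cong[of "l^2 + a1*l - a2" x3] that vpos_add[OF that] by (simp add: x3)
  have first: "vpos v x2 \<or> vpos v x3" if "vpos v x1"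
    using two_of_three_singular[OF A e1 e2 that] singular_vpos_y[OF A on(1) that] y1 by simp
  have second: "vpos v x1 \<or> vpos v x3" if "vpos v x2"
    using two_of_three_singular[OF A, of x2 x1 x3 l m] e1 e2 that singular_vpos_y[OF A on(2) that] y2
    by (simp add: algebra_simps)
  have third: "vpos v x1 \<or> vpos v x2" if "vpos v x3"
    using two_of_three_singular[OF A, of x3 x1 x2 l m] e1 e2 that singular_vpos_y[OF A on3 that]
    by (simp add: algebra_simps)
  from both first second third show ?thesis by auto
qed

definition singular_points :: "'k ainv \<Rightarrow> ('k \<times> 'k) set" where
  "singular_points A = {(x,y). on_curve A (x,y) \<and> vpos v x}"

text \<open>The coset relation subtracts, which is why \<open>f\<close> compares the first point
  with the negative of the second. The class added by \<open>Suc\<close> is \<open>E0\<close>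
  itself, encoded by the value \<open>None\<close> of \<open>g\<close>.\<close>

lemma coset_index_components:
  assumes A: "singular_model (a1,a2,a3,a4,a6)"
    and f: "\<And>x1 y1 x2 y2 l. (x1,y1) \<in> singular_points (a1,a2,a3,a4,a6) \<Longrightarrow>
        (x2,y2) \<in> singular_points (a1,a2,a3,a4,a6) \<Longrightarrow>
        is_slope (a1,a2,a3,a4,a6) (x1,y1) (x2,y2) l \<Longrightarrow>
        vpos v (l^2 + a1*l - a2) \<longleftrightarrow> f (x1,y1) \<noteq> f (x2, - y2 - a1*x2 - a3)"
    and fin: "finite (f ` singular_points (a1,a2,a3,a4,a6))"
  shows "coset_index v (a1,a2,a3,a4,a6) = Suc (card (f ` singular_points (a1,a2,a3,a4,a6)))"
proof -
  define B where "B = (a1,a2,a3,a4,a6)"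
  define g where "g P = (case P of None \<Rightarrow> None | Some (x,y) \<Rightarrow> if vpos v x then Some (f (x,y)) else None)" for P
  have key: "eadd B P Q \<in> E0 v B \<longleftrightarrow> g P = g (eneg B Q)" if PQ: "P \<in> points B" "Q \<in> points B" for P Q
  proof -
    consider "P = None" | "Q = None" | x1 y1 x2 y2 where "P = Some (x1,y1)" "Q = Some (x2,y2)"
      by (cases P; cases Q) auto
    thus ?thesis
    proof cases
      case 1
      show ?thesis
      proof (cases Q)
        case None
        thus ?thesis using 1 by (simp add: B_def)
      next
        case (Some xy)
        obtain x y where Q: "Q = Some (x,y)" using Some by (cases xy) auto
        have "on_curve B (x,y)" using PQ Q by (auto simp: points_def)
        with 1 Q show ?thesis using singular_E0_iff[of B x y] A by (simp add: B_def g_def)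
      qed
    next
      case 2
      show ?thesis
      proof (cases P)
        case None
        thus ?thesis using 2 by (simp add: B_def)
      next
        case (Some xy)
        obtain x y where P: "P = Some (x,y)" using Some by (cases xy) auto
        have "on_curve B (x,y)" using PQ P by (auto simp: points_def)
        with 2 P show ?thesis using singular_E0_iff[of B x y] A by (simp add: B_def g_def)
      qed
    next
      case 3
      have on: "on_curve B (x1,y1)" "on_curve B (x2,y2)" using PQ 3 by (auto simp: points_def)
      show ?thesis
      proof (cases "x1 = x2 \<and> y1 + y2 + a1*x2 + a3 = 0")
        case True
        hence "y1 = - y2 - a1*x2 - a3" by (simp add: algebra_simps eq_neg_iff_add_eq_0)
        with True 3 show ?thesis by (simp add: B_def)
      next
        case False
        obtain l where sl: "is_slope B (x1,y1) (x2,y2) l" and add: "eadd B P Q =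
            Some (l^2 + a1*l - a2 - x1 - x2, - (l + a1)*(l^2 + a1*l - a2 - x1 - x2) - (y1 - l * x1) - a3)"
          using slope_exists[OF on[unfolded B_def] False] 3 unfolding B_def by metis
        define x3 where "x3 = l^2 + a1*l - a2 - x1 - x2"
        define y3 where "y3 = - (l + a1)*x3 - (y1 - l * x1) - a3"
        have add: "eadd B P Q = Some (x3, y3)" unfolding add x3_def y3_def ..
        have "on_curve B (x3, l * x3 + (y1 - l * x1))"
          using slope_third_point[OF on(1)[unfolded B_def] sl[unfolded B_def] x3_def] by (simp add: B_def)
        hence "Some (x3, l * x3 + (y1 - l * x1)) \<in> points B" by (simp add: points_def)
        from eneg_points[OF this] have "Some (x3, - (l * x3 + (y1 - l * x1)) - a1 * x3 - a3) \<in> points B"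
          by (simp add: B_def)
        hence "on_curve B (x3, y3)" by (auto simp: points_def y3_def algebra_simps)
        hence E: "eadd B P Q \<in> E0 v B \<longleftrightarrow> \<not> vpos v x3"
          unfolding add using singular_E0_iff[of B] A by (simp add: B_def)
        note S = singular_sum_iff[OF A on[unfolded B_def] sl[unfolded B_def] x3_def]
        have "vpos v (l^2 + a1*l - a2) \<longleftrightarrow> f (x1,y1) \<noteq> f (x2, - y2 - a1*x2 - a3)" if "vpos v x1" "vpos v x2"
          using f[of x1 y1 x2 y2 l] on that sl by (simp add: singular_points_def B_def)
        thus ?thesis unfolding E S using 3 by (auto simp: g_def B_def)
      qed
    qed
  qed
  have "coset_index v B = card (g ` points B)"
    unfolding coset_index_def
    by (rule card_quotient_kernel) (simp add: key eneg_points)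
  also have "g ` points B = insert None (Some ` f ` singular_points B)"
  proof (intro subset_antisym subsetI)
    fix z assume "z \<in> g ` points B"
    thus "z \<in> insert None (Some ` f ` singular_points B)"
      by (auto simp: g_def points_def singular_points_def)
  next
    fix z assume "z \<in> insert None (Some ` f ` singular_points B)"
    thus "z \<in> g ` points B"
    proof
      assume "z = None"
      hence "z = g None" "None \<in> points B" by (auto simp: g_def points_def)
      thus ?thesis by blast
    next
      assume "z \<in> Some ` f ` singular_points B"
      then obtain x y where "(x,y) \<in> singular_points B" "z = Some (f (x,y))" by auto
      hence "z = g (Some (x,y))" "Some (x,y) \<in> points B"
        by (auto simp: g_def points_def singular_points_def)
      thus ?thesis by blast
    qed
  qed
  also have "card \<dots> = Suc (card (f ` singular_points B))"
    using fin by (subst card_insert_disjoint) (auto simp: B_def card_image)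
  finally show ?thesis by (simp add: B_def)
qed

lemma coset_index_no_singular_points:
  assumes "singular_model A" "singular_points A = {}"
  shows "coset_index v A = 1"
proof -
  obtain a1 a2 a3 a4 a6 where A: "A = (a1,a2,a3,a4,a6)" by (cases A)
  have "coset_index v A = Suc (card ((\<lambda>_. ()) ` singular_points A))"
    unfolding A by (rule coset_index_components) (use assms in \<open>auto simp: A\<close>)
  thus ?thesis using assms by simp
qed

end

section \<open>Nodes with rational tangents\<close>

text \<open>The third clause of \<open>is_slope\<close> is asymmetric; exchanging the points changes
  it by \<open>a1\<close> times the second clause.\<close>

lemma is_slope_commute:
  assumes "is_slope A (x1,y1) (x2,y2) l"
  shows "is_slope A (x2,y2) (x1,y1) l"
proof -
  obtain a1 a2 a3 a4 a6 where A: "A = (a1,a2,a3,a4,a6)" by (cases A)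
  have neq: "\<not> (x1 = x2 \<and> y1 + y2 + a1*x2 + a3 = 0)" and l: "l * (x2 - x1) = y2 - y1"
    and s: "l * (y1 + y2 + a1*x2 + a3) = x1^2 + x1*x2 + x2^2 + a2*(x1 + x2) + a4 - a1*y1"
    using assms by (auto simp: is_slope_def A)
  have "l * (y2 + y1 + a1*x1 + a3) = l * (y1 + y2 + a1*x2 + a3) - a1 * (l * (x2 - x1))"
    by (simp add: algebra_simps)
  also have "\<dots> = x2^2 + x2*x1 + x1^2 + a2*(x2 + x1) + a4 - a1*y2"
    unfolding s l by (simp add: algebra_simps)
  finally have "l * (y2 + y1 + a1*x1 + a3) = \<dots>" .
  moreover have "l * (x1 - x2) = y1 - y2" using l by (simp add: algebra_simps)
  ultimately show ?thesis using neq by (auto simp: is_slope_def A algebra_simps)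
qed

section \<open>Exact valuations and the components at a split node\<close>

context padic_field
begin

text \<open>\<open>v 0\<close> is an arbitrary integer, so \<open>v x = n\<close> alone would not
  express an exact valuation.\<close>

definition vex :: "'k \<Rightarrow> int \<Rightarrow> bool" where
  "vex x n \<longleftrightarrow> x \<noteq> 0 \<and> v x = n"

lemma vex_iff: "vex x n \<longleftrightarrow> vge v x n \<and> \<not> vge v x (n + 1)"
  by (auto simp: vex_def vge_def)

lemma vex_imp_vge: "vex x n \<Longrightarrow> vge v x n"
  by (simp add: vex_iff)

lemma vex_mult: "vex x m \<Longrightarrow> vex y n \<Longrightarrow> vex (x * y) (m + n)"
  by (auto simp: vex_def v_mult)

lemma vex_minus [simp]: "vex (- x) n \<longleftrightarrow> vex x n"
  by (simp add: vex_def)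

lemma vex_add: "vex x n \<Longrightarrow> vge v y (n + 1) \<Longrightarrow> vex (x + y) n"
  using vge_add[of x n y] vge_mono[of y "n + 1" n] vge_diff[of "x + y" "n + 1" y] by (auto simp: vex_iff)

lemma vex_add': "vge v x (n + 1) \<Longrightarrow> vex y n \<Longrightarrow> vex (x + y) n"
  using vex_add[of y n x] by (simp add: add.commute)

lemma vex_unit_mult: "vunit v c \<Longrightarrow> vex (c * x) n \<longleftrightarrow> vex x n"
  by (auto simp: vex_def vunit_def v_mult)

lemma vge_unit_mult: "vunit v c \<Longrightarrow> vge v (c * x) n \<longleftrightarrow> vge v x n"
  by (cases "x = 0") (auto simp: vge_def vunit_def v_mult)

lemma vex_0_iff: "vex x 0 \<longleftrightarrow> vunit v x"
  by (auto simp: vex_def vunit_def)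

text \<open>Together with \<open>not_vpos_of_mult_eq\<close> this reads off the slope from an
  equation with cleared denominator, treating chords and tangents at once.\<close>

lemma vpos_of_mult_eq: "l * s = r \<Longrightarrow> vex s t \<Longrightarrow> vge v r (t + 1) \<Longrightarrow> vpos v l"
  by (cases "l = 0") (auto simp: vex_def vge_def vpos_def v_mult)

lemma not_vpos_of_mult_eq: "l * s = r \<Longrightarrow> vge v s t \<Longrightarrow> vex r t \<Longrightarrow> \<not> vpos v l"
  using vge_mult'[of l 1 s t "t + 1"] by (auto simp: vex_iff vpos_iff)

lemma common_valuation:
  assumes "x \<noteq> 0 \<or> y \<noteq> 0"
  obtains t where "vge v x t" "vge v y t" "\<not> (vge v x (t + 1) \<and> vge v y (t + 1))"
proof (cases "x = 0 \<or> y = 0")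
  case True
  thus ?thesis using assms that[of "v x"] that[of "v y"] by (auto simp: vge_def)
next
  case False
  thus ?thesis using that[of "min (v x) (v y)"] by (auto simp: vge_def)
qed

definition \<pi> :: 'k where "\<pi> = of_int p"

lemma vex_power_uniformizer: "vex (\<pi> ^ n) (int n)"
proof -
  have "p \<noteq> 0" using prime_p by auto
  thus ?thesis by (simp add: vex_def \<pi>_def v_power v_p)
qed

lemma uniformizer_nonzero [simp]: "\<pi> \<noteq> 0"
  using vex_power_uniformizer[of 1] by (simp add: vex_def)

lemma vge_power_uniformizer_mult: "vge v (\<pi> ^ n * x) (int n + m) \<longleftrightarrow> vge v x m"
  using vex_power_uniformizer[of n] by (cases "x = 0") (auto simp: vex_def vge_def v_mult)

lemma vex_power_uniformizer_mult: "vex (\<pi> ^ n * x) (int n + m) \<longleftrightarrow> vex x m"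
  using vex_power_uniformizer[of n] by (cases "x = 0") (auto simp: vex_def vge_def v_mult)

lemma vge_power_uniformizerE:
  assumes "vge v x (int n)"
  obtains z where "x = \<pi> ^ n * z" "vint v z"
proof -
  have "x = \<pi> ^ n * (x / \<pi> ^ n)" by simp
  moreover from this assms have "vint v (x / \<pi> ^ n)"
    using vge_power_uniformizer_mult[of n "x / \<pi> ^ n" 0] by (simp add: vint_iff)
  ultimately show ?thesis using that by blast
qed

lemma vpos_power_uniformizer: "0 < n \<Longrightarrow> vpos v (\<pi> ^ n)"
  using vex_power_uniformizer[of n] by (simp add: vex_def vpos_def)

text \<open>On \<open>y (y + c x) = x\<^sup>3 + d\<close> the component of a singular point is read off from the valuations of
  the two factors \<open>y\<close> and \<open>w = y + c x\<close>; negation exchanges them up to sign.\<close>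

definition split_component :: "'k \<Rightarrow> int \<Rightarrow> 'k \<times> 'k \<Rightarrow> int" where
  "split_component c N = (\<lambda>(x,y). if y \<noteq> 0 \<and> vge v (y + c*x) (v y + 1) then v y else N - v (y + c*x))"

text \<open>With t the smaller valuation of the two factors, \<open>c*x = w - y\<close> bounds
  \<open>v x\<close> below by t, so \<open>x^3\<close> lies above level 2t and \<open>d\<close>
  agrees with \<open>y*w\<close> there. Unequal valuations force 2t < v(d), equal ones 2t = v(d); in
  this middle case both branches of \<open>split_component\<close> give t.\<close>

lemma split_component_cases:
  assumes c: "vunit v c" and d: "d \<noteq> 0" "vpos v d"
    and P: "(x,y) \<in> singular_points (c,0,0,0,d)" and w: "w = y + c*x"
  obtains t where "0 < t" "2 * t < v d" "vge v x t" "vex y t" "vge v w (t + 1)" "split_component c (v d) (x,y) = t"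
  | t where "0 < t" "2 * t < v d" "vge v x t" "vex w t" "vge v y (t + 1)" "split_component c (v d) (x,y) = v d - t"
  | t where "0 < t" "2 * t = v d" "vge v x t" "vex y t" "vex w t" "split_component c (v d) (x,y) = t"
proof -
  have on: "on_curve (c,0,0,0,d) (x,y)" and x: "vpos v x" using P by (auto simp: singular_points_def)
  have S: "singular_model (c,0,0,0,d)" using c d by (simp add: singular_model_def vunit_imp_vint)
  have y: "vpos v y" by (rule singular_vpos_y[OF S on x])
  have w': "vpos v w" using x y c by (simp add: w vpos_intros vint_intros)
  have yw: "y * w = x^3 + d" using on by (simp add: w algebra_simps power2_eq_square)
  have "y \<noteq> 0 \<or> w \<noteq> 0" using yw d vunit_nonzero[OF c] by (auto simp: w)
  then obtain t where t: "vge v y t" "vge v w t" "\<not> (vge v y (t + 1) \<and> vge v w (t + 1))"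
    by (rule common_valuation)
  have t0: "0 < t"
  proof (rule ccontr)
    assume "\<not> 0 < t"
    hence "vge v y (t + 1)" "vge v w (t + 1)" using y w' by (auto simp: vpos_iff intro: vge_mono)
    with t show False by simp
  qed
  have "c * x = w - y" by (simp add: w)
  hence "vge v (c * x) t" using t by (simp add: vge_diff)
  hence xt: "vge v x t" using c by (simp add: vge_unit_mult)
  have x3: "vge v (x^3) (2 * t + 1)" using t0 by (intro vge_cube[OF xt]) simp
  have d_eq: "d = y * w - x^3" using yw by simp
  consider "vex y t" "vge v w (t + 1)" | "vex w t" "vge v y (t + 1)" | "vex y t" "vex w t"
    using t by (auto simp: vex_iff)
  thus ?thesis
  proof cases
    case 1
    have "vge v (y * w) (2 * t + 1)"
      using vge_mult[OF t(1) 1(2)] by (simp add: algebra_simps)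
    with x3 have "vge v d (2 * t + 1)" unfolding d_eq by (intro vge_diff)
    hence "2 * t < v d" using d by (auto simp: vge_def)
    moreover have "split_component c (v d) (x,y) = t"
      using 1 by (auto simp: split_component_def vex_def w)
    ultimately show ?thesis using that(1) t0 1 xt by blast
  next
    case 2
    have "vge v (y * w) (2 * t + 1)"
      using vge_mult[OF 2(2) t(2)] by (simp add: algebra_simps)
    with x3 have "vge v d (2 * t + 1)" unfolding d_eq by (intro vge_diff)
    hence "2 * t < v d" using d by (auto simp: vge_def)
    moreover have "split_component c (v d) (x,y) = v d - t"
      using 2 by (auto simp: split_component_def vex_def w vge_def)
    ultimately show ?thesis using that(2) t0 2 xt by blast
  next
    case 3
    have "vex (y * w) (2 * t)" using vex_mult[OF 3] by simp
    hence "vex d (2 * t)" unfolding d_eq using vex_add[of "y * w" "2 * t" "- (x^3)"] x3 by simp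
    hence "2 * t = v d" by (simp add: vex_def)
    moreover from this have "split_component c (v d) (x,y) = t"
      using 3 by (auto simp: split_component_def vex_def w vge_def)
    ultimately show ?thesis using that(3) t0 3 xt by blast
  qed
qed

text \<open>The quadratic terms in \<open>x1\<close>, \<open>x2\<close> are of order at least 2t,
  hence negligible at order t. To leading order \<open>l\<close> is
  \<open>- c*y1 / (y1 + w2)\<close> and \<open>l + c\<close> is
  \<open>c*w2 / (y1 + w2)\<close>.\<close>

lemma split_component_slope_aux:
  assumes c: "vunit v c" and t: "0 < t" and x: "vge v x1 t" "vge v x2 t"
    and y1: "vex y1 t" and w2: "vge v w2 t"
    and l: "l * (y1 + w2) = x1^2 + x1*x2 + x2^2 - c*y1"
      "(l + c) * (y1 + w2) = x1^2 + x1*x2 + x2^2 + c*w2"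
  shows "vge v w2 (t + 1) \<Longrightarrow> vpos v (l + c)"
    and "vex w2 t \<Longrightarrow> \<not> vpos v l \<and> \<not> vpos v (l + c)"
proof -
  have q: "vge v (x1^2 + x1*x2 + x2^2) (t + 1)"
    using x t by (intro vge_add vge_square[of _ t] vge_mult'[of _ t _ t]) auto
  {
    assume w: "vge v w2 (t + 1)"
    have "vge v (x1^2 + x1*x2 + x2^2 + c*w2) (t + 1)"
      using q w c by (simp add: vge_add vge_unit_mult)
    with vpos_of_mult_eq[OF l(2) vex_add[OF y1 w]] show "vpos v (l + c)" .
  }
  assume w: "vex w2 t"
  have s: "vge v (y1 + w2) t" using y1 w by (simp add: vge_add vex_imp_vge)
  have "vex (x1^2 + x1*x2 + x2^2 + c*w2) t"
    using q w c by (intro vex_add') (simp_all add: vex_unit_mult)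
  moreover have "vex (x1^2 + x1*x2 + x2^2 + - (c*y1)) t"
    using q y1 c by (intro vex_add') (simp_all add: vex_unit_mult)
  ultimately show "\<not> vpos v l \<and> \<not> vpos v (l + c)"
    using not_vpos_of_mult_eq[OF l(1) s] not_vpos_of_mult_eq[OF l(2) s] by simp
qed

lemma split_component_slope:
  assumes c: "vunit v c" and d: "d \<noteq> 0" "vpos v d"
    and P: "(x1,y1) \<in> singular_points (c,0,0,0,d)" and Q: "(x2,y2) \<in> singular_points (c,0,0,0,d)"
    and sl: "is_slope (c,0,0,0,d) (x1,y1) (x2,y2) l"
  shows "vpos v (l^2 + c*l) \<longleftrightarrow> split_component c (v d) (x1,y1) + split_component c (v d) (x2,y2) \<noteq> v d"
proof -
  let ?f = "split_component c (v d)"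
  \<comment> \<open>By symmetry the first point is taken on the component nearer to
    \<open>E0\<close>, distances being measured around the cycle of \<open>v d\<close>
    components.\<close>
  have wlog: "vpos v l \<or> vpos v (l + c) \<longleftrightarrow> ?f (x1,y1) + ?f (x2,y2) \<noteq> v d"
    if P: "(x1,y1) \<in> singular_points (c,0,0,0,d)" and Q: "(x2,y2) \<in> singular_points (c,0,0,0,d)"
    and sl: "is_slope (c,0,0,0,d) (x1,y1) (x2,y2) l"
    and le: "min (?f (x1,y1)) (v d - ?f (x1,y1)) \<le> min (?f (x2,y2)) (v d - ?f (x2,y2))"
  for x1 y1 x2 y2
  proof -
    define w1 w2 where w: "w1 = y1 + c*x1" "w2 = y2 + c*x2"
    have l1: "l * (y1 + w2) = x1^2 + x1*x2 + x2^2 - c*y1"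
      using sl by (simp add: is_slope_def w algebra_simps)
    have l2: "l * (y2 + w1) = x2^2 + x2*x1 + x1^2 - c*y2"
      using is_slope_commute[OF sl] by (simp add: is_slope_def w algebra_simps)
    have l3: "(l + c) * (y1 + w2) = x1^2 + x1*x2 + x2^2 + c*w2"
      using l1 by (simp add: algebra_simps)
    have l4: "(l + c) * (y2 + w1) = x2^2 + x2*x1 + x1^2 + c*w1"
      using l2 by (simp add: algebra_simps)
    have aux1: "(vge v w2 (t + 1) \<longrightarrow> vpos v (l + c)) \<and> (vex w2 t \<longrightarrow> \<not> vpos v l \<and> \<not> vpos v (l + c))"
      if "0 < t" "vge v x1 t" "vge v x2 t" "vex y1 t" "vge v w2 t" for t
      using split_component_slope_aux[OF c that l1 l3] by blast
    have "- l - c = - (c + l)" by simp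
    hence neg: "vpos v (- l - c) \<longleftrightarrow> vpos v (c + l)" by (simp only: vpos_minus)
    \<comment> \<open>Negating both points turns the factors \<open>y\<close>, \<open>w\<close> into
      \<open>- w\<close>, \<open>- y\<close> and the slope \<open>l\<close> into
      \<open>- l - c\<close>; this is \<open>aux1\<close> for the negatives.\<close>
    have aux2: "(vge v y2 (t + 1) \<longrightarrow> vpos v l) \<and> (vex y2 t \<longrightarrow> \<not> vpos v l \<and> \<not> vpos v (l + c))"
      if "0 < t" "vge v x1 t" "vge v x2 t" "vex w1 t" "vge v y2 t" for t
      using split_component_slope_aux[of c t x2 x1 "- w1" "- y2" "- l - c"] c that l2 l4 neg
      by (simp add: algebra_simps)
    from split_component_cases[OF c d P w(1)]
    show ?thesis
    proof cases
      case P: (1 t1)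
      from split_component_cases[OF c d Q w(2)]
      show ?thesis
      proof cases
        case Q: (1 t2)
        with P le have "t1 \<le> t2" by auto
        with aux1[of t1] P Q vge_mono[of w2 "t2 + 1" t1] vge_mono[of w2 "t2 + 1" "t1 + 1"] vge_mono[of x2 t2 t1]
        show ?thesis by auto
      next
        case Q: (2 t2)
        with P le have "t1 \<le> t2" by auto
        with aux1[of t1] P Q vge_mono[of w2 t2 t1] vge_mono[of w2 t2 "t1 + 1"] vge_mono[of x2 t2 t1]
        show ?thesis by (cases "t1 = t2") (auto simp: vex_imp_vge)
      next
        case Q: (3 t2)
        with P le have "t1 < t2" by auto
        with aux1[of t1] P Q vge_mono[of w2 t2 t1] vge_mono[of w2 t2 "t1 + 1"] vge_mono[of x2 t2 t1]
        show ?thesis by (auto simp: vex_imp_vge)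
      qed
    next
      case P: (2 t1)
      from split_component_cases[OF c d Q w(2)]
      show ?thesis
      proof cases
        case Q: (1 t2)
        with P le have "t1 \<le> t2" by auto
        with aux2[of t1] P Q vge_mono[of y2 t2 t1] vge_mono[of y2 t2 "t1 + 1"] vge_mono[of x2 t2 t1]
        show ?thesis by (cases "t1 = t2") (auto simp: vex_imp_vge)
      next
        case Q: (2 t2)
        with P le have "t1 \<le> t2" by auto
        with aux2[of t1] P Q vge_mono[of y2 "t2 + 1" t1] vge_mono[of y2 "t2 + 1" "t1 + 1"] vge_mono[of x2 t2 t1]
        show ?thesis by auto
      next
        case Q: (3 t2)
        with P le have "t1 < t2" by auto
        with aux2[of t1] P Q vge_mono[of y2 t2 t1] vge_mono[of y2 t2 "t1 + 1"] vge_mono[of x2 t2 t1]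
        show ?thesis by (auto simp: vex_imp_vge)
      qed
    next
      case P: (3 t1)
      from split_component_cases[OF c d Q w(2)]
      show ?thesis
      proof cases
        case Q: (1 t2)
        with P le show ?thesis by auto
      next
        case Q: (2 t2)
        with P le show ?thesis by auto
      next
        case Q: (3 t2)
        with P have "t1 = t2" by auto
        with aux1[of t1] P Q show ?thesis by (auto simp: vex_imp_vge)
      qed
    qed
  qed
  \<comment> \<open>If one of \<open>l\<close>, \<open>l + c\<close> is positive, the other is
    integral, so the product is positive exactly when some factor is, even for nonintegral
    slopes.\<close>
  have "l^2 + c*l = l * (l + c)" by (simp add: algebra_simps power2_eq_square)
  moreover have "vint v (l + c)" if "vpos v l" using that c by (simp add: vint_intros)
  moreover have "vint v l" if "vpos v (l + c)"
    using vint_diff[of "l + c" c] that c by (simp add: vint_intros)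
  ultimately have "vpos v (l^2 + c*l) \<longleftrightarrow> vpos v l \<or> vpos v (l + c)"
    using vpos_multD vpos_mult1 vpos_mult2 by metis
  also have "\<dots> \<longleftrightarrow> ?f (x1,y1) + ?f (x2,y2) \<noteq> v d"
    using wlog[OF P Q sl] wlog[OF Q P is_slope_commute[OF sl]] by linarith
  finally show ?thesis .
qed

lemma split_component_eneg:
  assumes c: "vunit v c" and d: "d \<noteq> 0" "vpos v d"
    and P: "(x,y) \<in> singular_points (c,0,0,0,d)"
  shows "(x, - y - c*x) \<in> singular_points (c,0,0,0,d)"
    and "split_component c (v d) (x, - y - c*x) = v d - split_component c (v d) (x,y)"
proof -
  show P': "(x, - y - c*x) \<in> singular_points (c,0,0,0,d)"
    using P by (auto simp: singular_points_def algebra_simps power2_eq_square)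
  define w where "w = y + c*x"
  have eqs: "- y - c*x = - w" "y + c*x = w" "- w + c*x = - y" by (simp_all add: w_def)
  have "split_component c (v d) (x, - y - c*x) = (if w \<noteq> 0 \<and> vge v y (v w + 1) then v w else v d - v y)"
    unfolding split_component_def prod.case eqs by simp
  with split_component_cases[OF c d P w_def]
  show "split_component c (v d) (x, - y - c*x) = v d - split_component c (v d) (x,y)"
    by cases (auto simp: vex_def vge_def)
qed

text \<open>With \<open>x = \<pi>^n * \<xi>\<close> and \<open>y + c*x = \<pi>^n * \<omega>\<close>
  the equation becomes \<open>(\<omega> - c*\<xi>) * \<omega> = \<pi>^n * \<xi>^3 +
  \<delta>\<close>. For 2t < v(d) one sets \<open>\<xi> = 1\<close> and solves for a positive
  \<open>\<omega>\<close>; on the middle component one sets \<open>\<omega> = 1\<close> and solves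
  for \<open>\<xi>\<close>.\<close>

lemma split_component_surj_half:
  assumes c: "vunit v c" and d: "d \<noteq> 0" "vpos v d" and t: "0 < t" "2 * t \<le> v d"
  obtains x y where "(x,y) \<in> singular_points (c,0,0,0,d)" "split_component c (v d) (x,y) = t"
proof -
  define n where "n = nat t"
  have n: "0 < n" "t = int n" using t by (auto simp: n_def)
  have dn: "vge v d (int (2 * n))" using d t n by (simp add: vge_def)
  then obtain \<delta> where \<delta>: "d = \<pi> ^ (2 * n) * \<delta>" "vint v \<delta>" by (rule vge_power_uniformizerE)
  have v\<delta>: "v d = 2 * t + v \<delta>"
    using d n vex_power_uniformizer[of "2 * n"] by (auto simp: \<delta> vex_def v_mult)
  show ?thesis
  proof (cases "2 * t = v d")
    case False
    with v\<delta> t have \<delta>': "vpos v \<delta>" by (auto simp: vpos_def)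
    obtain \<omega> where \<omega>: "vpos v \<omega>" "- (\<pi> ^ n + \<delta>) + (- c) * \<omega> + 1 * \<omega>^2 + 0 * \<omega>^3 = 0"
      by (rule hensel_cubic[of "- (\<pi> ^ n + \<delta>)" "- c" 1 0])
         (use c \<delta>' n in \<open>auto simp: vpos_add vpos_power_uniformizer simp del: minus_add_distrib\<close>)
    define x y where xy: "x = \<pi> ^ n" "y = x * (\<omega> - c)"
    have w: "y + c*x = \<pi> ^ n * \<omega>" by (simp add: xy algebra_simps)
    have "y * (y + c*x) = x^2 * (\<omega>^2 - c * \<omega>)"
      unfolding w by (simp add: xy algebra_simps power2_eq_square)
    also have "\<omega>^2 - c * \<omega> = \<pi> ^ n + \<delta>" using \<omega>(2) by (simp add: algebra_simps)
    finally have "y * (y + c*x) = x^3 + d"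
      unfolding \<delta>(1) mult_2 power_add by (simp add: xy algebra_simps power2_eq_square power3_eq_cube)
    hence S: "(x,y) \<in> singular_points (c,0,0,0,d)"
      using n by (simp add: singular_points_def xy(1) vpos_power_uniformizer) (simp add: algebra_simps power2_eq_square)
    have "vunit v (\<omega> - c)" using vunit_cong[of "- c" "\<omega> - c"] \<omega> c by simp
    hence y: "vex y t" using vex_power_uniformizer_mult[of n "\<omega> - c" 0] by (simp add: xy n vex_0_iff)
    have "vge v (y + c*x) (t + 1)"
      unfolding w n using \<omega>(1) by (simp add: vge_power_uniformizer_mult vpos_iff)
    with y have "split_component c (v d) (x,y) = t" by (simp add: split_component_def vex_def)
    with S that show ?thesis by blast
  next
    case True
    have \<delta>0: "\<delta> \<noteq> 0" using d \<delta> by auto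
    with True v\<delta> have \<delta>': "vunit v \<delta>" by (simp add: vunit_def)
    \<comment> \<open>\<open>a\<close> solves
      \<open>1 - c*\<xi> = \<delta> + \<pi>^n * \<xi>^3\<close> modulo \<open>p\<close>; the root
      \<open>z\<close> below is the Hensel correction.\<close>
    define a where "a = (1 - \<delta>) / c"
    have a: "vint v a" using c \<delta> by (simp add: a_def vint_diff)
    have ca: "c * a = 1 - \<delta>" using vunit_nonzero[OF c] by (simp add: a_def)
    have pn: "vpos v (\<pi> ^ n)" using n by (simp add: vpos_power_uniformizer)
    have "vpos v (3 * \<pi> ^ n * a^2)" using pn a by (simp add: vpos_intros vint_intros)
    hence "vunit v (c + 3 * \<pi> ^ n * a^2)" using vunit_cong[of c "c + 3 * \<pi> ^ n * a^2"] c by simp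
    then obtain z where z: "vpos v z"
        "\<pi> ^ n * a^3 + (c + 3 * \<pi> ^ n * a^2) * z + (3 * \<pi> ^ n * a) * z^2 + \<pi> ^ n * z^3 = 0"
      by (rule hensel_cubic[rotated 1, of "c + 3 * \<pi> ^ n * a^2" "3 * \<pi> ^ n * a" "\<pi> ^ n" "\<pi> ^ n * a^3"])
         (use pn a in \<open>simp_all add: vpos_intros vint_intros\<close>)
    define x y where xy: "x = \<pi> ^ n * (a + z)" "y = \<pi> ^ n * (1 - c * (a + z))"
    have w: "y + c*x = \<pi> ^ n" by (simp add: xy algebra_simps)
    have eq: "1 - c * (a + z) = \<delta> + \<pi> ^ n * (a + z)^3"
      using z(2) ca by (simp add: algebra_simps power2_eq_square power3_eq_cube)
    have "y * (y + c*x) = \<pi> ^ (2 * n) * (1 - c * (a + z))"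
      unfolding w by (simp add: xy mult_2 power_add)
    also have "\<dots> = x^3 + d"
      unfolding eq \<delta>(1) xy mult_2 power_add by (simp add: algebra_simps power3_eq_cube)
    finally have on: "y * (y + c*x) = x^3 + d" .
    have S: "(x,y) \<in> singular_points (c,0,0,0,d)"
      using pn a z(1) on by (simp add: singular_points_def xy(1) vpos_intros vint_intros)
        (simp add: algebra_simps power2_eq_square)
    have w_ex: "vex (y + c*x) t" unfolding w n by (rule vex_power_uniformizer)
    have "vunit v (1 - c * (a + z))"
      by (rule vunit_cong[OF _ \<delta>']) (use pn a z(1) in \<open>simp add: eq vpos_mult1 vint_intros\<close>)
    hence y_ex: "vex y t"
      using vex_power_uniformizer_mult[of n "1 - c * (a + z)" 0] by (simp add: xy(2) n vex_0_iff)
    from split_component_cases[OF c d S refl] show ?thesis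
    proof cases
      case (3 t')
      with True S that show ?thesis by auto
    next
      case (1 t')
      with w_ex y_ex True show ?thesis by (auto simp: vex_def vge_def)
    next
      case (2 t')
      with w_ex y_ex True show ?thesis by (auto simp: vex_def vge_def)
    qed
  qed
qed

lemma split_component_image:
  assumes c: "vunit v c" and d: "d \<noteq> 0" "vpos v d"
  shows "split_component c (v d) ` singular_points (c,0,0,0,d) = {0<..<v d}"
proof (intro subset_antisym subsetI)
  fix n assume "n \<in> split_component c (v d) ` singular_points (c,0,0,0,d)"
  then obtain x y where S: "(x,y) \<in> singular_points (c,0,0,0,d)" and n: "n = split_component c (v d) (x,y)"
    by auto
  from split_component_cases[OF c d S refl] show "n \<in> {0<..<v d}"
    by cases (auto simp: n)
next
  fix n assume n: "n \<in> {0<..<v d}"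
  show "n \<in> split_component c (v d) ` singular_points (c,0,0,0,d)"
  proof (cases "2 * n \<le> v d")
    case True
    with n split_component_surj_half[OF c d, of n] show ?thesis by (metis greaterThanLessThan_iff image_eqI)
  next
    case False
    with n obtain x y where S: "(x,y) \<in> singular_points (c,0,0,0,d)" "split_component c (v d) (x,y) = v d - n"
      using split_component_surj_half[OF c d, of "v d - n"] by auto
    hence "split_component c (v d) (x, - y - c*x) = n"
      using split_component_eneg(2)[OF c d S(1)] by simp
    with split_component_eneg(1)[OF c d S(1)] show ?thesis by (metis image_eqI)
  qed
qed

lemma coset_index_split_normal:
  assumes c: "vunit v c" and d: "d \<noteq> 0" "vpos v d"
  shows "int (coset_index v (c,0,0,0,d)) = v d"
proof -
  have S: "singular_model (c,0,0,0,d)" using c d by (simp add: singular_model_def vunit_imp_vint)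
  have "coset_index v (c,0,0,0,d) = Suc (card (split_component c (v d) ` singular_points (c,0,0,0,d)))"
  proof (rule coset_index_components[OF S])
    fix x1 y1 x2 y2 l
    assume P: "(x1,y1) \<in> singular_points (c,0,0,0,d)" and Q: "(x2,y2) \<in> singular_points (c,0,0,0,d)"
      and sl: "is_slope (c,0,0,0,d) (x1,y1) (x2,y2) l"
    show "vpos v (l^2 + c*l - 0) \<longleftrightarrow>
        split_component c (v d) (x1,y1) \<noteq> split_component c (v d) (x2, - y2 - c*x2 - 0)"
      using split_component_slope[OF c d P Q sl] split_component_eneg(2)[OF c d Q] by auto
  qed (simp add: split_component_image[OF c d])
  moreover have "0 < v d" using d by (simp add: vpos_def)
  ultimately show ?thesis by (simp add: split_component_image[OF c d])
qed

lemma v_disc_node: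
  assumes "vunit v (a1^2 + 4*a2)" "d \<noteq> 0" "vpos v d"
  shows "v (disc (a1,a2,0,0,d)) = v d"
proof -
  have b2: "vunit v (b2 (a1,a2,0,0,d))" using assms by (simp add: b2_def)
  have "disc (a1,a2,0,0,d) = (- ((a1^2 + 4*a2)^3)) * d + (- (432 * d)) * d"
    by (simp add: Let_def) (simp add: algebra_simps power2_eq_square power3_eq_cube)
  moreover have "vex ((- ((a1^2 + 4*a2)^3)) * d) (v d)"
    using assms vunit_power[OF assms(1), of 3] by (simp add: vex_unit_mult) (simp add: vex_def)
  moreover have "vge v ((- (432 * d)) * d) (v d + 1)"
  proof (rule vge_mult')
    show "vge v (- (432 * d)) 1" using assms by (simp add: vpos_mult2 flip: vpos_iff)
    show "vge v d (v d)" by (simp add: vge_def)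
  qed simp
  ultimately have "vex (disc (a1,a2,0,0,d)) (v d)"
    by (metis vex_add)
  thus ?thesis by (simp add: vex_def)
qed

text \<open>The node of the reduction lifts to a critical point of the Weierstrass equation.\<close>

lemma node_normal_form:
  assumes A: "singular_model A" "A = (a1,a2,a3,a4,a6)" and b2: "vunit v (b2 A)" and nz: "disc A \<noteq> 0"
  obtains r d where "vpos v r" "vunit v (a1^2 + 4 * (a2 + 3*r))" "vpos v d" "d \<noteq> 0" "v d = v (disc A)"
    "coset_index v A = coset_index v (a1, a2 + 3*r, 0, 0, d)"
proof -
  have ai: "vint v a1" "vint v a2" "vpos v a3" "vpos v a4" "vpos v a6"
    using A by (auto simp: singular_model_def)
  have b4: "vpos v (b4 A)" using ai by (simp add: A b4_def vpos_intros vint_intros)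
  \<comment> \<open>Eliminating \<open>t\<close> from the two equations of a critical point leaves
    half the derivative of 4x^3 + b2 x^2 + 2 b4 x + b6.\<close>
  obtain r where r: "vpos v r" "b4 A + b2 A * r + 6 * r^2 + 0 * r^3 = 0"
    by (rule hensel_cubic[of "b4 A" "b2 A" 6 0]) (use b4 b2 in auto)
  have b20: "b2 A \<noteq> 0" using b2 by (rule vunit_nonzero)
  \<comment> \<open>Adding \<open>a1\<close> times \<open>a4 + 2*r*a2 + 3*r^2 = t*a1\<close> and
    \<open>- 2*a2\<close> times \<open>a3 + r*a1 = - 2*t\<close> gives \<open>b2 A * t\<close>.
    Dividing by \<open>b2 A\<close> instead of 2 covers \<open>p = 2\<close>.\<close>
  define t where "t = (a1*a4 - 2*a2*a3 + 3*a1*r^2) / b2 A"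
  have "vpos v (a1*a4 - 2*a2*a3 + 3*a1*r^2)"
    using ai r(1) by (simp add: vpos_intros vint_intros)
  hence t: "vpos v t" using b2 by (simp add: t_def)
  have tb: "b2 A * t = a1*a4 - 2*a2*a3 + 3*a1*r^2" using b20 by (simp add: t_def)
  have rb: "b2 A * r = - b4 A - 6 * r^2" using r(2) by (simp add: algebra_simps eq_neg_iff_add_eq_0)
  have "b2 A * (a3 + r*a1 + 2*t) = b2 A * a3 + a1 * (b2 A * r) + 2 * (b2 A * t)"
    by (simp add: algebra_simps)
  also have "\<dots> = 0"
    unfolding tb rb by (simp add: A b2_def b4_def algebra_simps power2_eq_square)
  finally have crit3: "a3 + r*a1 + 2*t = 0" using b20 by simp
  have "b2 A * (a4 + 2*r*a2 - t*a1 + 3*r^2) = b2 A * a4 + 2*a2 * (b2 A * r) - a1 * (b2 A * t) + 3 * r^2 * b2 A"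
    by (simp add: algebra_simps)
  also have "\<dots> = 0"
    unfolding tb rb by (simp add: A b2_def b4_def algebra_simps power2_eq_square)
  finally have crit4: "a4 + 2*r*a2 - t*a1 + 3*r^2 = 0" using b20 by simp
  define d where "d = a6 + r*a4 + r^2*a2 + r^3 - t*a3 - t^2 - r*t*a1"
  have W: "wchange A 1 r 0 t = (a1, a2 + 3*r, 0, 0, d)"
    using crit3 crit4 by (simp add: A d_def)
  have d: "vpos v d"
    unfolding d_def using ai r(1) t by (intro vpos_diff vpos_add) (simp_all add: vpos_intros vint_intros)
  have unit: "vunit v (a1^2 + 4 * (a2 + 3*r))"
  proof (rule vunit_cong[OF _ b2])
    have "vpos v (- (12 * r))" using r(1) by (simp add: vpos_mult2)
    thus "vpos v (b2 A - (a1^2 + 4 * (a2 + 3*r)))" by (simp add: A b2_def)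
  qed
  have D: "disc (a1, a2 + 3*r, 0, 0, d) = disc A"
    using disc_wchange[of 1 A r 0 t] by (simp add: W del: disc.simps)
  have d0: "d \<noteq> 0"
  proof
    assume "d = 0"
    hence "disc (a1, a2 + 3*r, 0, 0, d) = 0" by (simp add: Let_def)
    with D nz show False by simp
  qed
  have "integral_model v (a1, a2 + 3*r, 0, 0, d)"
    using ai r(1) d by (simp add: vint_intros)
  hence "coset_index v (a1, a2 + 3*r, 0, 0, d) = coset_index v A"
    using coset_index_wchange[OF _ W singular_model_integral[OF A(1)]]
      r(1) t vpos_imp_vint by (simp add: vunit_def)
  with that[OF r(1) unit d d0] v_disc_node[OF unit d0 d] D show ?thesis by simp
qed

text \<open>\<open>T\<close> is a tangent slope modulo \<open>p\<close>, a simple root because the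
  tangent cone has discriminant \<open>b2\<close>. Its lift \<open>s\<close> defines a shear that
  makes \<open>y = 0\<close> one of the tangents, giving the normal form.\<close>

theorem coset_index_split:
  assumes A: "singular_model A" "A = (a1,a2,a3,a4,a6)" and b2: "vunit v (b2 A)" and nz: "disc A \<noteq> 0"
    and T: "vint v T" "vpos v (T^2 + a1*T - a2)"
  shows "int (coset_index v A) = v (disc A)"
proof -
  obtain r d where r: "vpos v r" and unit: "vunit v (a1^2 + 4 * (a2 + 3*r))"
    and d: "vpos v d" "d \<noteq> 0" "v d = v (disc A)"
    and eq: "coset_index v A = coset_index v (a1, a2 + 3*r, 0, 0, d)"
    using node_normal_form[OF A b2 nz] .
  have ai: "vint v a1" "vint v a2" using A by (auto simp: singular_model_def)
  define e where "e = T^2 + a1*T - (a2 + 3*r)"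
  have "vpos v (T^2 + a1*T - a2 - 3*r)" using T r by (intro vpos_diff[OF T(2)] vpos_mult2) auto
  hence e: "vpos v e" by (simp add: e_def algebra_simps)
  have sq: "(2*T + a1)^2 = a1^2 + 4 * (a2 + 3*r) + 4 * e"
    by (simp add: e_def algebra_simps power2_eq_square)
  have "vunit v ((2*T + a1)^2)"
    by (rule vunit_cong[OF _ unit]) (use e in \<open>simp add: sq vpos_mult2\<close>)
  hence T': "vunit v (2*T + a1)" using T ai by (auto simp: vunit_alt vpos_power_iff vint_power_iff)
  obtain z where z: "vpos v z" "e + (2*T + a1) * z + 1 * z^2 + 0 * z^3 = 0"
    by (rule hensel_cubic[of e "2*T + a1" 1 0]) (use e T' in auto)
  define s where "s = T + z"
  have s: "vint v s" using T z by (simp add: s_def vint_intros)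
  have root: "a2 + 3*r - s*a1 - s^2 = 0"
    using z(2) by (simp add: s_def e_def algebra_simps power2_eq_square)
  have W: "wchange (a1, a2 + 3*r, 0, 0, d) 1 0 s 0 = (a1 + 2*s, 0, 0, 0, d)"
    using root by simp
  have c: "vunit v (a1 + 2*s)"
    by (rule vunit_cong[OF _ T']) (use z in \<open>simp add: s_def vpos_mult1 algebra_simps\<close>)
  have "coset_index v (a1 + 2*s, 0, 0, 0, d) = coset_index v (a1, a2 + 3*r, 0, 0, d)"
    by (rule coset_index_wchange[OF _ W]) (use ai r d s in \<open>auto simp: vunit_def vint_intros\<close>)
  with eq coset_index_split_normal[OF c d(2,1)] d(3) show ?thesis by simp
qed

end

section \<open>Nodes with irrational tangents\<close>

text \<open>On \<open>{0..h}\<close> both \<open>m^2\<close> and \<open>B * i^2 + D\<close> take (p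
  + 1)/2 distinct residues, and two such sets must meet.\<close>

lemma quadratic_residue_pigeonhole:
  fixes p B D :: int
  assumes p: "prime p" "odd p" and B: "\<not> p dvd B"
  obtains m i where "p dvd m^2 - B * i^2 - D"
proof -
  define h where "h = (p - 1) div 2"
  have p_eq: "p = 2 * h + 1" and h: "0 \<le> h" using p prime_gt_0_int[of p] by (auto simp: h_def elim: oddE)
  define I where "I = {0..h}"
  have inj: "i = j" if "p dvd c * (i^2 - j^2)" "\<not> p dvd c" "i \<in> I" "j \<in> I" for i j c :: int
  proof -
    from that(1,2) p(1) have "p dvd i^2 - j^2" using prime_dvd_mult_iff by blast
    hence "p dvd (i - j) * (i + j)" by (simp add: algebra_simps power2_eq_square)
    with p(1) have "p dvd i - j \<or> p dvd i + j" by (simp add: prime_dvd_mult_iff)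
    thus ?thesis
    proof
      assume "p dvd i - j"
      moreover have "\<bar>i - j\<bar> < p" using that(3,4) by (auto simp: I_def p_eq)
      ultimately show ?thesis using dvd_imp_le_int[of "i - j" p] by fastforce
    next
      assume "p dvd i + j"
      moreover have "0 \<le> i + j" "i + j < p" using that(3,4) by (auto simp: I_def p_eq)
      ultimately have "i + j = 0" using zdvd_not_zless[of "i + j" p] by linarith
      thus ?thesis using that(3,4) by (auto simp: I_def)
    qed
  qed
  define f where "f = (\<lambda>i. i^2 mod p)"
  define g where "g = (\<lambda>i. (B * i^2 + D) mod p)"
  have "inj_on f I"
  proof (rule inj_onI)
    fix i j assume ij: "i \<in> I" "j \<in> I" "f i = f j"
    hence "p dvd 1 * (i^2 - j^2)" by (simp add: f_def mod_eq_dvd_iff)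
    moreover have "\<not> p dvd 1" using p by auto
    ultimately show "i = j" using ij inj by blast
  qed
  hence cf: "card (f ` I) = card I" by (rule card_image)
  have "inj_on g I"
  proof (rule inj_onI)
    fix i j assume ij: "i \<in> I" "j \<in> I" "g i = g j"
    hence "p dvd B * (i^2 - j^2)" by (simp add: g_def mod_eq_dvd_iff algebra_simps)
    thus "i = j" using ij inj B by blast
  qed
  hence cg: "card (g ` I) = card I" by (rule card_image)
  have cI: "card I = nat (h + 1)" by (simp add: I_def)
  have "f ` I \<union> g ` I \<subseteq> {0..<p}" using prime_gt_0_int[OF p(1)] by (auto simp: f_def g_def)
  hence "card (f ` I \<union> g ` I) \<le> nat p" using card_mono[of "{0..<p}" "f ` I \<union> g ` I"] by simp
  moreover have "nat p < card (f ` I) + card (g ` I)" using h cI by (simp add: cf cg p_eq)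
  ultimately have "f ` I \<inter> g ` I \<noteq> {}"
    using card_Un_disjoint[of "f ` I" "g ` I"] by (force simp: I_def)
  then obtain m i where "m^2 mod p = (B * i^2 + D) mod p" by (auto simp: f_def g_def)
  hence "p dvd m^2 - B * i^2 - D" by (simp add: mod_eq_dvd_iff algebra_simps)
  thus ?thesis by (rule that)
qed

text \<open>For odd \<open>p\<close>, completing the square reduces four times the form to
  \<open>m^2 - (A^2 + 4*E) * i^2\<close>. For \<open>p = 2\<close> the only residue to be
  represented is 1, taken at (1, 0).\<close>

lemma binary_form_represents:
  fixes p A E D :: int
  assumes p: "prime p" and disc: "\<not> p dvd A^2 + 4 * E" and two: "p = 2 \<Longrightarrow> odd D"
  obtains k i where "p dvd k^2 + A * k * i - E * i^2 - D"
proof (cases "p = 2")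
  case True
  with two that[of 1 0] show ?thesis by simp
next
  case False
  hence "odd p" using p primes_dvd_imp_eq two_is_prime_nat by (metis prime_int_numeral_eq two_is_prime_nat)
  then obtain m i where mi: "p dvd m^2 - (A^2 + 4*E) * i^2 - 4 * D"
    using quadratic_residue_pigeonhole[OF p _ disc] by metis
  have "coprime 2 p" using \<open>odd p\<close> by simp
  then obtain h where h: "[2 * h = 1] (mod p)" using cong_solve_coprime_int by blast
  define k where "k = h * (m - A * i)"
  have "[2 * k = 1 * (m - A * i)] (mod p)"
    unfolding k_def mult.assoc[symmetric] by (intro cong_mult h cong_refl)
  hence k: "p dvd 2 * k - (m - A * i)" by (simp add: cong_iff_dvd_diff)
  have "4 * (k^2 + A * k * i - E * i^2 - D) =
      (2 * k - (m - A * i)) * (2 * k + A * i + m) + (m^2 - (A^2 + 4*E) * i^2 - 4 * D)"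
    by (simp add: algebra_simps power2_eq_square)
  also have "p dvd \<dots>" using k mi by simp
  finally have "p dvd 4 * (k^2 + A * k * i - E * i^2 - D)" .
  moreover have "\<not> p dvd 4"
    using p \<open>odd p\<close> prime_dvd_mult_iff[of p 2 2] primes_dvd_imp_eq[of p 2] False by auto
  ultimately show ?thesis using p prime_dvd_mult_iff that by blast
qed

section \<open>Points at a node whose tangent form is anisotropic\<close>

context padic_field
begin

text \<open>After division by \<open>\<pi>^n\<close> the form has only the trivial zero over the
  residue field: a zero with \<open>x'\<close> a unit would yield the root
  \<open>y' / x'\<close>.\<close>

lemma anisotropic_form:
  assumes ai: "vint v a1" "vint v e"
    and aniso: "\<And>T. vint v T \<Longrightarrow> \<not> vpos v (T^2 + a1*T - e)"
    and xy: "vge v x (int n)" "vge v y (int n)" and Q: "vge v (y^2 + a1*x*y - e*x^2) (2 * int n + 1)"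
  shows "vge v x (int n + 1)" "vge v y (int n + 1)"
proof -
  obtain x' where x': "x = \<pi> ^ n * x'" "vint v x'" using xy(1) by (rule vge_power_uniformizerE)
  obtain y' where y': "y = \<pi> ^ n * y'" "vint v y'" using xy(2) by (rule vge_power_uniformizerE)
  have "y^2 + a1*x*y - e*x^2 = \<pi> ^ (2 * n) * (y'^2 + a1*x'*y' - e*x'^2)"
    unfolding x' y' mult_2 power_add by (simp add: algebra_simps power2_eq_square)
  with Q have Q': "vpos v (y'^2 + a1*x'*y' - e*x'^2)"
    using vge_power_uniformizer_mult[of "2 * n" _ 1] by (simp add: vpos_iff)
  have "vpos v x'"
  proof (rule ccontr)
    assume "\<not> vpos v x'"
    with x' have u: "vunit v x'" by (simp add: vunit_alt)
    note x0 = vunit_nonzero[OF u]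
    have "(y' / x')^2 + a1 * (y' / x') - e = (y'^2 + a1*x'*y' - e*x'^2) / x'^2"
      using x0 by (simp add: field_simps power2_eq_square)
    also have "vpos v \<dots>" using Q' vunit_power[OF u, of 2] by simp
    finally show False using aniso[of "y' / x'"] u y' by simp
  qed
  moreover have "vpos v y'"
  proof -
    have "vpos v ((y'^2 + a1*x'*y' - e*x'^2) - a1*x'*y' + e*x'^2)"
      using \<open>vpos v x'\<close> ai y' by (intro vpos_add vpos_diff[OF Q']) (simp_all add: vpos_intros vint_intros)
    thus ?thesis by (simp add: vpos_power_iff)
  qed
  ultimately show "vge v x (int n + 1)" "vge v y (int n + 1)"
    unfolding x' y' by (simp_all add: vge_power_uniformizer_mult vpos_iff)
qed

text \<open>With t the smaller valuation of \<open>x\<close> and \<open>y\<close>, anisotropy gives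
  the quadratic form the exact valuation 2t, while \<open>x^3\<close> lies above it; hence v(d) =
  2t.\<close>

lemma nonsplit_singular_point:
  assumes ai: "vint v a1" "vint v e"
    and aniso: "\<And>T. vint v T \<Longrightarrow> \<not> vpos v (T^2 + a1*T - e)"
    and d: "d \<noteq> 0" "vpos v d" and P: "(x,y) \<in> singular_points (a1,e,0,0,d)"
  shows "even (v d)"
proof -
  have on: "on_curve (a1,e,0,0,d) (x,y)" and x: "vpos v x" using P by (auto simp: singular_points_def)
  have S: "singular_model (a1,e,0,0,d)" using ai d by (simp add: singular_model_def)
  have y: "vpos v y" by (rule singular_vpos_y[OF S on x])
  have Q: "d = (y^2 + a1*x*y - e*x^2) - x^3" using on by (simp add: algebra_simps)
  have "x \<noteq> 0 \<or> y \<noteq> 0" using Q d by auto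
  then obtain t where t: "vge v x t" "vge v y t" "\<not> (vge v x (t + 1) \<and> vge v y (t + 1))"
    by (rule common_valuation)
  have t0: "0 < t"
  proof (rule ccontr)
    assume "\<not> 0 < t"
    hence "vge v x (t + 1)" "vge v y (t + 1)" using x y by (auto simp: vpos_iff intro: vge_mono)
    with t show False by simp
  qed
  define n where "n = nat t"
  have n: "t = int n" using t0 by (simp add: n_def)
  have "\<not> vge v (y^2 + a1*x*y - e*x^2) (2 * t + 1)"
    using anisotropic_form[OF ai aniso, of x n y] t unfolding n by blast
  moreover have "vge v (y^2 + a1*x*y - e*x^2) (2 * t)"
  proof (intro vge_diff vge_add)
    show "vge v (y^2) (2 * t)" "vge v (e * x^2) (2 * t)" "vge v (a1 * x * y) (2 * t)"
      using t ai vge_mult'[of e 0 "x^2" "2 * t" "2 * t"] vge_mult'[of "a1 * x" t y t "2 * t"]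
        vge_mult'[of a1 0 x t t]
      by (auto simp: vint_iff vge_square)
  qed
  ultimately have "vex (y^2 + a1*x*y - e*x^2) (2 * t)" by (simp add: vex_iff)
  moreover have "vge v (- (x^3)) (2 * t + 1)" using vge_cube[OF t(1)] t0 by simp
  ultimately have "vex d (2 * t)" unfolding Q using vex_add by fastforce
  thus ?thesis by (auto simp: vex_def)
qed

text \<open>Dividing the coordinates by \<open>\<pi>^n\<close> leaves \<open>\<omega>^2 +
  a1*\<xi>*\<omega> - e*\<xi>^2 = \<pi>^n * \<xi>^3 + \<delta>\<close> with a unit
  \<open>\<delta>\<close>. Modulo \<open>p\<close> this is a smooth affine conic with a point
  supplied by \<open>binary_form_represents\<close>, and that point lifts.\<close>

lemma nonsplit_singular_point_exists:
  assumes ai: "vint v a1" "vint v e" and b2: "vunit v (a1^2 + 4*e)"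
    and d: "d \<noteq> 0" "vpos v d" "even (v d)"
  shows "singular_points (a1,e,0,0,d) \<noteq> {}"
proof -
  define n where "n = nat (v d div 2)"
  have n: "0 < n" "v d = int (2 * n)" using d by (auto simp: n_def vpos_def elim: evenE)
  have "vge v d (int (2 * n))" using n by (simp add: vge_def)
  then obtain \<delta> where \<delta>: "d = \<pi> ^ (2 * n) * \<delta>" "vint v \<delta>" by (rule vge_power_uniformizerE)
  have "vex (\<pi> ^ (2 * n) * \<delta>) (int (2 * n) + 0)" using d n \<delta> by (simp add: vex_def)
  hence \<delta>u: "vunit v \<delta>" unfolding vex_power_uniformizer_mult vex_0_iff .
  obtain A where A: "vpos v (a1 - of_int A)" using residue_exists[OF ai(1)] by blast
  obtain E where E: "vpos v (e - of_int E)" using residue_exists[OF ai(2)] by blast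
  obtain D where D: "vpos v (\<delta> - of_int D)" using residue_exists[OF \<delta>(2)] by blast
  define ea ee ed where eps: "ea = a1 - of_int A" "ee = e - of_int E" "ed = \<delta> - of_int D"
  have epos: "vpos v ea" "vpos v ee" "vpos v ed" using A E D by (simp_all add: eps)
  have eqs: "a1 = of_int A + ea" "e = of_int E + ee" "\<delta> = of_int D + ed" by (simp_all add: eps)
  have "vunit v (of_int (A^2 + 4 * E))"
  proof (rule vunit_cong[OF _ b2])
    have "a1^2 + 4*e - of_int (A^2 + 4 * E) = ea * (2 * of_int A + ea) + 4 * ee"
      unfolding eqs by (simp add: algebra_simps power2_eq_square)
    also have "vpos v \<dots>" using epos by (simp add: vpos_intros vint_intros)
    finally show "vpos v (a1^2 + 4*e - of_int (A^2 + 4 * E))" .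
  qed
  hence disc: "\<not> p dvd A^2 + 4 * E" unfolding vunit_of_int .
  have "vunit v (of_int D)" by (rule vunit_cong[OF D \<delta>u])
  hence "\<not> p dvd D" unfolding vunit_of_int .
  hence "odd D" if "p = 2" using that by simp
  then obtain k i where "p dvd k^2 + A * k * i - E * i^2 - D"
    using binary_form_represents[OF prime_p disc] by blast
  hence "vpos v (of_int (k^2 + A * k * i - E * i^2 - D))" by (simp only: vpos_of_int)
  moreover define \<kappa> \<iota> :: 'k where ki: "\<kappa> = of_int k" "\<iota> = of_int i"
  define F where "F = \<kappa>^2 + a1*\<kappa>*\<iota> - e*\<iota>^2 - \<delta>"
  have "F = of_int (k^2 + A * k * i - E * i^2 - D) + (ea*\<kappa>*\<iota> - ee*\<iota>^2 - ed)"
    unfolding F_def eqs by (simp add: ki algebra_simps)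
  moreover have int: "vint v \<kappa>" "vint v \<iota>" by (simp_all add: ki)
  moreover from int epos have "vpos v (ea*\<kappa>*\<iota> - ee*\<iota>^2 - ed)" by (simp add: vpos_intros vint_intros)
  ultimately have F: "vpos v F" by (simp only: vpos_add)
  have pn: "vpos v (\<pi> ^ n)" using n by (simp add: vpos_power_uniformizer)
  have finish: ?thesis
    if "vint v \<xi>" "\<omega>^2 + a1*\<xi>*\<omega> - e*\<xi>^2 = \<pi> ^ n * \<xi>^3 + \<delta>" for \<xi> \<omega>
  proof -
    have "(\<pi> ^ n * \<omega>)^2 + a1 * (\<pi> ^ n * \<xi>) * (\<pi> ^ n * \<omega>) - e * (\<pi> ^ n * \<xi>)^2 =
        \<pi> ^ (2 * n) * (\<omega>^2 + a1*\<xi>*\<omega> - e*\<xi>^2)"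
      unfolding mult_2 power_add by (simp add: algebra_simps power2_eq_square)
    also have "\<dots> = (\<pi> ^ n * \<xi>)^3 + d"
      unfolding that(2) \<delta>(1) mult_2 power_add by (simp add: algebra_simps power3_eq_cube)
    finally have "(\<pi> ^ n * \<xi>, \<pi> ^ n * \<omega>) \<in> singular_points (a1,e,0,0,d)"
      using that(1) pn by (simp add: singular_points_def vpos_mult1 vpos_mult2 algebra_simps)
    thus ?thesis by blast
  qed
  \<comment> \<open>These are the partial derivatives of \<open>F\<close>. As linear forms in
    \<open>\<kappa>\<close>, \<open>\<iota>\<close> they have the unit determinant
    \<open>- (a1^2 + 4*e)\<close>; were both positive, so would be \<open>\<kappa>\<close>,
    \<open>\<iota>\<close> and hence \<open>\<delta>\<close>. Hensel is applied in the variable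
    whose derivative is a unit.\<close>
  define F1 F2 where F12: "F1 = 2*\<kappa> + a1*\<iota>" "F2 = a1*\<kappa> - 2*e*\<iota>"
  have int12: "vint v F1" "vint v F2" using int ai by (simp_all add: F12 vint_intros)
  have "vunit v F1 \<or> vunit v F2"
  proof (rule ccontr)
    assume "\<not> ?thesis"
    with int12 have pos12: "vpos v F1" "vpos v F2" by (auto simp: vunit_alt)
    have "(a1^2 + 4*e) * \<iota> = a1 * F1 - 2 * F2" "(a1^2 + 4*e) * \<kappa> = 2*e*F1 + a1*F2"
      by (simp_all add: F12 algebra_simps power2_eq_square)
    moreover have "vpos v (a1 * F1 - 2 * F2)" "vpos v (2*e*F1 + a1*F2)"
      using pos12 ai by (simp_all add: vpos_intros vint_intros)
    ultimately have "vpos v \<iota>" "vpos v \<kappa>"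
      using b2 vpos_multD by (metis vunit_alt)+
    hence "vpos v (\<kappa>^2 + a1*\<kappa>*\<iota> - e*\<iota>^2)" using ai int by (simp add: vpos_intros vint_intros)
    from vpos_diff[OF this F] have "vpos v \<delta>" by (simp add: F_def)
    with \<delta>u show False by (simp add: vunit_alt)
  qed
  thus ?thesis
  proof
    assume u: "vunit v F1"
    obtain z where z: "vpos v z" "(F - \<pi> ^ n * \<iota>^3) + F1 * z + 1 * z^2 + 0 * z^3 = 0"
      by (rule hensel_cubic[of "F - \<pi> ^ n * \<iota>^3" F1 1 0])
        (use F u pn int in \<open>simp_all add: vpos_diff vpos_mult1 vint_power\<close>)
    show ?thesis
      by (rule finish[of \<iota> "\<kappa> + z"])
        (use int z(2) in \<open>simp_all add: F_def F12 algebra_simps power2_eq_square\<close>)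
  next
    assume u: "vunit v F2"
    have "vpos v (3 * \<pi> ^ n * \<iota>^2)" using pn int by (simp add: vpos_intros vint_intros)
    hence u': "vunit v (F2 - 3 * \<pi> ^ n * \<iota>^2)"
      using vunit_cong[of F2 "F2 - 3 * \<pi> ^ n * \<iota>^2"] u by simp
    obtain z where z: "vpos v z" "(F - \<pi> ^ n * \<iota>^3) + (F2 - 3 * \<pi> ^ n * \<iota>^2) * z +
        (- e - 3 * \<pi> ^ n * \<iota>) * z^2 + (- (\<pi> ^ n)) * z^3 = 0"
      by (rule hensel_cubic[of "F - \<pi> ^ n * \<iota>^3" "F2 - 3 * \<pi> ^ n * \<iota>^2" "- e - 3 * \<pi> ^ n * \<iota>" "- (\<pi> ^ n)"])
        (use F u' pn int ai in \<open>simp_all add: vpos_intros vint_intros\<close>)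
    show ?thesis
      by (rule finish[of "\<iota> + z" \<kappa>])
        (use int z in \<open>simp_all add: vint_intros F_def F12 algebra_simps power2_eq_square power3_eq_cube\<close>)
  qed
qed

theorem coset_index_nonsplit:
  assumes A: "singular_model A" "A = (a1,a2,a3,a4,a6)" and b2: "vunit v (b2 A)" and nz: "disc A \<noteq> 0"
    and aniso: "\<And>T. vint v T \<Longrightarrow> \<not> vpos v (T^2 + a1*T - a2)"
  shows "coset_index v A = (if even (v (disc A)) then 2 else 1)"
proof -
  obtain r d where r: "vpos v r" and unit: "vunit v (a1^2 + 4 * (a2 + 3*r))"
    and d: "vpos v d" "d \<noteq> 0" "v d = v (disc A)"
    and eq: "coset_index v A = coset_index v (a1, a2 + 3*r, 0, 0, d)"
    using node_normal_form[OF A b2 nz] .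
  define e where "e = a2 + 3*r"
  have ai: "vint v a1" "vint v e" using A r by (auto simp: singular_model_def e_def vint_intros)
  have S: "singular_model (a1,e,0,0,d)" using ai d by (simp add: singular_model_def)
  have aniso: "\<not> vpos v (T^2 + a1*T - e)" if "vint v T" for T
  proof
    assume "vpos v (T^2 + a1*T - e)"
    hence "vpos v (T^2 + a1*T - e + 3*r)" using r by (intro vpos_add vpos_mult2) auto
    with aniso[OF that] show False by (simp add: e_def algebra_simps)
  qed
  show ?thesis
  proof (cases "even (v d)")
    case False
    hence "singular_points (a1,e,0,0,d) = {}"
      using nonsplit_singular_point[OF ai aniso d(2,1)] by auto
    with coset_index_no_singular_points[OF S] False eq d show ?thesis by (simp add: e_def)
  next
    case True
    \<comment> \<open>The slope of a line need not be integral; for a nonintegral \<open>l\<close>,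
      division by \<open>l^2\<close> would make 1 positive.\<close>
    have no_slope: "\<not> vpos v (l^2 + a1*l - e)" for l
    proof (cases "vint v l")
      case False
      hence l0: "l \<noteq> 0" and vl: "v l < 0" by (auto simp: vint_def)
      define z where "z = inverse l"
      have z: "vpos v z" using l0 vl by (simp add: z_def vpos_def v_inverse)
      have one: "1 = z^2 * (l^2 + a1*l - e) - a1 * z + e * z^2"
        using l0 by (simp add: z_def field_simps power2_eq_square)
      show ?thesis
      proof
        assume "vpos v (l^2 + a1*l - e)"
        hence "vpos v (z^2 * (l^2 + a1*l - e) - a1 * z + e * z^2)"
          using z ai by (intro vpos_add vpos_diff) (simp_all add: vpos_intros vint_intros)
        thus False using one by simp
      qed
    qed (rule aniso)
    have "coset_index v (a1,e,0,0,d) = Suc (card ((\<lambda>_. ()) ` singular_points (a1,e,0,0,d)))"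
      by (rule coset_index_components[OF S]) (use no_slope in auto)
    also have "(\<lambda>_. ()) ` singular_points (a1,e,0,0,d) = {()}"
      using nonsplit_singular_point_exists[OF ai _ d(2,1) True] unit by (auto simp: e_def)
    finally show ?thesis using True eq d by (simp add: e_def)
  qed
qed

end

section \<open>Additive reduction of types IV and IV*\<close>

context padic_field
begin

text \<open>\<open>j = 1\<close> is type IV and \<open>j = 2\<close> type IV*. For
  \<open>j = 2\<close>, a \<open>y\<close> of valuation 1 would give \<open>y * w\<close> valuation
  2, against at least 3 for the cubic; then \<open>x^3\<close> has valuation at least 4, which
  forces \<open>v x\<close> up to 2.\<close>

lemma additive_valuations:
  assumes j: "j = 1 \<or> j = 2" and a: "vge v a1 1" "vex a3 j" "vge v a4 (j + 1)" "vge v a6 (2 * j)"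
    and P: "(x,y) \<in> singular_points (a1,0,a3,a4,a6)"
  shows "vge v x j" "vge v y j"
proof -
  have on: "on_curve (a1,0,a3,a4,a6) (x,y)" and x: "vge v x 1"
    using P by (auto simp: singular_points_def vpos_iff)
  have S: "singular_model (a1,0,a3,a4,a6)"
    using a j by (auto simp: singular_model_def vpos_iff vint_iff vex_iff intro: vge_mono)
  have y: "vge v y 1" using singular_vpos_y[OF S on] x by (simp add: vpos_iff)
  define w where "w = y + (a1*x + a3)"
  have yw: "y * w = x^3 + a4*x + a6" using on by (simp add: w_def algebra_simps power2_eq_square)
  have "vge v x j \<and> vge v y j"
  proof (cases "j = 1")
    case False
    with j have j: "j = 2" by simp
    have a1x: "vge v (a1 * x + a3) 2"
      using a x by (intro vge_add vge_mult'[of a1 1 x 1]) (auto simp: j vex_iff)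
    have a4x: "vge v (a4 * x) 4" using a x by (intro vge_mult'[of _ 3 _ 1]) (auto simp: j)
    have a6: "vge v a6 4" using a by (simp add: j)
    have y2: "vge v y 2"
    proof (rule ccontr)
      assume "\<not> vge v y 2"
      with y have y1: "vex y 1" by (simp add: vex_iff)
      hence "vex w 1" unfolding w_def using a1x by (intro vex_add) simp_all
      from vex_mult[OF y1 this] have "\<not> vge v (y * w) 3" by (simp add: vex_iff)
      moreover have "vge v (x^3 + a4*x + a6) 3"
        using vge_mono[OF a4x] vge_mono[OF a6] vge_cube[OF x] by (intro vge_add) simp_all
      ultimately show False by (simp add: yw)
    qed
    have "vge v w 2" unfolding w_def using y2 a1x by (rule vge_add)
    with y2 have yw4: "vge v (y * w) 4" by (rule vge_mult') simp
    have "x^3 = y * w - a4*x - a6" using yw by simp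
    also have "vge v \<dots> 4" using yw4 a4x a6 by (intro vge_diff)
    finally have x3: "vge v (x^3) 4" .
    have "vge v x 2"
    proof (rule ccontr)
      assume "\<not> vge v x 2"
      hence "x \<noteq> 0" "v x \<le> 1" by (auto simp: vge_def)
      hence "\<not> vge v (x^3) 4" by (simp add: vge_def v_power)
      with x3 show False by contradiction
    qed
    with y2 j show ?thesis by simp
  qed (use x y in simp)
  thus "vge v x j" "vge v y j" by auto
qed

text \<open>The factors of \<open>y * w = x^3 + a4*x\<close> differ by \<open>a1*x + a3\<close>, of
  exact valuation \<open>j\<close>, while the product lies above level 2j. So exactly one factor
  lies above level \<open>j\<close>, and \<open>f\<close> records which: these are the two
  components besides \<open>E0\<close>.\<close>

lemma coset_index_additive_normal:
  assumes j: "j = 1 \<or> j = 2" and a: "vge v a1 1" "vex a3 j" "vge v a4 (j + 1)"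
  shows "coset_index v (a1,0,a3,a4,0) = 3"
proof -
  let ?S = "singular_points (a1,0,a3,a4,0)"
  define f where "f = (\<lambda>(x::'k,y). vge v y (j + 1))"
  have S: "singular_model (a1,0,a3,a4,0)"
    using a j by (auto simp: singular_model_def vpos_iff vint_iff vex_iff intro: vge_mono)
  have a1: "vpos v a1" using a by (simp add: vpos_iff)
  have comp: "vge v x j \<and> (if f (x,y) then vge v y (j + 1) \<and> vex w j else vex y j \<and> vge v w (j + 1))"
    if P: "(x,y) \<in> ?S" and w: "w = y + a1*x + a3" for x y w
  proof -
    have x: "vge v x j" and y: "vge v y j"
      using additive_valuations[OF j a _ P] by auto
    have yw: "y * w = x^3 + a4*x"
      using P by (simp add: singular_points_def w algebra_simps power2_eq_square)
    have a1x: "vge v (a1 * x) (j + 1)" using a x by (intro vge_mult'[of _ 1 _ j]) auto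
    hence wy: "vex (a1*x + a3) j" using a(2) by (intro vex_add')
    have w': "vge v w j" using y wy by (auto simp: w vex_iff add.assoc intro: vge_add)
    have prod: "vge v (y * w) (2 * j + 1)"
      unfolding yw using j by (intro vge_add vge_cube[OF x] vge_mult'[OF a(3) x]) auto
    show ?thesis
    proof (cases "f (x,y)")
      case True
      hence y': "vge v y (j + 1)" by (simp add: f_def)
      have "vex w j" unfolding w add.assoc using y' wy by (rule vex_add')
      with True x y' show ?thesis by simp
    next
      case False
      with y have y': "vex y j" by (simp add: f_def vex_iff)
      have "vge v w (j + 1)"
      proof (rule ccontr)
        assume "\<not> vge v w (j + 1)"
        with w' have "vex w j" by (simp add: vex_iff)
        from vex_mult[OF y' this] prod show False by (simp add: vex_iff)
      qed
      with False x y' show ?thesis by simp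
    qed
  qed
  have half: "vpos v l" if "vge v x1 j" "vge v x2 j" "vge v y1 (j + 1)" "vex w2 j"
      "l * (y1 + w2) = x1^2 + x1*x2 + x2^2 + a4 - a1*y" "vge v y j" for x1 x2 y1 w2 y l
  proof (rule vpos_of_mult_eq[OF that(5)])
    show "vex (y1 + w2) j" using that(3,4) by (rule vex_add')
    show "vge v (x1^2 + x1*x2 + x2^2 + a4 - a1*y) (j + 1)"
      using j a that by (intro vge_diff vge_add vge_square[of _ j] vge_mult'[of x1 j x2 j] vge_mult'[of a1 1 y j]) auto
  qed
  have "coset_index v (a1,0,a3,a4,0) = Suc (card (f ` ?S))"
  proof (rule coset_index_components[OF S])
    fix x1 y1 x2 y2 l
    assume P: "(x1,y1) \<in> ?S" and Q: "(x2,y2) \<in> ?S"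
      and sl: "is_slope (a1,0,a3,a4,0) (x1,y1) (x2,y2) l"
    define w1 w2 where w: "w1 = y1 + a1*x1 + a3" "w2 = y2 + a1*x2 + a3"
    have l: "l * (x2 - x1) = y2 - y1" and l1: "l * (y1 + w2) = x1^2 + x1*x2 + x2^2 + a4 - a1*y1"
      using sl by (simp_all add: is_slope_def w algebra_simps)
    have l2: "l * (w1 + y2) = x1^2 + x1*x2 + x2^2 + a4 - a1*y2"
      using is_slope_commute[OF sl] by (simp add: is_slope_def w algebra_simps)
    note CP = comp[OF P w(1)] and CQ = comp[OF Q w(2)]
    have dx: "vge v (x2 - x1) j" using CP CQ by (auto intro: vge_diff)
    \<comment> \<open>On one component the cleared slope equation makes \<open>l\<close> positive;
      on different ones \<open>y2 - y1\<close> has exact valuation \<open>j\<close>, so the chord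
      equation prevents it.\<close>
    have same: "vpos v l \<longleftrightarrow> f (x1,y1) = f (x2,y2)"
    proof (cases "f (x1,y1)"; cases "f (x2,y2)")
      assume F: "f (x1,y1)" "f (x2,y2)"
      with CP CQ half[OF _ _ _ _ l1] show ?thesis using vge_mono[of y1 "j + 1" j] by auto
    next
      assume F: "\<not> f (x1,y1)" "\<not> f (x2,y2)"
      with CP CQ half[OF _ _ _ _ l2] show ?thesis by (auto simp: vex_imp_vge)
    next
      assume F: "f (x1,y1)" "\<not> f (x2,y2)"
      with CP CQ have "vex (y2 + - y1) j" by (intro vex_add) auto
      with not_vpos_of_mult_eq[OF l dx] F show ?thesis by simp
    next
      assume F: "\<not> f (x1,y1)" "f (x2,y2)"
      with CP CQ have "vex (y2 + - y1) j" by (intro vex_add') auto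
      with not_vpos_of_mult_eq[OF l dx] F show ?thesis by simp
    qed
    have "l^2 + a1*l - 0 = l * (l + a1)" by (simp add: algebra_simps power2_eq_square)
    hence "vpos v (l^2 + a1*l - 0) \<longleftrightarrow> vpos v l"
      using vpos_multD[of l "l + a1"] vpos_diff[of "l + a1" a1] a1 vpos_mult1[of l "l + a1"] vpos_add[of l a1]
      by (auto simp: vpos_imp_vint)
    also note same
    also have "f (x2,y2) \<longleftrightarrow> \<not> f (x2, - y2 - a1*x2 - a3)"
    proof -
      have "- y2 - a1*x2 - a3 = - w2" by (simp add: w)
      thus ?thesis using CQ by (auto simp: f_def vex_iff split: if_splits)
    qed
    finally show "vpos v (l^2 + a1*l - 0) \<longleftrightarrow> f (x1,y1) \<noteq> f (x2, - y2 - a1*x2 - a3)" by blast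
  qed simp
  also have "f ` ?S = {True, False}"
  proof -
    have "(0,0) \<in> ?S" "(0, - a3) \<in> ?S"
      by (simp_all add: singular_points_def power2_eq_square)
    moreover have "f (0,0) = True" "f (0,-a3) = False" using a(2) by (simp_all add: f_def vex_iff)
    ultimately show ?thesis by (metis (full_types) UNIV_bool UNIV_eq_I insert_commute image_eqI)
  qed
  finally show ?thesis by simp
qed

text \<open>Writing \<open>y = a3 * \<eta>\<close>, the singular points lie over the roots of \<open>\<eta>\<^sup>2 + \<eta> - a6 / a3\<^sup>2\<close> in the
  residue field.\<close>

theorem coset_index_additive_split:
  assumes j: "j = 1 \<or> j = 2" and a: "vge v a1 1" "vex a3 j" "vge v a4 (j + 1)" "vge v a6 (2 * j)"
    and \<eta>: "vint v \<eta>" "vpos v (\<eta>^2 + \<eta> - a6 / a3^2)" "vunit v (2 * \<eta> + 1)"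
  shows "coset_index v (a1,0,a3,a4,a6) = 3"
proof -
  obtain z where z: "vpos v z" "(\<eta>^2 + \<eta> - a6 / a3^2) + (2*\<eta> + 1) * z + 1 * z^2 + 0 * z^3 = 0"
    by (rule hensel_cubic[of "\<eta>^2 + \<eta> - a6 / a3^2" "2*\<eta> + 1" 1 0]) (use \<eta> in auto)
  \<comment> \<open>The simple root has been lifted; translating \<open>y\<close> by the
    corresponding \<open>t\<close> makes \<open>a6\<close> vanish.\<close>
  define t where "t = a3 * (\<eta> + z)"
  have a30: "a3 \<noteq> 0" using a(2) by (simp add: vex_def)
  have "a6 - t*a3 - t^2 = - (a3^2 * ((\<eta>^2 + \<eta> - a6 / a3^2) + (2*\<eta> + 1) * z + 1 * z^2 + 0 * z^3))"
    using a30 by (simp add: t_def algebra_simps power2_eq_square)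
  hence root: "a6 - t*a3 - t^2 = 0" unfolding z(2) by simp
  have int: "vint v (\<eta> + z)" using \<eta> z by (simp add: vint_intros)
  hence t: "vge v t j" using a(2) by (auto simp: t_def vint_iff vex_iff intro: vge_mult'[of _ j _ 0])
  have W: "wchange (a1,0,a3,a4,a6) 1 0 0 t = (a1,0,a3 + 2*t, a4 - t*a1, 0)"
    using root by (simp add: algebra_simps)
  have "vunit v (2 * (\<eta> + z) + 1)"
    by (rule vunit_cong[OF _ \<eta>(3)]) (use z in \<open>simp add: vpos_mult1 vpos_mult2 algebra_simps\<close>)
  moreover have "a3 + 2*t = (2 * (\<eta> + z) + 1) * a3" by (simp add: t_def algebra_simps)
  ultimately have a3': "vex (a3 + 2*t) j" using a(2) by (simp only: vex_unit_mult)
  have a4': "vge v (a4 - t*a1) (j + 1)" using a t by (intro vge_diff vge_mult'[of t j a1 1]) auto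
  have "0 \<le> j" using j by auto
  hence "integral_model v (a1,0,a3,a4,a6)" "integral_model v (a1,0,a3 + 2*t, a4 - t*a1, 0)" "vint v t"
    using a a3' a4' t by (auto simp: vint_iff vex_iff intro: vge_mono)
  hence "coset_index v (a1,0,a3 + 2*t, a4 - t*a1, 0) = coset_index v (a1,0,a3,a4,a6)"
    by (intro coset_index_wchange[OF _ W]) (auto simp: vunit_def)
  with coset_index_additive_normal[OF j a(1) a3' a4'] show ?thesis by simp
qed

theorem coset_index_additive_nonsplit:
  assumes j: "j = 1 \<or> j = 2" and a: "vge v a1 1" "vex a3 j" "vge v a4 (j + 1)" "vge v a6 (2 * j)"
    and no_root: "\<And>\<eta>. vint v \<eta> \<Longrightarrow> \<not> vpos v (\<eta>^2 + \<eta> - a6 / a3^2)"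
  shows "coset_index v (a1,0,a3,a4,a6) = 1"
proof (rule coset_index_no_singular_points)
  show "singular_model (a1,0,a3,a4,a6)"
    using a j by (auto simp: singular_model_def vpos_iff vint_iff vex_iff intro: vge_mono)
  have "P \<notin> singular_points (a1,0,a3,a4,a6)" for P
  proof
    assume "P \<in> singular_points (a1,0,a3,a4,a6)"
    moreover obtain x y where "P = (x,y)" by (cases P)
    ultimately have P: "(x,y) \<in> singular_points (a1,0,a3,a4,a6)" by simp
    note xy = additive_valuations[OF j a P]
    have "y^2 + a3*y - a6 = x^3 + a4*x - a1*x*y"
      using P by (simp add: singular_points_def algebra_simps)
    also have "vge v \<dots> (2 * j + 1)"
      using j xy a by (intro vge_diff vge_add vge_cube[OF xy(1)] vge_mult'[of a4 "j + 1" x j]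
          vge_mult'[of "a1 * x" "j + 1" y j] vge_mult'[of a1 1 x j]) auto
    finally have *: "vge v (y^2 + a3*y - a6) (2 * j + 1)" .
    have a3: "a3 \<noteq> 0" "v a3 = j" using a(2) by (simp_all add: vex_def)
    have "vge v (a3^2 * ((y / a3)^2 + y / a3 - a6 / a3^2)) (2 * j + 1)"
      using * a3 by (simp add: algebra_simps power2_eq_square)
    hence "vpos v ((y / a3)^2 + y / a3 - a6 / a3^2)"
      using a3 by (cases "(y / a3)^2 + y / a3 - a6 / a3^2 = 0") (auto simp: vge_def vpos_def v_mult v_power)
    moreover have "vint v (y / a3)"
      using xy(2) a3 by (cases "y = 0") (auto simp: vge_def vint_def v_divide)
    ultimately show False using no_root by blast
  qed
  thus "singular_points (a1,0,a3,a4,a6) = {}" by blast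
qed

end

section \<open>The curves with a point of order three\<close>

lemma cube_root_of_unity_exists:
  fixes p :: int
  assumes p: "prime p" and mod: "p mod 3 = 1"
  obtains z where "p dvd z^2 + z + 1"
proof -
  define q where "q = nat p"
  have pq: "p = int q" and q: "prime q" using p prime_gt_0_int[OF p] by (auto simp: q_def)
  have q3: "q mod 3 = 1" using mod unfolding pq by presburger
  define k where "k = (q - 1) div 3"
  have k: "q - 1 = 3 * k" "0 < k" using q3 prime_gt_1_nat[OF q] by (auto simp: k_def) presburger+
  obtain g where g: "residue_primroot q g" using prime_primitive_root_exists[OF prime_gt_1_nat[OF q] q] by blast
  hence ord: "ord q g = 3 * k" using q k by (simp add: residue_primroot_def totient_prime)
  \<comment> \<open>The primitive root \<open>g\<close> has order \<open>3 * k\<close>, so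
    \<open>g ^ k\<close> is a cube root of 1 different from 1.\<close>
  have "[(g ^ k) ^ 3 = 1] (mod q)"
    unfolding power_mult[symmetric] ord_divides ord by (simp add: mult.commute)
  moreover have "\<not> [g ^ k = 1] (mod q)"
    unfolding ord_divides ord using k nat_dvd_not_less[of k "3 * k"] by auto
  moreover define z where "z = int (g ^ k)"
  ultimately have z: "p dvd z^3 - 1" "\<not> p dvd z - 1"
    unfolding pq z_def using cong_int_iff[of "(g ^ k) ^ 3" 1 q] cong_int_iff[of "g ^ k" 1 q]
    by (simp_all add: cong_iff_dvd_diff)
  have "z^3 - 1 = (z - 1) * (z^2 + z + 1)"
    by (simp add: algebra_simps power2_eq_square power3_eq_cube)
  with z p have "p dvd z^2 + z + 1" using prime_dvd_mult_iff by metis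
  thus ?thesis by (rule that)
qed

text \<open>For such a \<open>z\<close> both \<open>z^3\<close> and, by Fermat,
  \<open>z^(3*k + 1)\<close> are 1 modulo \<open>p\<close>. Hence \<open>z\<close> is 1 and
  \<open>z^2 + z + 1\<close> is 3 modulo \<open>p\<close>, so \<open>p\<close> would be 3.\<close>

lemma no_cube_root_of_unity:
  fixes p z :: int
  assumes p: "prime p" and mod: "p mod 3 = 2"
  shows "\<not> p dvd z^2 + z + 1"
proof
  assume dvd: "p dvd z^2 + z + 1"
  have pz: "\<not> p dvd z"
  proof
    assume "p dvd z"
    hence "p dvd z^2 + z" by (simp add: power2_eq_square)
    with dvd have "p dvd 1" using dvd_add_right_iff by blast
    thus False using p by auto
  qed
  define q where "q = nat p"
  have pq: "p = int q" and q: "prime q" using p prime_gt_0_int[OF p] by (auto simp: q_def)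
  have q3: "q mod 3 = 2" using mod unfolding pq by presburger
  define k where "k = q div 3"
  have k: "q - 1 = 3 * k + 1" using q3 by (simp add: k_def) presburger
  define m where "m = nat (z mod p)"
  have m: "[int m = z] (mod p)" using prime_gt_0_int[OF p] by (simp add: m_def cong_def)
  have "\<not> q dvd m"
  proof
    assume "q dvd m"
    hence "[int m = 0] (mod p)" by (simp add: pq cong_0_iff)
    with m have "[z = 0] (mod p)" using cong_sym cong_trans by blast
    with pz show False by (simp add: cong_0_iff)
  qed
  from fermat_theorem[OF q this] have "[int m ^ (q - 1) = 1] (mod p)"
    unfolding pq by (metis cong_int_iff of_nat_1 of_nat_power)
  with m have fermat: "[z ^ (3 * k + 1) = 1] (mod p)"
    unfolding k by (metis cong_pow cong_sym cong_trans)
  have "z^3 - 1 = (z - 1) * (z^2 + z + 1)"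
    by (simp add: algebra_simps power2_eq_square power3_eq_cube)
  hence "[z^3 = 1] (mod p)" using dvd by (simp add: cong_iff_dvd_diff)
  hence "[(z^3)^k * z = 1^k * z] (mod p)" by (intro cong_mult cong_pow cong_refl)
  with fermat have "[z = 1] (mod p)"
    by (metis cong_sym cong_trans mult_1 power_add power_mult power_one power_one_right)
  hence z1: "p dvd z - 1" by (simp add: cong_iff_dvd_diff)
  have "3 = (z^2 + z + 1) - (z - 1) * (z + 2)" by (simp add: algebra_simps power2_eq_square)
  with z1 dvd have "p dvd 3" by (metis dvd_diff dvd_mult2)
  with p have "p = 3" using primes_dvd_imp_eq[of p 3] by simp
  with mod show False by simp
qed

lemma no_homogeneous_cube_root_of_unity:
  fixes p m x :: int
  assumes p: "prime p" and mod: "p mod 3 = 2" and m: "\<not> p dvd m"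
  shows "\<not> p dvd x^2 + m * x + m^2"
proof
  assume dvd: "p dvd x^2 + m * x + m^2"
  have "coprime m p" using p m prime_imp_coprime coprime_commute by blast
  then obtain g where "[m * g = 1] (mod p)" using cong_solve_coprime_int by blast
  hence g: "p dvd m * g - 1" by (simp add: cong_iff_dvd_diff)
  \<comment> \<open>Dehomogenization by the inverse \<open>g\<close> of \<open>m\<close> modulo
    \<open>p\<close>.\<close>
  have "(x * g)^2 + x * g + 1 = g^2 * (x^2 + m * x + m^2) - (m * g - 1) * (x * g + m * g + 1)"
    by (simp add: algebra_simps power2_eq_square)
  with dvd g have "p dvd (x * g)^2 + x * g + 1" by simp
  with no_cube_root_of_unity[OF p mod] show False by blast
qed

text \<open>The 3-isogeny interchanges the exponents of \<open>b\<close> and \<open>a - 27*b\<close>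
  found here to give those in \<open>disc_EC3t\<close>; at split nodes this accounts for the factor
  3 between the Tamagawa numbers.\<close>

lemma disc_EC3: "disc (EC3 a b :: 'k::field_char_0 ainv) = of_int a ^ 8 * of_int b ^ 3 * of_int (a - 27 * b)"
  by (simp add: EC3_def Let_def) (simp add: algebra_simps eval_nat_numeral)

lemma disc_EC3t: "disc (EC3t a b :: 'k::field_char_0 ainv) = of_int a ^ 8 * of_int b * of_int (a - 27 * b) ^ 3"
  by (simp add: EC3t_def Let_def) (simp add: algebra_simps eval_nat_numeral)

lemma c4_EC3: "c4 (EC3 a b :: 'k::field_char_0 ainv) = of_int (a ^ 3 * (a - 24 * b))"
  by (simp add: EC3_def c4_def b2_def b4_def algebra_simps eval_nat_numeral)

lemma c4_EC3t: "c4 (EC3t a b :: 'k::field_char_0 ainv) = of_int (a ^ 3 * (a + 216 * b))"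
  by (simp add: EC3t_def c4_def b2_def b4_def algebra_simps eval_nat_numeral)

section \<open>Local reduction of the two curves\<close>

context padic_field
begin

lemma v_disc_EC3:
  assumes "a \<noteq> 0" "b \<noteq> 0" "a \<noteq> 27 * b"
  shows "disc (EC3 a b :: 'k ainv) \<noteq> 0"
    and "v (disc (EC3 a b)) = 8 * int (multiplicity p a) + 3 * int (multiplicity p b) + int (multiplicity p (a - 27 * b))"
proof -
  have nz: "(of_int a :: 'k) \<noteq> 0" "(of_int b :: 'k) \<noteq> 0" "(of_int (a - 27 * b) :: 'k) \<noteq> 0"
    using assms by (simp_all only: of_int_eq_0_iff) auto
  thus "disc (EC3 a b :: 'k ainv) \<noteq> 0" by (simp add: disc_EC3 del: of_int_diff)
  show "v (disc (EC3 a b)) = 8 * int (multiplicity p a) + 3 * int (multiplicity p b) + int (multiplicity p (a - 27 * b))"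
    using nz assms by (simp add: disc_EC3 v_mult v_power v_of_int del: of_int_diff)
qed

lemma v_disc_EC3t:
  assumes "a \<noteq> 0" "b \<noteq> 0" "a \<noteq> 27 * b"
  shows "disc (EC3t a b :: 'k ainv) \<noteq> 0"
    and "v (disc (EC3t a b)) = 8 * int (multiplicity p a) + int (multiplicity p b) + 3 * int (multiplicity p (a - 27 * b))"
proof -
  have nz: "(of_int a :: 'k) \<noteq> 0" "(of_int b :: 'k) \<noteq> 0" "(of_int (a - 27 * b) :: 'k) \<noteq> 0"
    using assms by (simp_all only: of_int_eq_0_iff) auto
  thus "disc (EC3t a b :: 'k ainv) \<noteq> 0" by (simp add: disc_EC3t del: of_int_diff)
  show "v (disc (EC3t a b)) = 8 * int (multiplicity p a) + int (multiplicity p b) + 3 * int (multiplicity p (a - 27 * b))"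
    using nz assms by (simp add: disc_EC3t v_mult v_power v_of_int del: of_int_diff)
qed

text \<open>\<open>c4\<close> is invariant under translation, hence tested on \<open>A\<close>; as a
  unit it certifies minimality however large the valuation of the discriminant is.\<close>

lemma multiplicative_reduction:
  assumes W: "wchange A 1 r 0 t = M" and M: "M = (a1,a2,a3,a4,a6)" and S: "singular_model M"
    and b2: "vunit v (b2 M)" and c4: "vunit v (c4 A)" and nz: "disc A \<noteq> 0"
  shows "bad_reduction v A"
    and "vint v T \<Longrightarrow> vpos v (T^2 + a1*T - a2) \<Longrightarrow> int (tamagawa v A) = v (disc A)"
    and "(\<And>T. vint v T \<Longrightarrow> \<not> vpos v (T^2 + a1*T - a2)) \<Longrightarrow>
      tamagawa v A = (if even (v (disc A)) then 2 else 1)"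
proof -
  have D: "disc M = disc A" using disc_wchange[of 1 A r 0 t] by (simp add: W)
  with nz have nzM: "disc M \<noteq> 0" by simp
  have "c4 M = c4 A" using c4_wchange[of 1 A r 0 t] by (simp add: W)
  with c4 have min: "minimal_model v A M"
    by (intro minimal_modelI[OF W[symmetric] _ singular_model_integral[OF S] nz]) simp_all
  note tam = tamagawa_eq[OF min nz]
  obtain d where d: "vpos v d" "d \<noteq> 0" "v d = v (disc M)"
    by (rule node_normal_form[OF S M b2 nzM])
  thus "bad_reduction v A" using bad_reduction_eq[OF min nz] by (simp add: vpos_def)
  show "int (tamagawa v A) = v (disc A)" if "vint v T" "vpos v (T^2 + a1*T - a2)"
    using coset_index_split[OF S M b2 nzM that] by (simp add: tam D)
  show "tamagawa v A = (if even (v (disc A)) then 2 else 1)"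
    if "\<And>T. vint v T \<Longrightarrow> \<not> vpos v (T^2 + a1*T - a2)"
    using coset_index_nonsplit[OF S M b2 nzM that] by (simp add: tam D)
qed

lemma integral_root_residue:
  assumes "vint v T" "vpos v (T^2 + of_int a * T + of_int c)"
  obtains i where "p dvd i^2 + a * i + c"
proof -
  obtain i where i: "vpos v (T - of_int i)" using residue_exists[OF assms(1)] by blast
  have "of_int (i^2 + a * i + c) = (T^2 + of_int a * T + of_int c) - (T - of_int i) * (T + of_int i + of_int a)"
    by (simp add: algebra_simps power2_eq_square)
  also have "vpos v \<dots>" using assms i by (intro vpos_diff[OF assms(2)] vpos_mult1 vint_add) auto
  finally show ?thesis using that unfolding vpos_of_int by blast
qed

lemma EC3_dvd_b:
  assumes nz: "a \<noteq> 0" "b \<noteq> 0" "a \<noteq> 27 * b" and cop: "coprime a b" and b: "p dvd b"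
  shows "bad_reduction v (EC3 a b)" "tamagawa v (EC3 a b) = 3 * multiplicity p b"
    and "bad_reduction v (EC3t a b)" "tamagawa v (EC3t a b) = multiplicity p b"
proof -
  have a: "\<not> p dvd a" using cop b prime_p coprime_common_divisor not_prime_unit by blast
  hence ab: "\<not> p dvd a - 27 * b" "\<not> p dvd a - 24 * b" "\<not> p dvd a + 216 * b"
    using b by (simp_all add: dvd_diff_left_iff dvd_add_left_iff)
  have mult: "multiplicity p a = 0" "multiplicity p (a - 27 * b) = 0"
    using a ab by (simp_all add: not_dvd_imp_multiplicity_0)
  have "vunit v (of_int (a^2))" using a prime_p unfolding vunit_of_int by (simp add: prime_dvd_power_iff)
  hence b2: "vunit v (b2 (EC3 a b))" "vunit v (b2 (EC3t a b))"
    by (simp_all add: EC3_def EC3t_def b2_def)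
  have c4: "vunit v (c4 (EC3 a b))" "vunit v (c4 (EC3t a b))"
    unfolding c4_EC3 c4_EC3t vunit_of_int using a ab prime_p
    by (simp_all add: prime_dvd_mult_iff prime_dvd_power_iff)
  have W: "wchange (EC3 a b) 1 0 0 0 = EC3 a b" "wchange (EC3t a b) 1 0 0 0 = EC3t a b"
    by (simp_all add: EC3_def EC3t_def)
  have "vpos v (of_int b)" using b by simp
  hence S: "singular_model (EC3 a b)" "singular_model (EC3t a b)"
    by (simp_all add: singular_model_def EC3_def EC3t_def vpos_mult1 vpos_mult2 vint_intros)
  note E = multiplicative_reduction[OF W(1) EC3_def S(1) b2(1) c4(1) v_disc_EC3(1)[OF nz]]
  note Et = multiplicative_reduction[OF W(2) EC3t_def S(2) b2(2) c4(2) v_disc_EC3t(1)[OF nz]]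
  show "bad_reduction v (EC3 a b)" "bad_reduction v (EC3t a b)" by (rule E(1) Et(1))+
  \<comment> \<open>Both models have \<open>a2 = 0\<close>, so the tangent cone gives
    \<open>T^2 + a*T\<close>, with the root 0.\<close>
  show "tamagawa v (EC3 a b) = 3 * multiplicity p b"
    using E(2)[of 0] by (simp add: v_disc_EC3[OF nz] mult)
  show "tamagawa v (EC3t a b) = multiplicity p b"
    using Et(2)[of 0] by (simp add: v_disc_EC3t[OF nz] mult)
qed

lemma EC3_dvd_a_27b:
  assumes nz: "a \<noteq> 0" "b \<noteq> 0" "a \<noteq> 27 * b" and b: "\<not> p dvd b" and p3: "p \<noteq> 3" and dvd: "p dvd a - 27 * b"
  defines "n \<equiv> multiplicity p (a - 27 * b)"
  shows "bad_reduction v (EC3 a b)" "bad_reduction v (EC3t a b)"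
    and "p mod 3 = 1 \<Longrightarrow> tamagawa v (EC3 a b) = n \<and> tamagawa v (EC3t a b) = 3 * n"
    and "p mod 3 = 2 \<Longrightarrow> tamagawa v (EC3 a b) = (if even n then 2 else 1) \<and>
      tamagawa v (EC3t a b) = (if even n then 2 else 1)"
proof -
  have three: "\<not> p dvd 3" using p3 prime_p primes_dvd_imp_eq[of p 3] by auto
  have pow3: "\<not> p dvd 3 ^ k * b ^ l" for k l
    using three b prime_p by (meson prime_dvd_mult_iff prime_dvd_power)
  have a: "\<not> p dvd a"
  proof
    assume "p dvd a"
    from dvd_diff[OF this dvd] have "p dvd a - (a - 27 * b)" .
    with pow3[of 3 1] show False by simp
  qed
  have ab: "\<not> p dvd a - 24 * b" "\<not> p dvd a + 216 * b"
  proof -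
    have eqs: "a - 24 * b = (a - 27 * b) + 3 ^ 1 * b ^ 1" "a + 216 * b = (a - 27 * b) + 3 ^ 5 * b ^ 1"
      by simp_all
    show "\<not> p dvd a - 24 * b" "\<not> p dvd a + 216 * b"
      unfolding eqs dvd_add_right_iff[OF dvd] by (rule pow3)+
  qed
  have mult: "multiplicity p a = 0" "multiplicity p b = 0"
    using a b by (simp_all add: not_dvd_imp_multiplicity_0)
  have c4: "vunit v (c4 (EC3 a b))" "vunit v (c4 (EC3t a b))"
    unfolding c4_EC3 c4_EC3t vunit_of_int using a ab prime_p
    by (simp_all add: prime_dvd_mult_iff prime_dvd_power_iff)
  \<comment> \<open>the nodes of the two reductions, in terms of \<open>b\<close> because \<open>a \<equiv> 27 b\<close>\<close>
  define r t rt tt :: int where rt: "r = - 81 * b^2" "t = 729 * b^3" "rt = - 243 * b^2" "tt = 2916 * b^3"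
  \<comment> \<open>The last three coefficients display the factor \<open>a - 27*b\<close>, which
    makes the origin singular modulo \<open>p\<close>; the second ones are \<open>3*r\<close> and
    \<open>3*rt\<close>.\<close>
  define M :: "'k ainv" where "M = (of_int a, of_int (- 243 * b^2), of_int ((a - 27 * b) * (b * (a - 54 * b))),
    of_int ((a - 27 * b) * (- 729 * b^3)), of_int ((a - 27 * b) * (- 729 * b^4 * (a - 54 * b))))"
  define Mt :: "'k ainv" where "Mt = (of_int a, of_int (- 729 * b^2), of_int ((a - 27 * b) * (b * (a - 216 * b))),
    of_int ((a - 27 * b) * (b * (- 5 * a^2 - 135 * a * b - 6561 * b^2))),
    of_int ((a - 27 * b) * (b * (- (a^4) - 34 * a^3 * b + 297 * a^2 * b^2 + 5103 * a * b^3 + 846369 * b^4))))"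
  have W: "wchange (EC3 a b) 1 (of_int r) 0 (of_int t) = M"
    by (simp add: EC3_def M_def rt algebra_simps eval_nat_numeral)
  have Wt: "wchange (EC3t a b) 1 (of_int rt) 0 (of_int tt) = Mt"
    by (simp add: EC3t_def Mt_def rt algebra_simps eval_nat_numeral)
  have S: "singular_model M" "singular_model Mt"
    unfolding singular_model_def M_def Mt_def prod.case vpos_of_int using dvd by (simp_all del: of_int_mult of_int_minus)
  have "b2 M = of_int ((a - 27 * b) * (a + 27 * b) + - (3 ^ 5 * b ^ 2))"
    by (simp add: M_def b2_def algebra_simps power2_eq_square)
  hence b2: "vunit v (b2 M)"
    unfolding vunit_of_int using dvd pow3[of 5 2] by (metis dvd_add_right_iff dvd_minus_iff dvd_mult2 vunit_of_int)
  have "b2 Mt = of_int ((a - 27 * b) * (a + 27 * b) + - (3 ^ 7 * b ^ 2))"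
    by (simp add: Mt_def b2_def algebra_simps power2_eq_square)
  hence b2t: "vunit v (b2 Mt)"
    unfolding vunit_of_int using dvd pow3[of 7 2] by (metis dvd_add_right_iff dvd_minus_iff dvd_mult2 vunit_of_int)
  note E = multiplicative_reduction[OF W M_def S(1) b2 c4(1) v_disc_EC3(1)[OF nz]]
  note Et = multiplicative_reduction[OF Wt Mt_def S(2) b2t c4(2) v_disc_EC3t(1)[OF nz]]
  show "bad_reduction v (EC3 a b)" "bad_reduction v (EC3t a b)" by (rule E(1) Et(1))+
  have vd: "v (disc (EC3 a b)) = int n" "v (disc (EC3t a b)) = 3 * int n"
    by (simp_all add: v_disc_EC3[OF nz] v_disc_EC3t[OF nz] mult n_def)
  show "tamagawa v (EC3 a b) = n \<and> tamagawa v (EC3t a b) = 3 * n" if p1: "p mod 3 = 1"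
  proof -
    obtain z where z: "p dvd z^2 + z + 1" using cube_root_of_unity_exists[OF prime_p p1] .
    \<comment> \<open>Modulo \<open>a - 27*b\<close> the tangent polynomial at
      \<open>T = 9*b*(z - 1)\<close> is \<open>81*b^2*(z^2 + z + 1)\<close>; for the second curve
      \<open>T = 27*b*z\<close> gives \<open>729*b^2*(z^2 + z + 1)\<close>.\<close>
    have "vpos v (of_int (81 * b^2 * (z^2 + z + 1) + (a - 27 * b) * (9 * b * (z - 1))))"
      unfolding vpos_of_int using z dvd by simp
    also have "of_int (81 * b^2 * (z^2 + z + 1) + (a - 27 * b) * (9 * b * (z - 1))) =
        (of_int (9 * b * (z - 1)) :: 'k)^2 + of_int a * of_int (9 * b * (z - 1)) - of_int (- 243 * b^2)"
      by (simp add: algebra_simps power2_eq_square)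
    finally have 1: "int (tamagawa v (EC3 a b)) = int n" unfolding vd(1)[symmetric] by (rule E(2)[OF vint_of_int])
    have "vpos v (of_int (729 * b^2 * (z^2 + z + 1) + (a - 27 * b) * (27 * b * z)))"
      unfolding vpos_of_int using z dvd by simp
    also have "of_int (729 * b^2 * (z^2 + z + 1) + (a - 27 * b) * (27 * b * z)) =
        (of_int (27 * b * z) :: 'k)^2 + of_int a * of_int (27 * b * z) - of_int (- 729 * b^2)"
      by (simp add: algebra_simps power2_eq_square)
    finally have "int (tamagawa v (EC3t a b)) = 3 * int n" unfolding vd(2)[symmetric] by (rule Et(2)[OF vint_of_int])
    with 1 show ?thesis by simp
  qed
  show "tamagawa v (EC3 a b) = (if even n then 2 else 1) \<and> tamagawa v (EC3t a b) = (if even n then 2 else 1)"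
    if p2: "p mod 3 = 2"
  proof -
    have "\<not> vpos v (T^2 + of_int a * T - of_int (- 243 * b^2))" if "vint v T" for T
    proof
      assume "vpos v (T^2 + of_int a * T - of_int (- 243 * b^2))"
      hence "vpos v (T^2 + of_int a * T + of_int (243 * b^2))" by simp
      with that obtain i where i: "p dvd i^2 + a * i + 243 * b^2" by (rule integral_root_residue)
      \<comment> \<open>This inverts the substitution \<open>T = 9*b*(z - 1)\<close>, in homogeneous
        form with \<open>m = 9*b\<close>.\<close>
      have "(i + 9 * b)^2 + 9 * b * (i + 9 * b) + (9 * b)^2 = (i^2 + a * i + 243 * b^2) - (a - 27 * b) * i"
        by (simp add: algebra_simps power2_eq_square)
      also have "p dvd \<dots>" using i dvd by simp
      finally show False using no_homogeneous_cube_root_of_unity[OF prime_p p2, of "9 * b" "i + 9 * b"] pow3[of 2 1] by simp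
    qed
    moreover have "\<not> vpos v (T^2 + of_int a * T - of_int (- 729 * b^2))" if "vint v T" for T
    proof
      assume "vpos v (T^2 + of_int a * T - of_int (- 729 * b^2))"
      hence "vpos v (T^2 + of_int a * T + of_int (729 * b^2))" by simp
      with that obtain i where i: "p dvd i^2 + a * i + 729 * b^2" by (rule integral_root_residue)
      have "i^2 + 27 * b * i + (27 * b)^2 = (i^2 + a * i + 729 * b^2) - (a - 27 * b) * i"
        by (simp add: algebra_simps power2_eq_square)
      also have "p dvd \<dots>" using i dvd by simp
      finally show False using no_homogeneous_cube_root_of_unity[OF prime_p p2, of "27 * b" i] pow3[of 3 1] by simp
    qed
    ultimately show ?thesis using E(3) Et(3) by (simp add: vd)
  qed
qed

lemma vge_divide_power: "vge v x (m + int (n * e)) \<Longrightarrow> vge v (x / (\<pi> ^ e) ^ n) m"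
  using vge_power_uniformizer_mult[of "n * e" "x / (\<pi> ^ e) ^ n" m]
  by (simp add: add.commute mult.commute flip: power_mult)

lemma vex_divide_power: "vex x (m + int (n * e)) \<Longrightarrow> vex (x / (\<pi> ^ e) ^ n) m"
  using vex_power_uniformizer_mult[of "n * e" "x / (\<pi> ^ e) ^ n" m]
  by (simp add: add.commute mult.commute flip: power_mult)

text \<open>Scaling by \<open>\<pi> ^ e\<close> lowers the valuation of the discriminant by 12e, to
  below 12, which certifies minimality; what remains decides between good and bad reduction.\<close>

lemma scaled_model:
  assumes A: "A = (a1,0,a3,a4,a6)" and nz: "disc A \<noteq> 0"
    and a: "vge v a1 (int e)" "vge v a3 (3 * int e)" "vge v a4 (4 * int e)" "vge v a6 (6 * int e)"
    and D: "v (disc A) < 12 * int e + 12"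
  shows "minimal_model v A (a1 / \<pi> ^ e, 0, a3 / (\<pi> ^ e) ^ 3, a4 / (\<pi> ^ e) ^ 4, a6 / (\<pi> ^ e) ^ 6)"
    and "bad_reduction v A \<longleftrightarrow> 12 * int e < v (disc A)"
proof -
  let ?M = "(a1 / \<pi> ^ e, 0, a3 / (\<pi> ^ e) ^ 3, a4 / (\<pi> ^ e) ^ 4, a6 / (\<pi> ^ e) ^ 6)"
  have W: "wchange A (\<pi> ^ e) 0 0 0 = ?M" by (simp add: A)
  have int: "integral_model v ?M"
    using vge_divide_power[of a1 0 1 e] vge_divide_power[of a3 0 3 e] vge_divide_power[of a4 0 4 e]
      vge_divide_power[of a6 0 6 e] a by (simp add: vint_iff)
  have "v (\<pi> ^ e) = int e" using vex_power_uniformizer[of e] by (simp add: vex_def)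
  hence vd: "v (disc ?M) = v (disc A) - 12 * int e"
    using v_disc_wchange[OF _ nz, of "\<pi> ^ e" 0 0 0] by (simp add: W del: disc.simps)
  show min: "minimal_model v A ?M"
    by (rule minimal_modelI[OF W[symmetric] _ int nz]) (use D vd in auto)
  show "bad_reduction v A \<longleftrightarrow> 12 * int e < v (disc A)"
    unfolding bad_reduction_eq[OF min nz] vd by simp
qed

text \<open>The ratio \<open>a6 / a3^2\<close> has weight 0, so the quadratic that separates the two
  cases can be stated on the unscaled equation.\<close>

lemma additive_reduction:
  assumes A: "A = (a1,0,a3,a4,a6)" and nz: "disc A \<noteq> 0" and j: "j = 1 \<or> j = 2"
    and a: "vge v a1 (1 + int e)" "vex a3 (j + 3 * int e)" "vge v a4 (j + 1 + 4 * int e)" "vge v a6 (2 * j + 6 * int e)"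
    and D: "v (disc A) < 12 * int e + 12"
  shows "vint v \<eta> \<Longrightarrow> vpos v (\<eta>^2 + \<eta> - a6 / a3^2) \<Longrightarrow> vunit v (2 * \<eta> + 1) \<Longrightarrow> tamagawa v A = 3"
    and "(\<And>\<eta>. vint v \<eta> \<Longrightarrow> \<not> vpos v (\<eta>^2 + \<eta> - a6 / a3^2)) \<Longrightarrow> tamagawa v A = 1"
proof -
  have min: "minimal_model v A (a1 / \<pi> ^ e, 0, a3 / (\<pi> ^ e) ^ 3, a4 / (\<pi> ^ e) ^ 4, a6 / (\<pi> ^ e) ^ 6)"
    by (rule scaled_model(1)[OF A nz _ _ _ _ D])
      (use a j vge_mono[OF a(1)] vge_mono[OF vex_imp_vge[OF a(2)]] vge_mono[OF a(3)] vge_mono[OF a(4)] in auto)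
  note tam = tamagawa_eq[OF min nz]
  have q: "a6 / (\<pi> ^ e) ^ 6 / (a3 / (\<pi> ^ e) ^ 3)^2 = a6 / a3^2"
  proof -
    have "((\<pi> ^ e) ^ 3)^2 = (\<pi> ^ e) ^ 6" by (simp add: mult.commute flip: power_mult)
    thus ?thesis by (simp add: power_divide)
  qed
  have vals: "vge v (a1 / \<pi> ^ e) 1" "vex (a3 / (\<pi> ^ e) ^ 3) j" "vge v (a4 / (\<pi> ^ e) ^ 4) (j + 1)"
      "vge v (a6 / (\<pi> ^ e) ^ 6) (2 * j)"
    using vge_divide_power[of a1 1 1 e] vex_divide_power[of a3 j 3 e] vge_divide_power[of a4 "j + 1" 4 e]
      vge_divide_power[of a6 "2 * j" 6 e] a by simp_all
  show "tamagawa v A = 3" if "vint v \<eta>" "vpos v (\<eta>^2 + \<eta> - a6 / a3^2)" "vunit v (2 * \<eta> + 1)"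
    unfolding tam by (rule coset_index_additive_split[OF j vals, of \<eta>]) (use that in \<open>simp_all only: q\<close>)
  show "tamagawa v A = 1" if "\<And>\<eta>. vint v \<eta> \<Longrightarrow> \<not> vpos v (\<eta>^2 + \<eta> - a6 / a3^2)"
    unfolding tam by (rule coset_index_additive_nonsplit[OF j vals]) (use that in \<open>simp only: q not_False_eq_True\<close>)
qed

lemma EC3_not_dvd:
  assumes nz: "a \<noteq> 0" "b \<noteq> 0" "a \<noteq> 27 * b" and b: "\<not> p dvd b" and p3: "p \<noteq> 3" and ndvd: "\<not> p dvd a - 27 * b"
  defines "m \<equiv> multiplicity p a"
  shows "bad_reduction v (EC3 a b) \<longleftrightarrow> m mod 3 \<noteq> 0" "bad_reduction v (EC3t a b) \<longleftrightarrow> m mod 3 \<noteq> 0"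
    and "m mod 3 \<noteq> 0 \<Longrightarrow> tamagawa v (EC3 a b) = 3"
    and "m mod 3 \<noteq> 0 \<Longrightarrow> p mod 3 = 1 \<Longrightarrow> tamagawa v (EC3t a b) = 3"
    and "m mod 3 \<noteq> 0 \<Longrightarrow> p mod 3 = 2 \<Longrightarrow> tamagawa v (EC3t a b) = 1"
proof -
  have three: "\<not> p dvd 3" using p3 prime_p primes_dvd_imp_eq[of p 3] by auto
  define k where "k = m div 3"
  \<comment> \<open>The choice gives 8m = 12e + 4j, so scaling by \<open>\<pi> ^ e\<close> leaves
    discriminant valuation 4j. Good reduction is j = 0, for m = 0 modulo 3; type IV* is j = 2, for m
    = 1; type IV is j = 1, for m = 2.\<close>
  define e where "e = (if m mod 3 = 2 then 2 * k + 1 else 2 * k)"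
  define j where "j = 2 * int m - 3 * int e"
  have "m = 3 * k + m mod 3" by (simp add: k_def)
  moreover have "m mod 3 = 0 \<or> m mod 3 = 1 \<or> m mod 3 = 2" by linarith
  ultimately consider (0) "m mod 3 = 0" "m = 3 * k" "e = 2 * k" | (1) "m mod 3 \<noteq> 0" "m = 3 * k + 1" "e = 2 * k"
    | (2) "m mod 3 \<noteq> 0" "m = 3 * k + 2" "e = 2 * k + 1"
    unfolding e_def by fastforce
  hence j: "m mod 3 = 0 \<Longrightarrow> j = 0" "m mod 3 \<noteq> 0 \<Longrightarrow> j = 1 \<or> j = 2" "0 \<le> j" "j \<le> 2"
    and je: "m mod 3 \<noteq> 0 \<Longrightarrow> 1 + int e \<le> int m" "m mod 3 \<noteq> 0 \<Longrightarrow> j + 1 + 4 * int e \<le> 3 * int m"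
    and em: "int e \<le> int m" "4 * int e \<le> 3 * int m"
    by (cases; simp add: j_def)+
  have "vunit v (of_int b)" using b by simp
  hence vb: "vex (of_int b) 0" by (simp add: vex_0_iff)
  have va: "vex (of_int a) (int m)" using nz by (simp add: vex_def v_of_int m_def)
  have vapow: "vge v (of_int a ^ n) (int n * int m)" for n
    using va by (auto simp: vex_def vge_def v_power)
  have "vex (of_int b * (of_int a * of_int a)) (0 + (int m + int m))"
    by (intro vex_mult va vb)
  hence v3: "vex (of_int (a^2 * b)) (j + 3 * int e)"
    by (simp add: j_def power2_eq_square algebra_simps)
  have v4: "vge v (of_int (-5 * a^3 * b)) (3 * int m)"
    using vge_mult[OF vapow[of 3], of "of_int (-5 * b)" 0] vint_of_int[of "-5 * b"]
    by (simp add: vint_iff algebra_simps del: vint_of_int)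
  have v6: "vge v (of_int (-(a^4 * b * (a + 7 * b)))) (2 * j + 6 * int e)"
    using vge_mult[OF vapow[of 4], of "of_int (-(b * (a + 7 * b)))" 0] vint_of_int[of "-(b * (a + 7 * b))"]
    by (simp add: vint_iff j_def mult.assoc del: vint_of_int)
  have mult: "multiplicity p b = 0" "multiplicity p (a - 27 * b) = 0"
    using b ndvd by (simp_all add: not_dvd_imp_multiplicity_0)
  have vd: "v (disc (EC3 a b)) = 12 * int e + 4 * j" "v (disc (EC3t a b)) = 12 * int e + 4 * j"
    by (simp_all add: v_disc_EC3[OF nz] v_disc_EC3t[OF nz] mult j_def flip: m_def)
  note nzd = v_disc_EC3(1)[OF nz] v_disc_EC3t(1)[OF nz]
  have small: "v (disc (EC3 a b)) < 12 * int e + 12" "v (disc (EC3t a b)) < 12 * int e + 12"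
    using j vd by auto
  have bad: "bad_reduction v (EC3 a b) \<longleftrightarrow> 12 * int e < v (disc (EC3 a b))"
    by (rule scaled_model(2)[OF EC3_def nzd(1) _ _ _ _ small(1)])
      (use j em vge_mono[OF vex_imp_vge[OF va]] vge_mono[OF vex_imp_vge[OF v3]] in auto)
  have badt: "bad_reduction v (EC3t a b) \<longleftrightarrow> 12 * int e < v (disc (EC3t a b))"
    by (rule scaled_model(2)[OF EC3t_def nzd(2) _ _ _ _ small(2)])
      (use j em vge_mono[OF vex_imp_vge[OF va]] vge_mono[OF vex_imp_vge[OF v3]] vge_mono[OF v4] vge_mono[OF v6] in auto)
  show "bad_reduction v (EC3 a b) \<longleftrightarrow> m mod 3 \<noteq> 0" "bad_reduction v (EC3t a b) \<longleftrightarrow> m mod 3 \<noteq> 0"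
    unfolding bad badt vd using j by auto
  {
    assume m: "m mod 3 \<noteq> 0"
    have v1: "vge v (of_int a) (1 + int e)" using vge_mono[OF vex_imp_vge[OF va]] je(1)[OF m] .
    have v4': "vge v (of_int (-5 * a^3 * b)) (j + 1 + 4 * int e)" using vge_mono[OF v4] je(2)[OF m] .
    \<comment> \<open>With \<open>a6 = 0\<close> the quadratic is \<open>\<eta>^2 + \<eta>\<close>,
      and 0 is a simple root.\<close>
    show "tamagawa v (EC3 a b) = 3"
      by (rule additive_reduction(1)[OF EC3_def nzd(1) j(2)[OF m] v1 v3 _ _ small(1), of 0]) (auto simp: vunit_def)
    have "m > 0" using m by (cases m) auto
    hence pa: "p dvd a" unfolding m_def using not_dvd_imp_multiplicity_0 by force
    \<comment> \<open>As \<open>p\<close> divides \<open>a\<close> but not \<open>b\<close>, the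
      quadratic is \<open>\<eta>^2 + \<eta> + 7\<close> modulo \<open>p\<close>;
      \<open>\<eta> = 3*z + 1\<close> turns it into \<open>9*(z^2 + z + 1)\<close>.\<close>
    have quot: "of_int (-(a^4 * b * (a + 7 * b))) / of_int (a^2 * b) ^ 2 = - (7 + of_int a / of_int b :: 'k)"
      using nz by (simp add: field_simps eval_nat_numeral)
    have ab: "vpos v (of_int a / of_int b)" using pa b by simp
    note T = additive_reduction[OF EC3t_def nzd(2) j(2)[OF m] v1 v3 v4' v6 small(2), unfolded quot]
    {
      assume "p mod 3 = 1"
      then obtain z where z: "p dvd z^2 + z + 1" using cube_root_of_unity_exists[OF prime_p] by blast
      have "vpos v (of_int (9 * (z^2 + z + 1)) + of_int a / of_int b)"
        using z by (intro vpos_add ab) (simp only: vpos_of_int dvd_mult)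
      also have "of_int (9 * (z^2 + z + 1)) + of_int a / of_int b =
          (of_int (3 * z + 1))^2 + of_int (3 * z + 1) - (- (7 + of_int a / of_int b :: 'k))"
        by (simp add: algebra_simps power2_eq_square)
      finally have root: "vpos v \<dots>" .
      have "\<not> p dvd 2 * (3 * z + 1) + 1"
      proof
        assume "p dvd 2 * (3 * z + 1) + 1"
        \<comment> \<open>The square of the derivative \<open>2*\<eta> + 1\<close> at this root is
          -27 modulo \<open>p\<close>, so a double root would mean \<open>p = 3\<close>.\<close>
        moreover have "3 ^ 3 = 36 * (z^2 + z + 1) - (2 * (3 * z + 1) + 1) * (2 * (3 * z + 1) + 1)"
          by (simp add: algebra_simps power2_eq_square)
        ultimately have "p dvd 3 ^ 3" using z by (metis dvd_diff dvd_mult dvd_mult2)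
        with three prime_p prime_dvd_power show False by blast
      qed
      hence "vunit v (of_int (2 * (3 * z + 1) + 1))" unfolding vunit_of_int .
      hence "vunit v (2 * of_int (3 * z + 1) + 1)" by simp
      from T(1)[OF vint_of_int root this] show "tamagawa v (EC3t a b) = 3" by simp
    next
      assume p2: "p mod 3 = 2"
      show "tamagawa v (EC3t a b) = 1"
      proof (rule T(2))
        fix \<eta> :: 'k assume \<eta>: "vint v \<eta>"
        show "\<not> vpos v (\<eta>^2 + \<eta> - - (7 + of_int a / of_int b))"
        proof
          assume "vpos v (\<eta>^2 + \<eta> - - (7 + of_int a / of_int b))"
          from vpos_diff[OF this ab] have "vpos v (\<eta>^2 + of_int 1 * \<eta> + of_int 7)" by (simp add: add.assoc)
          with \<eta> obtain i where "p dvd i^2 + 1 * i + 7" by (rule integral_root_residue)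
          also have "i^2 + 1 * i + 7 = (i - 1)^2 + 3 * (i - 1) + 3^2"
            by (simp add: algebra_simps power2_eq_square)
          finally show False using no_homogeneous_cube_root_of_unity[OF prime_p p2 three] by blast
        qed
      qed
    }
  }
qed

end

theorem theorem3p1:
  fixes a b p :: int and v :: "'k::field_char_0 \<Rightarrow> int"
  assumes "coprime a b" and "a > 0" and "b \<noteq> 0" and "a \<noteq> 27*b"
    and "is_Qp p v"
  shows
   "(0 < multiplicity p b \<longrightarrow>
       bad_reduction v (EC3 a b :: 'k ainv) \<and> bad_reduction v (EC3t a b :: 'k ainv) \<and>
       tamagawa v (EC3 a b :: 'k ainv) = 3 * multiplicity p b \<and>
       tamagawa v (EC3t a b :: 'k ainv) = multiplicity p b)
    \<and>
    (p \<noteq> 3 \<and> \<not> p dvd b \<longrightarrow>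
       (bad_reduction v (EC3 a b :: 'k ainv) \<longleftrightarrow>
          0 < multiplicity p (a - 27*b) \<or> multiplicity p a mod 3 \<noteq> 0) \<and>
       (bad_reduction v (EC3t a b :: 'k ainv) \<longleftrightarrow>
          0 < multiplicity p (a - 27*b) \<or> multiplicity p a mod 3 \<noteq> 0) \<and>
       (0 < multiplicity p (a - 27*b) \<and> p mod 6 = 1 \<longrightarrow>
          tamagawa v (EC3 a b :: 'k ainv) = multiplicity p (a - 27*b) \<and>
          tamagawa v (EC3t a b :: 'k ainv) = 3 * multiplicity p (a - 27*b)) \<and>
       (0 < multiplicity p (a - 27*b) \<and> p mod 6 \<in> {2, 5} \<longrightarrow>
          (even (multiplicity p (a - 27*b)) \<longrightarrow>
             tamagawa v (EC3 a b :: 'k ainv) = 2 \<and> tamagawa v (EC3t a b :: 'k ainv) = 2) \<and>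
          (odd (multiplicity p (a - 27*b)) \<longrightarrow>
             tamagawa v (EC3 a b :: 'k ainv) = 1 \<and> tamagawa v (EC3t a b :: 'k ainv) = 1)) \<and>
       (multiplicity p a mod 3 \<noteq> 0 \<longrightarrow>
          tamagawa v (EC3 a b :: 'k ainv) = 3 \<and>
          (p mod 6 = 1 \<longrightarrow> tamagawa v (EC3t a b :: 'k ainv) = 3) \<and>
          (p mod 6 \<in> {2, 5} \<longrightarrow> tamagawa v (EC3t a b :: 'k ainv) = 1)))"
proof -
  interpret padic_field p v using assms(5) by unfold_locales
  have nz: "a \<noteq> 0" "b \<noteq> 0" "a \<noteq> 27 * b" using assms by auto
  have not_unit: "\<not> is_unit p" using prime_p by auto
  have pos_iff: "0 < multiplicity p x \<longleftrightarrow> p dvd x" if "x \<noteq> 0" for x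
    using multiplicity_gt_zero_iff[OF that not_unit] .
  have mod6: "p mod 6 = 1 \<Longrightarrow> p mod 3 = 1" "p mod 6 \<in> {2, 5} \<Longrightarrow> p mod 3 = 2"
    by (auto, presburger+)
  show ?thesis
  proof (intro conjI[of "_ \<longrightarrow> _" "_ \<longrightarrow> _"] impI, goal_cases)
    case 1
    with EC3_dvd_b[OF nz assms(1)] nz show ?case by (simp add: pos_iff)
  next
    case 2
    hence p3: "p \<noteq> 3" and b: "\<not> p dvd b" by auto
    show ?case
    proof (cases "p dvd a - 27 * b")
      case True
      \<comment> \<open>Since \<open>p\<close> divides neither 3 nor \<open>b\<close>, it cannot
        divide both \<open>a\<close> and \<open>a - 27*b\<close>; the multiplicative and additive
        cases exclude each other.\<close>
      have "\<not> p dvd a"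
      proof
        assume "p dvd a"
        from dvd_diff[OF this True] have "p dvd a - (a - 27 * b)" .
        hence "p dvd 3 ^ 3 * b" by simp
        with b prime_p have "p dvd 3" by (meson prime_dvd_mult_iff prime_dvd_power)
        with p3 prime_p primes_dvd_imp_eq[of p 3] show False by auto
      qed
      hence "multiplicity p a = 0" by (rule not_dvd_imp_multiplicity_0)
      with EC3_dvd_a_27b[OF nz b p3 True] True nz mod6 pos_iff[of "a - 27 * b"] show ?thesis by auto
    next
      case False
      hence "multiplicity p (a - 27 * b) = 0" by (rule not_dvd_imp_multiplicity_0)
      with EC3_not_dvd[OF nz b p3 False] mod6 show ?thesis by auto
    qed
  qed
qed

end
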